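(* Let $R_0>3/2$ be fixed, and let $u\in\dot H^1(\mathbb{R}^3)$ (a vector field with values in $\mathbb{R}^3$) be a solution of the stationary Navier--Stokes equations $$-\Delta u+u\cdot\nabla u+\nabla P=0,\qquad \nabla\cdot u=0\qquad\text{in }\mathbb{R}^3 .$$ Let $\overline\varepsilon(x)=\frac32\,\frac{R_0}{|x|}$, a scalar function defined on $\{x\in\mathbb{R}^3:|x|\ge R_0\}$. If in addition $$\mathbf 1_{\{|x|\ge R_0\}}\,u\in L^{\frac92+\overline\varepsilon(\cdot)}(\mathbb{R}^3),$$ then $u\equiv 0$.
   Context: A vector field $u$ is called a solution of the stationary Navier--Stokes equations if there is an associated scalar pressure $P$ on $\mathbb{R}^3$ such that both equations hold in the sense of distributions. The homogeneous Sobolev space $\dot H^1(\mathbb{R}^3)$ is understood with the convention that the Sobolev embedding $\dot H^1(\mathbb{R}^3)\subset L^6(\mathbb{R}^3)$ holds; that is, $u\in L^6(\mathbb{R}^3)$ and $\nabla u\in L^2(\mathbb{R}^3)$. Variable exponent Lebesgue spaces: for a set $\Omega\subseteq\mathbb{R}^n$ and a measurable $p(\cdot):\Omega\to[1,+\infty)$ with $1<\operatorname{ess\,inf}_\Omega p\le\operatorname{ess\,sup}_\Omega p<+\infty$, the space $L^{p(\cdot)}(\Omega)$ is the set of measurable functions $u$ on $\Omega$ such that $$\|u\|_{L^{p(\cdot)}(\Omega)}:=\inf\Big\{\lambda>0:\ \int_\Omega \Big|\frac{u(x)}{\lambda}\Big|^{p(x)}dx\le 1\Big\}<+\infty ,$$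 with the convention that the infimum of the empty set is $+\infty$. Since $\overline\varepsilon$ is defined only for $|x|\ge R_0$ and $\mathbf 1_{\{|x|\ge R_0\}}u$ vanishes elsewhere, the integrability condition means that the restriction of $u$ to $\{|x|\ge R_0\}$ belongs to $L^{\frac92+\overline\varepsilon(\cdot)}(\{|x|\ge R_0\})$. *)

theory Defs
  imports "HOL-Analysis.Analysis" "HOL-Probability.Essential_Supremum"
begin

section \<open>Test functions and distributions\<close>

definition partial_deriv :: "'n \<Rightarrow> (real^'n \<Rightarrow> real) \<Rightarrow> real^'n::finite \<Rightarrow> real"
  where "partial_deriv i f x = frechet_derivative f (at x) (axis i 1)"

text \<open>The iterated partial derivative
  \<open>\<partial>\<^bsub>i\<^sub>1\<^esub> \<dots> \<partial>\<^bsub>i\<^sub>k\<^esub> f\<close> for the multi-index given as the list \<open>[i\<^sub>1, \<dots>, i\<^sub>k]\<close>.\<close>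

definition iter_partial :: "'n list \<Rightarrow> (real^'n \<Rightarrow> real) \<Rightarrow> real^'n::finite \<Rightarrow> real"
  where "iter_partial is f = foldr partial_deriv is f"

text \<open>Since \<^const>\<open>frechet_derivative\<close> is a total operator, smoothness is expressed by requiring
  every iterated partial derivative to be itself differentiable on the whole space.\<close>

definition smooth_fun :: "(real^'n::finite \<Rightarrow> real) \<Rightarrow> bool"
  where "smooth_fun f \<longleftrightarrow> (\<forall>is. iter_partial is f differentiable_on UNIV)"

definition fun_supp :: "(real^'n::finite \<Rightarrow> real) \<Rightarrow> (real^'n) set"
  where "fun_supp f = closure {x. f x \<noteq> 0}"

definition test_functions :: "(real^'n::finite \<Rightarrow> real) set"
  where "test_functions = {\<phi>. smooth_fun \<phi> \<and> compact (fun_supp \<phi>)}"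

text \<open>A distribution is a functional of which only the values on test functions are relevant. Its
  continuity is stated by the usual seminorm estimates on each compact set.\<close>

type_synonym 'n functional = "(real^'n \<Rightarrow> real) \<Rightarrow> real"

definition distribution :: "'n::finite functional \<Rightarrow> bool"
  where "distribution T \<longleftrightarrow>
    (\<forall>\<phi>\<in>test_functions. \<forall>\<psi>\<in>test_functions. T (\<lambda>x. \<phi> x + \<psi> x) = T \<phi> + T \<psi>) \<and>
    (\<forall>\<phi>\<in>test_functions. \<forall>c. T (\<lambda>x. c * \<phi> x) = c * T \<phi>) \<and>
    (\<forall>K. compact K \<longrightarrow> (\<exists>C N. \<forall>\<phi>\<in>test_functions. fun_supp \<phi> \<subseteq> K \<longrightarrow>
        \<bar>T \<phi>\<bar> \<le> C * (\<Sum>is | length is \<le> N. SUP x. \<bar>iter_partial is \<phi> x\<bar>)))"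

definition dist_deriv :: "'n \<Rightarrow> 'n::finite functional \<Rightarrow> 'n functional"
  where "dist_deriv i T = (\<lambda>\<phi>. - T (partial_deriv i \<phi>))"

definition dist_laplacian :: "'n::finite functional \<Rightarrow> 'n functional"
  where "dist_laplacian T = (\<lambda>\<phi>. \<Sum>j\<in>UNIV. dist_deriv j (dist_deriv j T) \<phi>)"

definition locally_integrable :: "(real^'n::finite \<Rightarrow> real) \<Rightarrow> bool"
  where "locally_integrable f \<longleftrightarrow>
    f \<in> borel_measurable lebesgue \<and> (\<forall>K. compact K \<longrightarrow> set_integrable lebesgue K f)"

text \<open>The distribution of a function. The Bochner integral is 0 for non-integrable integrands, so
  this is meaningful only for locally integrable \<open>f\<close>.\<close>

definition regular_dist :: "(real^'n::finite \<Rightarrow> real) \<Rightarrow> 'n functional"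
  where "regular_dist f = (\<lambda>\<phi>. LINT x|lebesgue. f x * \<phi> x)"

text \<open>\<open>G\<close> is the Jacobian matrix of \<open>u\<close> in the sense of distributions:
  \<open>G x $ i $ j\<close> is the \<open>j\<close>-th weak partial derivative of the \<open>i\<close>-th component.\<close>

definition has_weak_gradient :: "(real^'n::finite \<Rightarrow> real^'m::finite) \<Rightarrow> (real^'n \<Rightarrow> real^'n^'m) \<Rightarrow> bool"
  where "has_weak_gradient u G \<longleftrightarrow>
    (\<forall>i. locally_integrable (\<lambda>x. u x $ i)) \<and>
    (\<forall>i j. locally_integrable (\<lambda>x. G x $ i $ j)) \<and>
    (\<forall>i j. \<forall>\<phi>\<in>test_functions.
       dist_deriv j (regular_dist (\<lambda>x. u x $ i)) \<phi> = regular_dist (\<lambda>x. G x $ i $ j) \<phi>)"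

section \<open>Function spaces\<close>

text \<open>Elements of these spaces are functions, not classes modulo null sets.\<close>

definition Lebesgue_space :: "real \<Rightarrow> ('a::euclidean_space \<Rightarrow> 'b::euclidean_space) set"
  where "Lebesgue_space p =
    {f. f \<in> borel_measurable lebesgue \<and> integrable lebesgue (\<lambda>x. norm (f x) powr p)}"

text \<open>The homogeneous Sobolev space on \<open>\<real>\<^sup>3\<close>, with the convention that
  its elements belong to \<open>L\<^sup>6\<close>.\<close>

definition homogeneous_H1 :: "(real^3 \<Rightarrow> real^3) set"
  where "homogeneous_H1 =
    {u. u \<in> Lebesgue_space 6 \<and> (\<exists>G. has_weak_gradient u G \<and> G \<in> Lebesgue_space 2)}"

definition admissible_exponent :: "'a::euclidean_space set \<Rightarrow> ('a \<Rightarrow> real) \<Rightarrow> bool"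
  where "admissible_exponent \<Omega> p \<longleftrightarrow>
    p \<in> borel_measurable (lebesgue_on \<Omega>) \<and> (\<forall>x\<in>\<Omega>. 1 \<le> p x) \<and>
    \<comment> \<open>the essential infimum, expressed through the essential supremum of \<open>- p\<close>\<close>
    1 < - esssup (lebesgue_on \<Omega>) (\<lambda>x. - ereal (p x)) \<and>
    esssup (lebesgue_on \<Omega>) (\<lambda>x. ereal (p x)) < \<infinity>"

text \<open>The Luxemburg norm takes values in the extended nonnegative reals, where the infimum of the
  empty set is \<open>\<infinity>\<close>. The values of \<open>f\<close> and \<open>p\<close> outside \<open>\<Omega>\<close>
  are irrelevant. The exponent is meant to satisfy \<^const>\<open>admissible_exponent\<close>.\<close>

definition var_norm :: "'a::euclidean_space set \<Rightarrow> ('a \<Rightarrow> real) \<Rightarrow> ('a \<Rightarrow> 'b::euclidean_space) \<Rightarrow> ennreal"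
  where "var_norm \<Omega> p f =
    (INF l\<in>{l::real. 0 < l \<and>
        (\<integral>\<^sup>+x. ennreal (norm (f x /\<^sub>R l) powr p x) \<partial>lebesgue_on \<Omega>) \<le> 1}. ennreal l)"

definition var_Lebesgue_space ::
    "'a::euclidean_space set \<Rightarrow> ('a \<Rightarrow> real) \<Rightarrow> ('a \<Rightarrow> 'b::euclidean_space) set"
  where "var_Lebesgue_space \<Omega> p =
    {f. f \<in> borel_measurable (lebesgue_on \<Omega>) \<and> var_norm \<Omega> p f < \<infinity>}"

definition eps_bar :: "real \<Rightarrow> real^3 \<Rightarrow> real"
  where "eps_bar R0 x = 3/2 * (R0 / norm x)"

lemma admissible_eps_bar:
  assumes "R0 > 3/2"
  shows "admissible_exponent {x. R0 \<le> norm x} (\<lambda>x. 9/2 + eps_bar R0 x)"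
proof -
  let ?S = "{x::real^3. R0 \<le> norm x}"
  let ?p = "\<lambda>x::real^3. 9/2 + eps_bar R0 x"
  have "?p \<in> borel_measurable borel"
    unfolding eps_bar_def by measurable
  then have "?p \<in> borel_measurable lebesgue"
    by (intro measurable_completion) simp
  then have m: "?p \<in> borel_measurable (lebesgue_on ?S)"
    by (rule measurable_restrict_space1)
  have b: "9/2 \<le> ?p x \<and> ?p x \<le> 6" if "x \<in> ?S" for x
  proof -
    have "0 < R0" "0 < norm x" "R0 \<le> norm x" using that assms by auto
    then have "0 \<le> R0 / norm x" "R0 / norm x \<le> 1"
      by (simp_all only: divide_le_eq_1_pos zero_le_divide_iff) auto
    then show ?thesis by (simp add: eps_bar_def)
  qed
  have sp: "space (lebesgue_on ?S) = ?S"
    by (simp add: space_restrict_space)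
  have u: "esssup (lebesgue_on ?S) (\<lambda>x. ereal (?p x)) \<le> ereal 6"
    using b m by (intro esssup_I) (auto simp: sp intro!: AE_I2)
  have "(\<lambda>x. - ereal (?p x)) \<in> borel_measurable (lebesgue_on ?S)"
    by (intro borel_measurable_uminus_ereal borel_measurable_ereal m)
  then have l: "esssup (lebesgue_on ?S) (\<lambda>x. - ereal (?p x)) \<le> ereal (-(9/2))"
    using b by (intro esssup_I) (auto simp: sp intro!: AE_I2)
  then have "- ereal (-(9/2)) \<le> - esssup (lebesgue_on ?S) (\<lambda>x. - ereal (?p x))"
    by (subst ereal_minus_le_minus)
  then have "1 < - esssup (lebesgue_on ?S) (\<lambda>x. - ereal (?p x))"
    by (rule less_le_trans[rotated]) (simp add: one_ereal_def)
  moreover have "esssup (lebesgue_on ?S) (\<lambda>x. ereal (?p x)) < \<infinity>"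
    using u by (rule le_less_trans) simp
  moreover have "\<forall>x\<in>?S. 1 \<le> ?p x" using b by force
  ultimately show ?thesis
    unfolding admissible_exponent_def using m by blast
qed

section \<open>The stationary Navier--Stokes equations\<close>

text \<open>The equations \<open>- \<Delta>u + u \<cdot> \<nabla>u + \<nabla>P = 0\<close> and \<open>\<nabla> \<cdot> u = 0\<close>, componentwise in the
  sense of distributions. The pressure may be any distribution. With \<open>G\<close> the Jacobian of \<open>u\<close>,
  the \<open>i\<close>-th component of \<open>u \<cdot> \<nabla>u\<close> is \<open>\<Sum>\<^sub>j u\<^sub>j \<partial>\<^sub>j u\<^sub>i = (G *v u)\<^sub>i\<close>; its local
  integrability, needed for it to define a distribution, is automatic for
  \<open>u \<in> homogeneous_H1\<close>.\<close>

definition stationary_NS_solution :: "(real^3 \<Rightarrow> real^3) \<Rightarrow> bool"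
  where "stationary_NS_solution u \<longleftrightarrow>
    (\<exists>G P. has_weak_gradient u G \<and> distribution P \<and>
      (\<forall>i. locally_integrable (\<lambda>x. (G x *v u x) $ i)) \<and>
      (\<forall>i. \<forall>\<phi>\<in>test_functions.
         - dist_laplacian (regular_dist (\<lambda>x. u x $ i)) \<phi>
         + regular_dist (\<lambda>x. (G x *v u x) $ i) \<phi>
         + dist_deriv i P \<phi> = 0) \<and>
      (\<forall>\<phi>\<in>test_functions. (\<Sum>i\<in>UNIV. dist_deriv i (regular_dist (\<lambda>x. u x $ i)) \<phi>) = 0))"

end

theory Submission
  imports Defs "HOL-Real_Asymp.Real_Asymp"
begin

text \<open>The variable exponent enters only through a growth bound. Where \<open>|u| \<ge> exp (- |x|)\<close>, the factor
\<open>|u|\<close> to the power \<open>- (3/2) R\<^sub>0 / |x|\<close> is at most \<open>exp (3 R\<^sub>0 / 2)\<close>, so outside a ball \<open>|u|\<close> to the power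
\<open>9/2\<close> is controlled by the finite modular, up to a rapidly decaying term. Young's inequality turns
this into \<open>\<integral> |u|\<^sup>4 = o(r\<^bsup>1/3\<^esup>)\<close> over the ball of radius \<open>r\<close> (\<open>fourth_power_growth\<close>). What remains is a Liouville theorem: a weak
stationary flow with square integrable gradient and this growth vanishes (\<open>flow_vanishes\<close>).

The Liouville theorem is an energy argument. Testing the equation with \<open>\<phi> u\<close>, where \<open>\<phi>\<close> is a cutoff at
scale \<open>R\<close>, would involve the pressure, whose control in Lebesgue spaces is usually taken from the
Calderon--Zygmund theory. Here the pressure is removed by an explicit divergence-free test field.
Let \<open>K\<^sub>s\<close> be the mollifier at scale \<open>s\<close> and let \<open>N\<close> be the smooth kernel supported in the ball of radius \<open>R\<close> with
\<open>- \<Delta>N = K\<^sub>a - K\<^sub>R\<close> (\<open>laplacian_newton\<close>). The field \<open>b = N * u\<close> is divergence-free, so with the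
antisymmetric matrix \<open>\<omega>\<^sub>i\<^sub>j = \<partial>\<^sub>j b\<^sub>i - \<partial>\<^sub>i b\<^sub>j\<close> the field
  \<open>\<Phi>\<^sub>i = - \<Sum>\<^sub>j \<partial>\<^sub>j (\<phi> \<omega>\<^sub>i\<^sub>j) = \<phi> (K\<^sub>a * u\<^sub>i - K\<^sub>R * u\<^sub>i) - \<Sum>\<^sub>j \<partial>\<^sub>j\<phi> \<omega>\<^sub>i\<^sub>j\<close>
is smooth, compactly supported and divergence-free. Its leading part is \<open>\<phi> u\<close> as \<open>a \<rightarrow> 0\<close>, and the
gradient of the rest is bounded in \<open>L\<^sup>2\<close> by \<open>C/R\<close> times the \<open>L\<^sup>2\<close> norm of \<open>u\<close> on the ball of radius \<open>2 R\<close>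
(\<open>energy_step\<close>). The only singular integral estimate involved is the \<open>L\<^sup>2\<close> bound of second
derivatives by the Laplacian, which is an integration by parts (\<open>hessian_L2\<close>); it is enough because
\<open>u \<otimes> u\<close> is locally in \<open>L\<^sup>2\<close>.

As \<open>a \<rightarrow> 0\<close> this gives (\<open>energy_inequality\<close>)
  \<open>\<integral> \<phi> |\<nabla>u|\<^sup>2 \<le> (K/R) \<parallel>u\<parallel>\<^sub>2 (\<parallel>\<nabla>u\<parallel>\<^sub>2 + \<parallel>u\<parallel>\<^sub>4\<^sup>2)\<close>
with the norms of \<open>u\<close> over the ball of radius \<open>2 R\<close> and that of \<open>\<nabla>u\<close> over the whole space. The
right-hand side tends to 0 as \<open>R \<rightarrow> \<infinity>\<close> because the \<open>L\<^sup>4\<close> mass grows more slowly than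
\<open>R\<^bsup>1/3\<^esup>\<close>. Hence \<open>\<nabla>u = 0\<close>, every mollification of \<open>u\<close> is constant, and the growth bound makes the constant 0.\<close>

section \<open>Smooth functions and their partial derivatives\<close>

lemma partial_deriv_eq:
  assumes "(f has_derivative f') (at x)"
  shows "partial_deriv i f x = f' (axis i 1)"
  using frechet_derivative_at[OF assms] by (simp add: partial_deriv_def)

lemma iter_partial_snoc: "iter_partial (is @ [i]) f = iter_partial is (partial_deriv i f)"
  by (simp add: iter_partial_def)

text \<open>Smoothness quantifies over all iterated derivatives, so it is proved coinductively: it suffices to
place the function in a class of differentiable functions that is closed under partial derivatives.\<close>

lemma smooth_coinduct:
  assumes "f \<in> A"
    and "\<And>g x. g \<in> A \<Longrightarrow> g differentiable (at x)"
    and "\<And>g i. g \<in> A \<Longrightarrow> partial_deriv i g \<in> A"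
  shows "smooth_fun f"
proof -
  have "iter_partial is f \<in> A" for "is"
    using assms(1,3) by (induction "is") (auto simp: iter_partial_def)
  with assms(2) show ?thesis
    by (auto simp: smooth_fun_def differentiable_on_def)
qed

lemma smooth_fun_differentiable: "smooth_fun f \<Longrightarrow> f differentiable (at x)"
  unfolding smooth_fun_def differentiable_on_def
  by (drule spec[of _ "[]"]) (simp add: iter_partial_def)

lemma smooth_fun_partial_deriv: "smooth_fun f \<Longrightarrow> smooth_fun (partial_deriv i f)"
  unfolding smooth_fun_def by (metis iter_partial_snoc)

lemma smooth_fun_has_derivative:
  assumes "smooth_fun f"
  shows "(f has_derivative (\<lambda>h. \<Sum>i\<in>UNIV. partial_deriv i f x * h $ i)) (at x)"
proof -
  obtain f' where f': "(f has_derivative f') (at x)"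
    using smooth_fun_differentiable[OF assms] by (auto simp: differentiable_def)
  have lin: "linear f'" using f' by (rule has_derivative_linear)
  have "f' h = (\<Sum>i\<in>UNIV. partial_deriv i f x * h $ i)" for h
  proof -
    have "f' h = f' (\<Sum>i\<in>UNIV. h $ i *\<^sub>R axis i 1)"
      using basis_expansion[of h] by (simp add: scalar_mult_eq_scaleR)
    also have "\<dots> = (\<Sum>i\<in>UNIV. h $ i * f' (axis i 1))"
      by (simp add: linear_sum[OF lin] linear_scale[OF lin])
    finally show ?thesis by (simp add: partial_deriv_eq[OF f'] mult.commute)
  qed
  then have "f' = (\<lambda>h. \<Sum>i\<in>UNIV. partial_deriv i f x * h $ i)" by blast
  with f' show ?thesis by simp
qed

lemma smooth_fun_isCont: "smooth_fun f \<Longrightarrow> isCont f x"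
  using smooth_fun_differentiable differentiable_imp_continuous_within by blast

lemma smooth_fun_continuous: "smooth_fun f \<Longrightarrow> continuous_on UNIV f"
  by (simp add: smooth_fun_isCont continuous_at_imp_continuous_on)

lemma partial_deriv_const: "partial_deriv i (\<lambda>x. c) = (\<lambda>x. 0)"
  by (rule ext, subst partial_deriv_eq[OF has_derivative_const]) simp

lemma smooth_fun_const: "smooth_fun (\<lambda>x. c)"
  by (rule smooth_coinduct[of _ "range (\<lambda>c x. c)"]) (auto simp: partial_deriv_const)

lemma partial_deriv_component:
  fixes i j :: "'n::finite"
  shows "partial_deriv i (\<lambda>x. x $ j) = (\<lambda>x. if i = j then 1 else 0)"
proof
  fix x :: "real^'n"
  have "((\<lambda>x::real^'n. x $ j) has_derivative (\<lambda>h. h $ j)) (at x)"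
    by (intro bounded_linear_imp_has_derivative bounded_linear_vec_nth)
  then show "partial_deriv i (\<lambda>x. x $ j) x = (if i = j then 1 else 0)"
    by (auto simp: partial_deriv_eq axis_def)
qed

lemma smooth_fun_component:
  fixes j :: "'n::finite"
  shows "smooth_fun (\<lambda>x. x $ j)"
proof (rule smooth_coinduct[of _ "insert (\<lambda>x. x $ j) (range (\<lambda>c x. c))"])
  fix g :: "real^'n \<Rightarrow> real" and x
  assume "g \<in> insert (\<lambda>x. x $ j) (range (\<lambda>c x. c))"
  then show "g differentiable at x"
    using bounded_linear_imp_differentiable[OF bounded_linear_vec_nth[of j]] by auto
qed (auto simp: partial_deriv_const partial_deriv_component)

lemma partial_deriv_add:
  assumes "f differentiable (at x)" "g differentiable (at x)"
  shows "partial_deriv i (\<lambda>x. f x + g x) x = partial_deriv i f x + partial_deriv i g x"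
proof -
  obtain f' g' where "(f has_derivative f') (at x)" "(g has_derivative g') (at x)"
    using assms by (auto simp: differentiable_def)
  then show ?thesis
    by (simp add: partial_deriv_eq partial_deriv_eq[OF has_derivative_add])
qed

lemma partial_deriv_mult:
  assumes "f differentiable (at x)" "g differentiable (at x)"
  shows "partial_deriv i (\<lambda>x. f x * g x) x = partial_deriv i f x * g x + f x * partial_deriv i g x"
proof -
  obtain f' g' where "(f has_derivative f') (at x)" "(g has_derivative g') (at x)"
    using assms by (auto simp: differentiable_def)
  then show ?thesis
    by (simp add: partial_deriv_eq partial_deriv_eq[OF has_derivative_mult])
qed

text \<open>The family is closed under differentiation up to linear combinations, and every member is flat at 0;
this makes bump functions built from it smooth.\<close>

definition flat :: "nat \<Rightarrow> real \<Rightarrow> real"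
  where "flat k t = (if t > 0 then exp (- 1 / t) / t ^ k else 0)"

lemma flat_nonneg: "flat k t \<ge> 0"
  by (simp add: flat_def)

lemma flat_mono: "s \<le> t \<Longrightarrow> flat 0 s \<le> flat 0 t"
  by (auto simp: flat_def frac_le)

lemma flat_tendsto_0: "(flat k \<longlongrightarrow> 0) (at_right 0)"
proof -
  have "((\<lambda>t::real. inverse t ^ k / exp (inverse t)) \<longlongrightarrow> 0) (at_right 0)"
    by (rule filterlim_compose[OF tendsto_power_div_exp_0 filterlim_inverse_at_top_right])
  then show ?thesis
    by (rule Lim_transform_eventually)
      (auto simp: flat_def eventually_at_filter exp_minus field_simps intro!: always_eventually)
qed

lemma flat_has_derivative:
  "(flat k has_real_derivative (flat (k + 2) t - real k * flat (k + 1) t)) (at t)"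
proof (cases t "0::real" rule: linorder_cases)
  case less
  have "((\<lambda>t. 0) has_real_derivative 0) (at t)" by simp
  then have "(flat k has_real_derivative 0) (at t)"
    by (rule has_field_derivative_transform_within_open[of _ _ _ "{..<0}"])
      (use less in \<open>auto simp: flat_def\<close>)
  then show ?thesis using less by (simp add: flat_def)
next
  case greater
  have "((\<lambda>t. exp (- 1 / t) / t ^ k) has_real_derivative
      (exp (- 1 / t) * (1 / t\<^sup>2) * t ^ k - exp (- 1 / t) * (real k * t ^ (k - 1))) / (t ^ k * t ^ k)) (at t)"
    using greater by (auto intro!: derivative_eq_intros simp: power2_eq_square)
  also have "(exp (- 1 / t) * (1 / t\<^sup>2) * t ^ k - exp (- 1 / t) * (real k * t ^ (k - 1))) / (t ^ k * t ^ k)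
      = flat (k + 2) t - real k * flat (k + 1) t"
  proof (cases k)
    case (Suc n)
    show ?thesis using greater unfolding Suc
      by (simp add: flat_def divide_simps power2_eq_square) (simp add: algebra_simps)
  qed (use greater in \<open>simp add: flat_def power2_eq_square\<close>)
  finally have "((\<lambda>t. exp (- 1 / t) / t ^ k) has_real_derivative
      (flat (k + 2) t - real k * flat (k + 1) t)) (at t)" .
  then show ?thesis
    by (rule has_field_derivative_transform_within_open[of _ _ _ "{0<..}"])
      (use greater in \<open>auto simp: flat_def\<close>)
next
  case equal
  have "((\<lambda>h. flat k h / h) \<longlongrightarrow> 0) (at_right 0)"
    by (rule Lim_transform_eventually[OF flat_tendsto_0[of "Suc k"]])
      (auto simp: flat_def eventually_at_filter field_simps intro!: always_eventually)
  moreover have "((\<lambda>h. flat k h / h) \<longlongrightarrow> 0) (at_left 0)"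
    by (rule Lim_transform_eventually[OF tendsto_const])
      (auto simp: flat_def eventually_at_filter intro!: always_eventually)
  ultimately have "((\<lambda>h. flat k h / h) \<longlongrightarrow> 0) (at 0)"
    by (rule filterlim_split_at[rotated])
  then show ?thesis using equal by (simp add: DERIV_def flat_def)
qed

text \<open>Closing the smooth functions and the bump profiles under sums and products gives a class that the
product rule maps into itself. Smoothness of sums, of products and of the bump functions all follow
from this one application of \<open>smooth_coinduct\<close>.\<close>

inductive smooth_algebra :: "(real^'n::finite \<Rightarrow> real) \<Rightarrow> bool" where
  base: "smooth_fun f \<Longrightarrow> smooth_algebra f"
| flat: "smooth_algebra (\<lambda>x. flat k (1 - x \<bullet> x))"
| add: "smooth_algebra f \<Longrightarrow> smooth_algebra g \<Longrightarrow> smooth_algebra (\<lambda>x. f x + g x)"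
| mult: "smooth_algebra f \<Longrightarrow> smooth_algebra g \<Longrightarrow> smooth_algebra (\<lambda>x. f x * g x)"

lemma flat_ball_has_derivative:
  "((\<lambda>x. flat k (1 - x \<bullet> x)) has_derivative
     (\<lambda>h. (flat (k + 2) (1 - x \<bullet> x) - real k * flat (k + 1) (1 - x \<bullet> x)) * (- 2 * (x \<bullet> h)))) (at x)"
proof -
  have 1: "((\<lambda>x. 1 - x \<bullet> x) has_derivative (\<lambda>h. - 2 * (x \<bullet> h))) (at x)"
    by (auto intro!: derivative_eq_intros simp: inner_commute)
  have 2: "(flat k has_derivative (\<lambda>h. (flat (k + 2) (1 - x \<bullet> x) - real k * flat (k + 1) (1 - x \<bullet> x)) * h))
      (at (1 - x \<bullet> x))"
    using flat_has_derivative by (simp add: has_field_derivative_def)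
  show ?thesis using has_derivative_compose[OF 1 2] by simp
qed

lemma partial_deriv_flat_ball:
  "partial_deriv i (\<lambda>x. flat k (1 - x \<bullet> x)) =
    (\<lambda>x. (flat (k + 2) (1 - x \<bullet> x) + (- real k) * flat (k + 1) (1 - x \<bullet> x)) * ((- 2) * x $ i))"
  by (rule ext, subst partial_deriv_eq[OF flat_ball_has_derivative]) (simp add: inner_axis)

lemma smooth_algebra_closed:
  "smooth_algebra f \<Longrightarrow> (\<forall>x. f differentiable (at x)) \<and> smooth_algebra (partial_deriv i f)"
proof (induction rule: smooth_algebra.induct)
  case (base f)
  then show ?case
    by (auto intro: smooth_fun_differentiable smooth_fun_partial_deriv smooth_algebra.base)
next
  case (flat k)
  show ?case
  proof (intro conjI allI)
    show "(\<lambda>x. flat k (1 - x \<bullet> x)) differentiable (at x)" for x :: "real^'n"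
      using flat_ball_has_derivative unfolding differentiable_def by blast
    show "smooth_algebra (partial_deriv i (\<lambda>x. flat k (1 - x \<bullet> x)))"
      unfolding partial_deriv_flat_ball
      by (rule smooth_algebra.intros smooth_fun_const smooth_fun_component)+
  qed
next
  case (add f g)
  then have "partial_deriv i (\<lambda>x. f x + g x) = (\<lambda>x. partial_deriv i f x + partial_deriv i g x)"
    by (auto simp: partial_deriv_add)
  with add show ?case by (auto intro: smooth_algebra.add)
next
  case (mult f g)
  then have "partial_deriv i (\<lambda>x. f x * g x) =
      (\<lambda>x. partial_deriv i f x * g x + f x * partial_deriv i g x)"
    by (auto simp: partial_deriv_mult)
  with mult show ?case by (auto intro: smooth_algebra.add smooth_algebra.mult)
qed

lemma smooth_algebra_smooth: "smooth_algebra f \<Longrightarrow> smooth_fun f"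
  by (rule smooth_coinduct[of _ "Collect smooth_algebra"]) (use smooth_algebra_closed in auto)

lemma smooth_fun_flat_ball: "smooth_fun (\<lambda>x. flat k (1 - x \<bullet> x))"
  by (intro smooth_algebra_smooth smooth_algebra.flat)

lemma smooth_fun_add: "smooth_fun f \<Longrightarrow> smooth_fun g \<Longrightarrow> smooth_fun (\<lambda>x. f x + g x)"
  by (rule smooth_algebra_smooth, rule smooth_algebra.add; rule smooth_algebra.base)

lemma smooth_fun_mult: "smooth_fun f \<Longrightarrow> smooth_fun g \<Longrightarrow> smooth_fun (\<lambda>x. f x * g x)"
  by (rule smooth_algebra_smooth, rule smooth_algebra.mult; rule smooth_algebra.base)

lemma smooth_fun_cmult: "smooth_fun f \<Longrightarrow> smooth_fun (\<lambda>x. c * f x)"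
  by (intro smooth_fun_mult smooth_fun_const)

lemma smooth_fun_uminus: "smooth_fun f \<Longrightarrow> smooth_fun (\<lambda>x. - f x)"
  using smooth_fun_cmult[of f "-1"] by simp

lemma smooth_fun_diff: "smooth_fun f \<Longrightarrow> smooth_fun g \<Longrightarrow> smooth_fun (\<lambda>x. f x - g x)"
  using smooth_fun_add[of f "\<lambda>x. - g x"] by (simp add: smooth_fun_uminus)

lemma smooth_fun_sum: "(\<And>j. j \<in> S \<Longrightarrow> smooth_fun (f j)) \<Longrightarrow> smooth_fun (\<lambda>x. \<Sum>j\<in>S. f j x)"
  by (induction S rule: infinite_finite_induct) (auto intro: smooth_fun_const smooth_fun_add)

lemma partial_deriv_smooth_add:
  "smooth_fun f \<Longrightarrow> smooth_fun g \<Longrightarrow>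
    partial_deriv i (\<lambda>x. f x + g x) = (\<lambda>x. partial_deriv i f x + partial_deriv i g x)"
  by (simp add: fun_eq_iff partial_deriv_add smooth_fun_differentiable)

lemma partial_deriv_smooth_mult:
  "smooth_fun f \<Longrightarrow> smooth_fun g \<Longrightarrow>
    partial_deriv i (\<lambda>x. f x * g x) = (\<lambda>x. partial_deriv i f x * g x + f x * partial_deriv i g x)"
  by (simp add: fun_eq_iff partial_deriv_mult smooth_fun_differentiable)

lemma partial_deriv_smooth_cmult:
  "smooth_fun f \<Longrightarrow> partial_deriv i (\<lambda>x. c * f x) = (\<lambda>x. c * partial_deriv i f x)"
  by (simp add: partial_deriv_smooth_mult smooth_fun_const partial_deriv_const)

lemma partial_deriv_smooth_uminus:
  "smooth_fun f \<Longrightarrow> partial_deriv i (\<lambda>x. - f x) = (\<lambda>x. - partial_deriv i f x)"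
  using partial_deriv_smooth_cmult[of f i "-1"] by simp

lemma partial_deriv_smooth_diff:
  "smooth_fun f \<Longrightarrow> smooth_fun g \<Longrightarrow>
    partial_deriv i (\<lambda>x. f x - g x) = (\<lambda>x. partial_deriv i f x - partial_deriv i g x)"
  using partial_deriv_smooth_add[of f "\<lambda>x. - g x"]
  by (simp add: smooth_fun_uminus partial_deriv_smooth_uminus)

lemma partial_deriv_smooth_sum:
  "(\<And>j. j \<in> S \<Longrightarrow> smooth_fun (f j)) \<Longrightarrow>
    partial_deriv i (\<lambda>x. \<Sum>j\<in>S. f j x) = (\<lambda>x. \<Sum>j\<in>S. partial_deriv i (f j) x)"
  by (induction S rule: infinite_finite_induct)
    (auto simp: partial_deriv_const partial_deriv_smooth_add smooth_fun_sum)

lemma partial_deriv_affine: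
  assumes "smooth_fun f"
  shows "partial_deriv i (\<lambda>x. f (c *\<^sub>R x + d)) = (\<lambda>x. c * partial_deriv i f (c *\<^sub>R x + d))"
    and "(\<lambda>x. f (c *\<^sub>R x + d)) differentiable (at x)"
proof -
  have *: "((\<lambda>x. f (c *\<^sub>R x + d)) has_derivative
      (\<lambda>h. \<Sum>i\<in>UNIV. partial_deriv i f (c *\<^sub>R x + d) * (c *\<^sub>R h) $ i)) (at x)" for x
    by (rule has_derivative_compose[OF _ smooth_fun_has_derivative[OF assms]])
      (auto intro!: derivative_eq_intros)
  then show "(\<lambda>x. f (c *\<^sub>R x + d)) differentiable (at x)"
    by (auto simp: differentiable_def)
  show "partial_deriv i (\<lambda>x. f (c *\<^sub>R x + d)) = (\<lambda>x. c * partial_deriv i f (c *\<^sub>R x + d))"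
    by (rule ext, subst partial_deriv_eq[OF *])
      (simp add: axis_def if_distrib if_distribR cong: if_cong)
qed

lemma smooth_fun_affine:
  fixes f :: "real^'n::finite \<Rightarrow> real"
  assumes "smooth_fun f"
  shows "smooth_fun (\<lambda>x. f (c *\<^sub>R x + d))"
proof (rule smooth_coinduct[of _ "{\<lambda>x. a * g (c *\<^sub>R x + d) | a g. smooth_fun g}"])
  show "(\<lambda>x. f (c *\<^sub>R x + d)) \<in> {\<lambda>x. a * g (c *\<^sub>R x + d) | a g. smooth_fun g}"
    using assms by (auto intro!: exI[of _ "1::real"] exI[of _ f])
next
  fix g and x :: "real^'n" assume "g \<in> {\<lambda>x. a * g (c *\<^sub>R x + d) | a g. smooth_fun g}"
  then show "g differentiable (at x)"
    using partial_deriv_affine(2) by (auto intro!: derivative_intros)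
next
  fix h and i :: 'n assume "h \<in> {\<lambda>x. a * g (c *\<^sub>R x + d) | a g. smooth_fun g}"
  then obtain a g where h: "h = (\<lambda>x. a * g (c *\<^sub>R x + d))" and g: "smooth_fun g" by auto
  have "partial_deriv i h = (\<lambda>x. (a * c) * partial_deriv i g (c *\<^sub>R x + d))"
    unfolding h using partial_deriv_affine(1)[OF g, of i c d] partial_deriv_affine(2)[OF g]
    by (auto simp: fun_eq_iff partial_deriv_mult partial_deriv_const)
  then show "partial_deriv i h \<in> {\<lambda>x. a * g (c *\<^sub>R x + d) | a g. smooth_fun g}"
    using smooth_fun_partial_deriv[OF g] by blast
qed

lemma smooth_fun_reflect: "smooth_fun f \<Longrightarrow> smooth_fun (\<lambda>y. f (x - y))"
  using smooth_fun_affine[of f "-1" x] by simp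

lemma partial_deriv_reflect:
  "smooth_fun f \<Longrightarrow> partial_deriv i (\<lambda>y. f (x - y)) = (\<lambda>y. - partial_deriv i f (x - y))"
  using partial_deriv_affine(1)[of f i "-1" x] by simp

lemma smooth_fun_scale: "smooth_fun f \<Longrightarrow> smooth_fun (\<lambda>x. f (x /\<^sub>R s))"
  using smooth_fun_affine[of f "inverse s" 0] by simp

lemma partial_deriv_scale:
  "smooth_fun f \<Longrightarrow> partial_deriv i (\<lambda>x. f (x /\<^sub>R s)) = (\<lambda>x. partial_deriv i f (x /\<^sub>R s) / s)"
  using partial_deriv_affine(1)[of f i "inverse s" 0] by (simp add: divide_inverse mult.commute)

lemma smooth_fun_line_derivative:
  assumes "smooth_fun f"
  shows "((\<lambda>t. f (a + t *\<^sub>R axis i 1)) has_real_derivative partial_deriv i f (a + t *\<^sub>R axis i 1)) (at t)"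
proof -
  have "((\<lambda>t. f (a + t *\<^sub>R axis i 1)) has_derivative
     (\<lambda>h. \<Sum>j\<in>UNIV. partial_deriv j f (a + t *\<^sub>R axis i 1) * (h *\<^sub>R axis i 1) $ j)) (at t)"
    by (rule has_derivative_compose[OF _ smooth_fun_has_derivative[OF assms]])
      (auto intro!: derivative_eq_intros)
  then show ?thesis
    unfolding has_field_derivative_def
    by (rule has_derivative_eq_rhs)
      (auto simp: axis_def fun_eq_iff if_distrib if_distribR cong: if_cong)
qed

text \<open>Two applications of the mean value theorem; the left-hand side is symmetric in the two directions,
which is why mixed partial derivatives commute.\<close>

lemma second_difference_mean_value:
  fixes f :: "real^'n::finite \<Rightarrow> real"
  assumes f: "smooth_fun f" and h: "h > 0"
  shows "\<exists>s t. 0 < s \<and> s < h \<and> 0 < t \<and> t < h \<and>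
    f (x + h *\<^sub>R axis i 1 + h *\<^sub>R axis j 1) - f (x + h *\<^sub>R axis i 1) - f (x + h *\<^sub>R axis j 1) + f x
     = h * h * partial_deriv j (partial_deriv i f) (x + s *\<^sub>R axis i 1 + t *\<^sub>R axis j 1)"
proof -
  let ?e = "axis i 1 :: real^'n" and ?d = "axis j 1 :: real^'n"
  let ?g = "\<lambda>s. f ((x + h *\<^sub>R ?d) + s *\<^sub>R ?e) - f (x + s *\<^sub>R ?e)"
  have "(?g has_real_derivative (partial_deriv i f ((x + h *\<^sub>R ?d) + s *\<^sub>R ?e)
      - partial_deriv i f (x + s *\<^sub>R ?e))) (at s)" for s
    by (intro derivative_intros smooth_fun_line_derivative f)
  from MVT2[OF h this] obtain s where s: "0 < s" "s < h"
    "?g h - ?g 0 = h * (partial_deriv i f ((x + h *\<^sub>R ?d) + s *\<^sub>R ?e) - partial_deriv i f (x + s *\<^sub>R ?e))"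
    by auto
  have "((\<lambda>t. partial_deriv i f ((x + s *\<^sub>R ?e) + t *\<^sub>R ?d)) has_real_derivative
      (partial_deriv j (partial_deriv i f) ((x + s *\<^sub>R ?e) + t *\<^sub>R ?d))) (at t)" for t
    by (intro smooth_fun_line_derivative smooth_fun_partial_deriv f)
  from MVT2[OF h this] obtain t where t: "0 < t" "t < h"
    "partial_deriv i f ((x + s *\<^sub>R ?e) + h *\<^sub>R ?d) - partial_deriv i f ((x + s *\<^sub>R ?e) + 0 *\<^sub>R ?d)
      = h * partial_deriv j (partial_deriv i f) ((x + s *\<^sub>R ?e) + t *\<^sub>R ?d)"
    by auto
  show ?thesis
  proof (rule exI[of _ s], rule exI[of _ t], intro conjI s(1,2) t(1,2))
    have "f (x + h *\<^sub>R ?e + h *\<^sub>R ?d) - f (x + h *\<^sub>R ?e) - f (x + h *\<^sub>R ?d) + f x = ?g h - ?g 0"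
      by (simp add: algebra_simps)
    also have "\<dots> = h * (h * partial_deriv j (partial_deriv i f) ((x + s *\<^sub>R ?e) + t *\<^sub>R ?d))"
      unfolding s(3) t(3)[symmetric] by (simp add: algebra_simps)
    finally show "f (x + h *\<^sub>R ?e + h *\<^sub>R ?d) - f (x + h *\<^sub>R ?e) - f (x + h *\<^sub>R ?d) + f x
      = h * h * partial_deriv j (partial_deriv i f) (x + s *\<^sub>R ?e + t *\<^sub>R ?d)"
      by simp
  qed
qed

lemma partial_deriv_commute:
  fixes f :: "real^'n::finite \<Rightarrow> real"
  assumes f: "smooth_fun f"
  shows "partial_deriv i (partial_deriv j f) = partial_deriv j (partial_deriv i f)"
proof
  fix x :: "real^'n"
  let ?D = "\<lambda>i j. partial_deriv j (partial_deriv i f)"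
  define D where "D h i j = (f (x + h *\<^sub>R axis i 1 + h *\<^sub>R axis j 1) - f (x + h *\<^sub>R axis i 1)
    - f (x + h *\<^sub>R axis j 1) + f x) / (h * h)" for h i j
  have lim: "((\<lambda>h. D h i j) \<longlongrightarrow> ?D i j x) (at_right 0)" for i j
  proof (rule tendstoI)
    fix e :: real assume "e > 0"
    have "isCont (?D i j) x"
      by (intro smooth_fun_isCont smooth_fun_partial_deriv f)
    then obtain d where d: "d > 0" "\<And>y. dist y x < d \<Longrightarrow> dist (?D i j y) (?D i j x) < e"
      using \<open>e > 0\<close> unfolding continuous_at_eps_delta by blast
    have "dist (D h i j) (?D i j x) < e" if h: "0 < h" "h < d / 2" for h
    proof -
      obtain s t where st: "0 < s" "s < h" "0 < t" "t < h"
        "D h i j = ?D i j (x + s *\<^sub>R axis i 1 + t *\<^sub>R axis j 1)"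
        using second_difference_mean_value[OF f h(1), of x i j] h(1) unfolding D_def
        by (auto simp: field_simps)
      have "dist (x + s *\<^sub>R axis i 1 + t *\<^sub>R axis j 1) x \<le> s + t"
        using norm_triangle_ineq[of "s *\<^sub>R axis i 1 :: real^'n" "t *\<^sub>R axis j 1"] st
        by (simp add: dist_norm)
      then show ?thesis using st h d(2) by auto
    qed
    then show "\<forall>\<^sub>F h in at_right 0. dist (D h i j) (?D i j x) < e"
      unfolding eventually_at_right_field using d(1)
      by (intro exI[of _ "d/2"]) auto
  qed
  have "D h i j = D h j i" for h i j by (simp add: D_def algebra_simps)
  then have "?D j i x = ?D i j x"
    using tendsto_unique[OF trivial_limit_at_right_real lim[of j i]] lim[of i j] by simp
  then show "partial_deriv i (partial_deriv j f) x = partial_deriv j (partial_deriv i f) x"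
    by simp
qed

section \<open>Locally integrable powers and integrals over Euclidean space\<close>

definition supp_in :: "real \<Rightarrow> ('a::euclidean_space \<Rightarrow> real) \<Rightarrow> bool"
  where "supp_in r f \<longleftrightarrow> (\<forall>x. r < norm x \<longrightarrow> f x = 0)"

lemma supp_inD: "supp_in r f \<Longrightarrow> r < norm x \<Longrightarrow> f x = 0"
  by (simp add: supp_in_def)

lemma supp_in_mono: "supp_in r f \<Longrightarrow> r \<le> s \<Longrightarrow> supp_in s f"
  by (simp add: supp_in_def)

lemma supp_in_mult: "supp_in r f \<Longrightarrow> supp_in r (\<lambda>x. f x * g x)"
  "supp_in r f \<Longrightarrow> supp_in r (\<lambda>x. g x * f x)"
  by (simp_all add: supp_in_def)

lemma supp_in_partial_deriv:
  assumes "supp_in r f" "smooth_fun f"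
  shows "supp_in r (partial_deriv i f)"
  unfolding supp_in_def
proof (intro allI impI)
  fix x :: "real^'a" assume x: "r < norm x"
  have "(f has_derivative (\<lambda>h. 0)) (at x)"
    by (rule has_derivative_transform_within_open[of "\<lambda>x. 0" _ _ _ "- cball 0 r"])
      (use assms(1) x in \<open>auto simp: supp_in_def open_Compl\<close>)
  then show "partial_deriv i f x = 0" by (simp add: partial_deriv_eq)
qed

lemma supp_in_iff_bounded: "(\<exists>r. supp_in r f) \<longleftrightarrow> bounded {x. f x \<noteq> 0}"
  unfolding bounded_iff supp_in_def by (intro ex_cong1) (auto simp: not_less[symmetric])

lemma test_functions_iff: "\<phi> \<in> test_functions \<longleftrightarrow> smooth_fun \<phi> \<and> (\<exists>r. supp_in r \<phi>)"
  by (simp add: test_functions_def fun_supp_def supp_in_iff_bounded)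

lemma test_functionsI: "smooth_fun \<phi> \<Longrightarrow> supp_in r \<phi> \<Longrightarrow> \<phi> \<in> test_functions"
  by (auto simp: test_functions_iff)

lemma continuous_borel: "continuous_on UNIV f \<Longrightarrow> f \<in> borel_measurable borel"
  by (rule borel_measurable_continuous_onI)

lemma continuous_cball_bounded:
  fixes f :: "'a::euclidean_space \<Rightarrow> real"
  assumes "continuous_on UNIV f"
  obtains B where "\<And>x. x \<in> cball 0 r \<Longrightarrow> \<bar>f x\<bar> \<le> B"
proof -
  have "compact (f ` cball 0 r)"
    using assms by (intro compact_continuous_image) (auto intro: continuous_on_subset)
  from compact_imp_bounded[OF this] show ?thesis
    unfolding bounded_iff using that by (metis imageI real_norm_def)
qed

lemma continuous_supp_bounded:
  fixes f :: "'a::euclidean_space \<Rightarrow> real"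
  assumes "continuous_on UNIV f" "supp_in r f"
  obtains C where "C \<ge> 0" "\<And>x. \<bar>f x\<bar> \<le> C"
proof -
  obtain B where B: "\<And>x. x \<in> cball 0 r \<Longrightarrow> \<bar>f x\<bar> \<le> B"
    by (rule continuous_cball_bounded[OF assms(1), of r]) blast
  show ?thesis
  proof (rule that[of "max B 0"])
    show "\<bar>f x\<bar> \<le> max B 0" for x
      using B[of x] supp_inD[OF assms(2), of x] by (cases "r < norm x") auto
  qed simp
qed

lemma cball_borel [measurable]: "cball c r \<in> sets borel"
  by simp

text \<open>Measurability is with respect to the Borel sets, which keeps Fubini's theorem applicable to the
convolutions below.\<close>

definition Lloc :: "nat \<Rightarrow> ('a::euclidean_space \<Rightarrow> real) \<Rightarrow> bool"
  where "Lloc p f \<longleftrightarrow> f \<in> borel_measurable borel \<and>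
    (\<forall>r. integrable lborel (\<lambda>x. indicator (cball 0 r) x * \<bar>f x\<bar> ^ p))"

lemma Lloc_measurable: "Lloc p f \<Longrightarrow> f \<in> borel_measurable borel"
  by (simp add: Lloc_def)

lemma Lloc_integrable: "Lloc p f \<Longrightarrow> integrable lborel (\<lambda>x. indicator (cball 0 r) x * \<bar>f x\<bar> ^ p)"
  by (simp add: Lloc_def)

lemma integrable_indicator_cball: "integrable lborel (indicat_real (cball c r))"
  by (rule integrable_real_indicator)
    (use emeasure_lborel_cball_finite[of c r] in \<open>auto simp: top.not_eq_extremum less_top\<close>)

lemma LlocI:
  assumes "f \<in> borel_measurable borel"
    and "\<And>r. integrable lborel (\<lambda>x. indicator (cball 0 r) x * g r x)"
    and "\<And>r x. \<bar>f x\<bar> ^ p \<le> g r x"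
  shows "Lloc p f"
  unfolding Lloc_def
proof (intro conjI allI assms(1))
  fix r :: real
  note [measurable] = assms(1)
  show "integrable lborel (\<lambda>x. indicator (cball 0 r) x * \<bar>f x\<bar> ^ p)"
    by (rule Bochner_Integration.integrable_bound[OF assms(2)[of r]])
      (auto simp: abs_mult indicator_def order_trans[OF assms(3) abs_ge_self])
qed

lemma integrable_indicator_add:
  fixes f g :: "'a \<Rightarrow> real"
  shows "integrable M (\<lambda>x. h x * f x) \<Longrightarrow> integrable M (\<lambda>x. h x * g x) \<Longrightarrow>
   integrable M (\<lambda>x. h x * (f x + g x))"
  by (simp add: distrib_left)

lemma Lloc_mono:
  assumes "Lloc q f" "p \<le> q"
  shows "Lloc p f"
proof (rule LlocI)
  show "f \<in> borel_measurable borel" using assms(1) by (rule Lloc_measurable)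
  show "integrable lborel (\<lambda>x. indicator (cball 0 r) x * (1 + \<bar>f x\<bar> ^ q))" for r
    using integrable_indicator_cball Lloc_integrable[OF assms(1)]
    by (intro integrable_indicator_add) auto
  show "\<bar>f x\<bar> ^ p \<le> 1 + \<bar>f x\<bar> ^ q" for x
  proof (cases "\<bar>f x\<bar> \<le> 1")
    case True
    then have "\<bar>f x\<bar> ^ p \<le> 1" by (simp add: power_le_one)
    also have "1 \<le> 1 + \<bar>f x\<bar> ^ q" by simp
    finally show ?thesis .
  next
    case False
    then have "\<bar>f x\<bar> ^ p \<le> \<bar>f x\<bar> ^ q" by (intro power_increasing assms(2)) auto
    then show ?thesis by simp
  qed
qed

lemma abs_mult_le_sum_squares: "\<bar>a * b\<bar> \<le> a\<^sup>2 + b\<^sup>2" for a b :: real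
proof -
  have "2 * (\<bar>a\<bar> * \<bar>b\<bar>) \<le> a\<^sup>2 + b\<^sup>2" using sum_squares_bound[of "\<bar>a\<bar>" "\<bar>b\<bar>"] by simp
  moreover have "0 \<le> \<bar>a\<bar> * \<bar>b\<bar>" by simp
  ultimately show ?thesis unfolding abs_mult by linarith
qed

lemma Lloc_mult:
  assumes "Lloc (2 * p) f" "Lloc (2 * p) g"
  shows "Lloc p (\<lambda>x. f x * g x)"
proof (rule LlocI)
  note [measurable] = assms[THEN Lloc_measurable]
  show "(\<lambda>x. f x * g x) \<in> borel_measurable borel" by measurable
  show "integrable lborel (\<lambda>x. indicator (cball 0 r) x * (\<bar>f x\<bar> ^ (2 * p) + \<bar>g x\<bar> ^ (2 * p)))" for r
    using assms by (intro integrable_indicator_add Lloc_integrable) auto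
  show "\<bar>f x * g x\<bar> ^ p \<le> \<bar>f x\<bar> ^ (2 * p) + \<bar>g x\<bar> ^ (2 * p)" for x
    using abs_mult_le_sum_squares[of "\<bar>f x\<bar> ^ p" "\<bar>g x\<bar> ^ p"]
    by (simp only: power_mult mult.commute[of 2 p] abs_mult power_mult_distrib power_abs abs_abs)
qed

lemma Lloc_continuous:
  assumes "continuous_on UNIV f"
  shows "Lloc p f"
  unfolding Lloc_def
proof (intro conjI allI continuous_borel assms)
  fix r :: real
  note [measurable] = continuous_borel[OF assms]
  obtain B where B: "\<And>x. x \<in> cball 0 r \<Longrightarrow> \<bar>f x\<bar> \<le> B"
    by (rule continuous_cball_bounded[OF assms(1), of r]) blast
  show "integrable lborel (\<lambda>x. indicator (cball 0 r) x * \<bar>f x\<bar> ^ p)"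
  proof (rule Bochner_Integration.integrable_bound)
    show "integrable lborel (\<lambda>x. indicator (cball 0 r) x * B ^ p)"
      using integrable_indicator_cball by auto
    show "AE x in lborel. norm (indicator (cball 0 r) x * \<bar>f x\<bar> ^ p) \<le> norm (indicator (cball 0 r) x * B ^ p)"
    proof (rule AE_I2)
      fix x
      show "norm (indicator (cball 0 r) x * \<bar>f x\<bar> ^ p) \<le> norm (indicator (cball 0 r) x * B ^ p)"
      proof (cases "x \<in> cball 0 r")
        case True
        then show ?thesis using power_mono[of "\<bar>f x\<bar>" "\<bar>B\<bar>" p] B[of x] by (auto simp: power_abs)
      qed simp
    qed
  qed measurable
qed

lemma Lloc_smooth: "smooth_fun f \<Longrightarrow> Lloc p f"
  by (intro Lloc_continuous smooth_fun_continuous)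

lemma Lloc_global:
  assumes "f \<in> borel_measurable borel" "integrable lborel (\<lambda>x. \<bar>f x\<bar> ^ p)"
  shows "Lloc p f"
  unfolding Lloc_def
proof (intro conjI allI assms)
  fix r
  note [measurable] = assms(1)
  show "integrable lborel (\<lambda>x. indicator (cball 0 r) x * \<bar>f x\<bar> ^ p)"
    by (rule Bochner_Integration.integrable_bound[OF assms(2)])
       (auto simp: indicator_def)
qed

lemma Lloc_diff:
  assumes "Lloc p f" "Lloc p g"
  shows "Lloc p (\<lambda>x. f x - g x)"
proof (rule LlocI)
  note [measurable] = assms[THEN Lloc_measurable]
  show "(\<lambda>x. f x - g x) \<in> borel_measurable borel" by measurable
  have "integrable lborel (\<lambda>x. 2 ^ p * (indicator (cball 0 r) x * (\<bar>f x\<bar> ^ p + \<bar>g x\<bar> ^ p)))" for r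
    using assms by (intro integrable_mult_right integrable_indicator_add Lloc_integrable)
  then show "integrable lborel (\<lambda>x. indicator (cball 0 r) x * (2 ^ p * (\<bar>f x\<bar> ^ p + \<bar>g x\<bar> ^ p)))" for r
    by (simp add: ac_simps)
  show "\<bar>f x - g x\<bar> ^ p \<le> 2 ^ p * (\<bar>f x\<bar> ^ p + \<bar>g x\<bar> ^ p)" for x
  proof -
    have "\<bar>f x - g x\<bar> ^ p \<le> (2 * max \<bar>f x\<bar> \<bar>g x\<bar>) ^ p"
      by (intro power_mono) auto
    also have "\<dots> \<le> 2 ^ p * (\<bar>f x\<bar> ^ p + \<bar>g x\<bar> ^ p)"
      by (simp add: power_mult_distrib max_def)
    finally show ?thesis .
  qed
qed

lemma Lloc_cmult: "Lloc p f \<Longrightarrow> Lloc p (\<lambda>x. c * f x)"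
  unfolding Lloc_def by (auto simp: abs_mult power_mult_distrib mult.left_commute)

lemma Lloc_add: "Lloc p f \<Longrightarrow> Lloc p g \<Longrightarrow> Lloc p (\<lambda>x. f x + g x)"
  using Lloc_diff[of p f "\<lambda>x. - 1 * g x"] Lloc_cmult[of p g "-1"] by simp

lemma Lloc_sum: "(\<And>j. j \<in> S \<Longrightarrow> Lloc p (f j)) \<Longrightarrow> Lloc p (\<lambda>x. \<Sum>j\<in>S. f j x)"
  by (induction S rule: infinite_finite_induct) (auto intro: Lloc_add Lloc_continuous)

lemma Lloc_bounded_mult:
  assumes "Lloc p f" "g \<in> borel_measurable borel" "\<And>x. \<bar>g x\<bar> \<le> C"
  shows "Lloc p (\<lambda>x. g x * f x)"
proof (rule LlocI)
  note [measurable] = Lloc_measurable[OF assms(1)] assms(2)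
  show "(\<lambda>x. g x * f x) \<in> borel_measurable borel" by measurable
  show "integrable lborel (\<lambda>x. indicator (cball 0 r) x * \<bar>C * f x\<bar> ^ p)" for r
    using assms by (intro Lloc_integrable Lloc_cmult)
  have "\<bar>g x\<bar> \<le> \<bar>C\<bar>" for x using assms(3)[of x] by linarith
  then show "\<bar>g x * f x\<bar> ^ p \<le> \<bar>C * f x\<bar> ^ p" for x
    by (intro power_mono) (auto simp: abs_mult mult_right_mono)
qed

lemma Lloc_continuous_mult:
  assumes "Lloc p f" "continuous_on UNIV g"
  shows "Lloc p (\<lambda>x. g x * f x)"
  unfolding Lloc_def
proof (intro conjI allI)
  note [measurable] = Lloc_measurable[OF assms(1)] continuous_borel[OF assms(2)]
  show "(\<lambda>x. g x * f x) \<in> borel_measurable borel" by measurable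
  fix r :: real
  obtain B where B: "\<And>x. x \<in> cball 0 r \<Longrightarrow> \<bar>g x\<bar> \<le> B"
    by (rule continuous_cball_bounded[OF assms(2), of r]) blast
  let ?g = "\<lambda>x. indicator (cball 0 r) x * g x"
  have "Lloc p (\<lambda>x. ?g x * f x)"
    by (rule Lloc_bounded_mult[OF assms(1), of _ "\<bar>B\<bar>"]) (use B in \<open>force simp: indicator_def\<close>)+
  from Lloc_integrable[OF this, of r]
  show "integrable lborel (\<lambda>x. indicator (cball 0 r) x * \<bar>g x * f x\<bar> ^ p)"
    by (rule Bochner_Integration.integrable_cong[THEN iffD1, rotated -1]) (auto simp: indicator_def)
qed

lemma integrable_supp:
  assumes "Lloc 1 f" "supp_in r f"
  shows "integrable lborel f"
proof (rule Bochner_Integration.integrable_bound[OF Lloc_integrable[OF assms(1), of r]])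
  show "f \<in> borel_measurable lborel" using Lloc_measurable[OF assms(1)] by simp
  show "AE x in lborel. norm (f x) \<le> norm (indicator (cball 0 r) x * \<bar>f x\<bar> ^ 1)"
    using supp_inD[OF assms(2)] by (auto simp: indicator_def)
qed

lemma integrable_mult_supp:
  assumes "Lloc 1 f" "continuous_on UNIV g" "supp_in r g"
  shows "integrable lborel (\<lambda>x. f x * g x)"
  using integrable_supp[OF Lloc_continuous_mult[OF assms(1,2)], of r] assms(3)
  by (simp add: supp_in_def mult.commute)

lemma integrable_continuous_supp:
  "continuous_on UNIV g \<Longrightarrow> supp_in r g \<Longrightarrow> integrable lborel g"
  by (rule integrable_supp[OF Lloc_continuous])

lemma integral_Cauchy_Schwarz:
  fixes f g :: "'a \<Rightarrow> real"
  assumes [measurable]: "f \<in> borel_measurable M" "g \<in> borel_measurable M"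
    and f: "integrable M (\<lambda>x. (f x)\<^sup>2)" and g: "integrable M (\<lambda>x. (g x)\<^sup>2)"
  shows "integrable M (\<lambda>x. f x * g x)"
    and "\<bar>\<integral>x. f x * g x \<partial>M\<bar> \<le> sqrt (\<integral>x. (f x)\<^sup>2 \<partial>M) * sqrt (\<integral>x. (g x)\<^sup>2 \<partial>M)"
proof -
  show fg: "integrable M (\<lambda>x. f x * g x)"
  proof (rule Bochner_Integration.integrable_bound[OF Bochner_Integration.integrable_add[OF f g]])
    show "AE x in M. norm (f x * g x) \<le> norm ((f x)\<^sup>2 + (g x)\<^sup>2)"
      using abs_mult_le_sum_squares by (intro AE_I2) simp
  qed measurable
  let ?A = "\<integral>x. (f x)\<^sup>2 \<partial>M" and ?B = "\<integral>x. (g x)\<^sup>2 \<partial>M" and ?C = "\<integral>x. f x * g x \<partial>M"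
  have A: "?A \<ge> 0" and B: "?B \<ge> 0" by simp_all
  have q: "0 \<le> ?A - 2 * t * ?C + t\<^sup>2 * ?B" for t
  proof -
    have "0 \<le> (\<integral>x. (f x - t * g x)\<^sup>2 \<partial>M)" by simp
    also have "\<dots> = (\<integral>x. (f x)\<^sup>2 - 2 * t * (f x * g x) + t\<^sup>2 * (g x)\<^sup>2 \<partial>M)"
      by (simp add: power2_diff power_mult_distrib algebra_simps)
    also have "\<dots> = ?A - 2 * t * ?C + t\<^sup>2 * ?B"
      using f g fg by simp
    finally show ?thesis .
  qed
  have "?C\<^sup>2 \<le> ?A * ?B"
  proof (cases "?B = 0")
    case True
    have "?C = 0"
    proof (rule ccontr)
      assume "?C \<noteq> 0"
      then show False using q[of "(?A + 1) / (2 * ?C)"] True by simp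
    qed
    then show ?thesis using True by simp
  next
    case False
    then have "?B > 0" using B by linarith
    then show ?thesis using q[of "?C / ?B"] by (simp add: field_simps power2_eq_square)
  qed
  then have "sqrt (?C\<^sup>2) \<le> sqrt (?A * ?B)" by (rule real_sqrt_le_mono)
  then show "\<bar>?C\<bar> \<le> sqrt ?A * sqrt ?B" by (simp add: real_sqrt_mult)
qed

lemma lborel_integral_affine:
  fixes f :: "'a::euclidean_space \<Rightarrow> real"
  assumes c: "c \<noteq> 0" and f: "f \<in> borel_measurable borel"
  shows "(\<integral>x. f x \<partial>lborel) = \<bar>c\<bar> ^ DIM('a) * (\<integral>x. f (t + c *\<^sub>R x) \<partial>lborel)"
    and "integrable lborel (\<lambda>x. f (t + c *\<^sub>R x)) \<longleftrightarrow> integrable lborel f"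
proof -
  note [measurable] = f
  show "(\<integral>x. f x \<partial>lborel) = \<bar>c\<bar> ^ DIM('a) * (\<integral>x. f (t + c *\<^sub>R x) \<partial>lborel)"
    by (subst lborel_affine[OF c, of t], subst integral_density)
      (auto simp: integral_distr)
  show "integrable lborel (\<lambda>x. f (t + c *\<^sub>R x)) \<longleftrightarrow> integrable lborel f"
    by (subst (2) lborel_affine[OF c, of t], subst integrable_density)
      (use c in \<open>auto simp: integrable_distr_eq\<close>)
qed

lemma lborel_integral_reflect:
  fixes f :: "'a::euclidean_space \<Rightarrow> real"
  assumes f: "f \<in> borel_measurable borel"
  shows "(\<integral>y. f (x - y) \<partial>lborel) = (\<integral>y. f y \<partial>lborel)"
    and "integrable lborel (\<lambda>y. f (x - y)) \<longleftrightarrow> integrable lborel f"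
  using lborel_integral_affine[OF _ f, of "-1" x] by simp_all

lemma lborel_integral_translate:
  fixes f :: "'a::euclidean_space \<Rightarrow> real"
  assumes f: "f \<in> borel_measurable borel"
  shows "(\<integral>y. f (y - x) \<partial>lborel) = (\<integral>y. f y \<partial>lborel)"
    and "integrable lborel (\<lambda>y. f (y - x)) \<longleftrightarrow> integrable lborel f"
  using lborel_integral_affine[OF _ f, of 1 "-x"] by simp_all

text \<open>Dominated convergence for the difference quotients: the mean value inequality bounds them by a multiple
of the integrable majorant of the gradients.\<close>

lemma has_derivative_integral_parameter:
  fixes f :: "'a::euclidean_space \<Rightarrow> 't \<Rightarrow> real" and D :: "'a \<Rightarrow> 't \<Rightarrow> 'a"
  assumes der: "\<And>x t. t \<in> space M \<Longrightarrow> ((\<lambda>x. f x t) has_derivative (\<lambda>h. D x t \<bullet> h)) (at x)"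
    and f: "\<And>x. integrable M (f x)"
    and D: "\<And>x. D x \<in> borel_measurable M"
    and bound: "\<And>x t. t \<in> space M \<Longrightarrow> norm (D x t) \<le> w t"
    and w: "integrable M w"
  shows "((\<lambda>x. \<integral>t. f x t \<partial>M) has_derivative (\<lambda>h. (\<integral>t. D x t \<partial>M) \<bullet> h)) (at x)"
    and "integrable M (D x)"
proof -
  have [measurable]: "f x \<in> borel_measurable M" "D x \<in> borel_measurable M" for x
    using f D by auto
  have D_int: "integrable M (D x)" for x
    by (rule Bochner_Integration.integrable_bound[OF w D])
      (use bound in \<open>auto intro!: AE_I2 intro: order_trans[OF _ abs_ge_self]\<close>)
  then show "integrable M (D x)" .
  have lip: "\<bar>f y t - f x t\<bar> \<le> w t * norm (y - x)" if t: "t \<in> space M" for x y t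
  proof -
    have "norm (f y t - f x t) \<le> w t * norm (y - x)"
    proof (rule differentiable_bound[of UNIV "\<lambda>x. f x t" "\<lambda>x h. D x t \<bullet> h"])
      show "onorm (\<lambda>h. D x t \<bullet> h) \<le> w t" for x
      proof (rule onorm_le)
        fix h
        have "norm (D x t \<bullet> h) \<le> norm (D x t) * norm h"
          by (simp add: Cauchy_Schwarz_ineq2)
        also have "\<dots> \<le> w t * norm h"
          by (intro mult_right_mono bound t) auto
        finally show "norm (D x t \<bullet> h) \<le> w t * norm h" .
      qed
    qed (use der t in auto)
    then show ?thesis by simp
  qed
  let ?q = "\<lambda>h t. (f (x + h) t - f x t - D x t \<bullet> h) / norm h"
  have "((\<lambda>h. \<integral>t. ?q h t \<partial>M) \<longlongrightarrow> 0) (at 0)"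
    unfolding tendsto_at_iff_sequentially
  proof (intro allI impI)
    fix X :: "nat \<Rightarrow> 'a"
    assume X: "\<forall>i. X i \<in> UNIV - {0}" "X \<longlonglongrightarrow> 0"
    have "(\<lambda>n. \<integral>t. ?q (X n) t \<partial>M) \<longlonglongrightarrow> (\<integral>t. 0 \<partial>M)"
    proof (rule integral_dominated_convergence)
      show "(\<lambda>t. ?q (X n) t) \<in> borel_measurable M" for n
        by measurable
      show "integrable M (\<lambda>t. 2 * w t)" using w by simp
      show "AE t in M. (\<lambda>n. ?q (X n) t) \<longlonglongrightarrow> 0"
      proof (rule AE_I2)
        fix t assume t: "t \<in> space M"
        have "((\<lambda>h. norm (f (x + h) t - f x t - D x t \<bullet> h) / norm h) \<longlongrightarrow> 0) (at 0)"
          using der[OF t, of x] unfolding has_derivative_at by blast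
        then have "((\<lambda>h. norm (?q h t)) \<longlongrightarrow> 0) (at 0)" by simp
        then have "((\<lambda>h. ?q h t) \<longlongrightarrow> 0) (at 0)" by (rule tendsto_norm_zero_cancel)
        then show "(\<lambda>n. ?q (X n) t) \<longlonglongrightarrow> 0"
          using X unfolding tendsto_at_iff_sequentially by (auto simp: o_def)
      qed
      show "AE t in M. norm (?q (X n) t) \<le> 2 * w t" for n
      proof (rule AE_I2)
        fix t assume t: "t \<in> space M"
        have n0: "norm (X n) > 0" using X(1) by auto
        have "\<bar>f (x + X n) t - f x t - D x t \<bullet> X n\<bar> \<le> w t * norm (X n) + norm (D x t) * norm (X n)"
          using lip[OF t, of "x + X n" x] Cauchy_Schwarz_ineq2[of "D x t" "X n"] by simp
        also have "\<dots> \<le> 2 * w t * norm (X n)"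
          using mult_right_mono[OF bound[OF t, of x], of "norm (X n)"] by simp
        finally show "norm (?q (X n) t) \<le> 2 * w t"
          using n0 by (simp add: divide_le_eq)
      qed
    qed simp
    then show "((\<lambda>h. \<integral>t. ?q h t \<partial>M) \<circ> X) \<longlonglongrightarrow> 0" by (simp add: o_def)
  qed
  moreover have "(\<integral>t. ?q h t \<partial>M) =
      ((\<integral>t. f (x + h) t \<partial>M) - (\<integral>t. f x t \<partial>M) - (\<integral>t. D x t \<partial>M) \<bullet> h) / norm h" for h
    using f D_int by (simp add: integral_inner_left integrable_inner_left)
  ultimately have "((\<lambda>h. ((\<integral>t. f (x + h) t \<partial>M) - (\<integral>t. f x t \<partial>M)
      - (\<integral>t. D x t \<partial>M) \<bullet> h) / norm h) \<longlongrightarrow> 0) (at 0)"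
    by (simp only:)
  from tendsto_norm_zero[OF this]
  show "((\<lambda>x. \<integral>t. f x t \<partial>M) has_derivative (\<lambda>h. (\<integral>t. D x t \<partial>M) \<bullet> h)) (at x)"
    unfolding has_derivative_at by (simp add: bounded_linear_inner_right norm_divide)
qed

section \<open>Convolution with smooth kernels\<close>

definition grad :: "(real^'n \<Rightarrow> real) \<Rightarrow> real^'n::finite \<Rightarrow> real^'n"
  where "grad f x = (\<chi> i. partial_deriv i f x)"

lemma grad_has_derivative: "smooth_fun f \<Longrightarrow> (f has_derivative (\<lambda>h. grad f x \<bullet> h)) (at x)"
  using smooth_fun_has_derivative[of f x] by (simp add: grad_def inner_vec_def)

lemma continuous_grad: "smooth_fun f \<Longrightarrow> continuous_on UNIV (grad f)"
  unfolding grad_def[abs_def]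
  by (intro continuous_on_vec_lambda smooth_fun_continuous smooth_fun_partial_deriv)

lemma grad_bounded:
  assumes "smooth_fun J" "supp_in r J"
  obtains C where "C \<ge> 0" "\<And>x. norm (grad J x) \<le> C"
proof -
  have "continuous_on UNIV (\<lambda>x. norm (grad J x))"
    using continuous_grad[OF assms(1)] by (intro continuous_intros)
  moreover have "supp_in r (\<lambda>x. norm (grad J x))"
    using supp_in_partial_deriv[OF assms(2,1)] by (simp add: supp_in_def grad_def vec_eq_iff)
  ultimately show ?thesis
    by (rule continuous_supp_bounded) (use that in auto)
qed

definition conv :: "('a::euclidean_space \<Rightarrow> real) \<Rightarrow> ('a \<Rightarrow> real) \<Rightarrow> 'a \<Rightarrow> real"
  where "conv J f x = (\<integral>y. J (x - y) * f y \<partial>lborel)"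

lemma conv_measurable [measurable]:
  assumes [measurable]: "J \<in> borel_measurable borel" "f \<in> borel_measurable borel"
  shows "conv J f \<in> borel_measurable borel"
  unfolding conv_def[abs_def] by measurable

lemma continuous_reflect: "continuous_on UNIV J \<Longrightarrow> continuous_on UNIV (\<lambda>y. J (x - y))"
  for J :: "'a::real_normed_vector \<Rightarrow> 'b::topological_space"
  by (rule continuous_on_compose2[of UNIV J]) (auto intro!: continuous_intros)

lemma supp_in_reflect:
  fixes J :: "'a::euclidean_space \<Rightarrow> real"
  shows "supp_in r J \<Longrightarrow> supp_in (norm x + r) (\<lambda>y. J (x - y))"
  unfolding supp_in_def
proof (intro allI impI)
  fix y :: 'a assume J: "\<forall>x. r < norm x \<longrightarrow> J x = 0" and "norm x + r < norm y"
  then have "r < norm (x - y)" using norm_triangle_ineq2[of y x] by (simp add: norm_minus_commute)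
  with J show "J (x - y) = 0" by blast
qed

lemma conv_integrable:
  assumes "continuous_on UNIV J" "supp_in r J" "Lloc 1 f"
  shows "integrable lborel (\<lambda>y. J (x - y) * f y)"
  using integrable_mult_supp[OF assms(3) continuous_reflect[OF assms(1)] supp_in_reflect[OF assms(2)]]
  by (simp add: mult.commute)

text \<open>A compactly supported kernel only sees the values of the function near the point; this reduces local
integrability to integrability.\<close>

lemma conv_truncate:
  assumes "supp_in r J" "norm x \<le> s"
  shows "conv J f x = conv J (\<lambda>y. indicator (cball 0 (s + r)) y * f y) x"
  unfolding conv_def
proof (rule Bochner_Integration.integral_cong)
  fix y
  show "J (x - y) * f y = J (x - y) * (indicator (cball 0 (s + r)) y * f y)"
    using supp_inD[OF supp_in_reflect[OF assms(1), of x], of y] assms(2)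
    by (auto simp: indicator_def)
qed simp

lemma conv_supp_in:
  assumes "supp_in r J" "supp_in s f"
  shows "supp_in (r + s) (conv J f)"
  unfolding supp_in_def
proof (intro allI impI)
  fix x :: 'a assume "r + s < norm x"
  then have "J (x - y) * f y = 0" for y
    using supp_inD[OF assms(1), of "x - y"] supp_inD[OF assms(2), of y] norm_triangle_ineq2[of x y]
    by (cases "s < norm y") auto
  then have "(\<lambda>y. J (x - y) * f y) = (\<lambda>y. 0)" by blast
  then show "conv J f x = 0" by (simp add: conv_def)
qed

lemma conv_has_derivative_integrable:
  fixes J :: "real^'n::finite \<Rightarrow> real"
  assumes J: "smooth_fun J" "supp_in r J" and f: "integrable lborel f" "f \<in> borel_measurable borel"
  shows "conv J f differentiable (at x)"
    and "partial_deriv i (conv J f) x = conv (partial_deriv i J) f x"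
proof -
  note [measurable] = f(2)
  have [measurable]: "grad J \<in> borel_measurable borel"
    using continuous_grad[OF J(1)] by (rule borel_measurable_continuous_onI)
  have [measurable]: "J \<in> borel_measurable borel"
    using J(1) by (intro continuous_borel smooth_fun_continuous)
  obtain C where C: "C \<ge> 0" "\<And>x. norm (grad J x) \<le> C" using grad_bounded[OF J] by blast
  let ?D = "\<lambda>x y. f y *\<^sub>R grad J (x - y)"
  have "Lloc 1 f" by (rule Lloc_global) (use f in auto)
  note int = conv_integrable[OF smooth_fun_continuous[OF J(1)] J(2) this]
  have der: "((\<lambda>x. J (x - y) * f y) has_derivative (\<lambda>h. ?D x y \<bullet> h)) (at x)" for x y
  proof -
    have "((\<lambda>x. J (x - y)) has_derivative (\<lambda>h. grad J (x - y) \<bullet> h)) (at x)"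
      by (rule has_derivative_compose[OF _ grad_has_derivative[OF J(1)]])
        (auto intro!: derivative_eq_intros)
    then show ?thesis by (auto intro!: derivative_eq_intros simp: mult.commute)
  qed
  have bound: "norm (?D x y) \<le> C * \<bar>f y\<bar>" for x y
    using mult_left_mono[OF C(2)[of "x - y"], of "\<bar>f y\<bar>"] by (simp add: mult.commute)
  have w: "integrable lborel (\<lambda>y. C * \<bar>f y\<bar>)" using f(1) by simp
  have meas: "?D x \<in> borel_measurable lborel" for x by measurable
  note * = has_derivative_integral_parameter[of lborel "\<lambda>x y. J (x - y) * f y" ?D,
      OF der int meas bound w]
  have **: "(conv J f has_derivative (\<lambda>h. (\<integral>y. ?D x y \<partial>lborel) \<bullet> h)) (at x)"
    using *(1) by (simp add: conv_def[abs_def])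
  then show "conv J f differentiable (at x)" by (auto simp: differentiable_def)
  have "partial_deriv i (conv J f) x = (\<integral>y. ?D x y \<partial>lborel) \<bullet> axis i 1"
    using partial_deriv_eq[OF **] by simp
  also have "\<dots> = (\<integral>y. ?D x y \<bullet> axis i 1 \<partial>lborel)"
    using *(2) by (intro integral_inner_left[symmetric]) auto
  also have "\<dots> = conv (partial_deriv i J) f x"
    by (simp add: conv_def inner_axis grad_def mult.commute)
  finally show "partial_deriv i (conv J f) x = conv (partial_deriv i J) f x" .
qed

lemma Lloc_indicator_integrable:
  assumes "Lloc 1 f"
  shows "integrable lborel (\<lambda>y. indicator (cball 0 s) y * f y)"
proof (rule Bochner_Integration.integrable_bound[OF Lloc_integrable[OF assms, of s]])
  note [measurable] = Lloc_measurable[OF assms]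
  show "(\<lambda>y. indicator (cball 0 s) y * f y) \<in> borel_measurable lborel" by measurable
qed (auto simp: indicator_def)

lemma conv_partial_deriv:
  fixes J :: "real^'n::finite \<Rightarrow> real"
  assumes J: "smooth_fun J" "supp_in r J" and f: "Lloc 1 f"
  shows "conv J f differentiable (at x)"
    and "partial_deriv i (conv J f) = conv (partial_deriv i J) f"
proof -
  note [measurable] = Lloc_measurable[OF f]
  let ?g = "\<lambda>s y. indicator (cball 0 (s + r)) y * f y"
  have g: "integrable lborel (?g s)" "?g s \<in> borel_measurable borel" for s
    by (intro Lloc_indicator_integrable f) measurable
  have *: "(conv J f has_derivative D) (at x)"
    if "(conv J (?g (norm x + 1)) has_derivative D) (at x)" for x D
    by (rule has_derivative_transform_within_open[OF that, of "ball 0 (norm x + 1)"])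
      (auto intro!: conv_truncate[OF J(2), symmetric] less_imp_le)
  have ex: "\<exists>D. (conv J (?g (norm x + 1)) has_derivative D) (at x)" for x
    using conv_has_derivative_integrable(1)[OF J g] by (simp add: differentiable_def)
  then show "conv J f differentiable (at x)" using *[of x] unfolding differentiable_def by blast
  have "partial_deriv i (conv J f) x = conv (partial_deriv i J) f x" for x
  proof -
    obtain D where D: "(conv J (?g (norm x + 1)) has_derivative D) (at x)" using ex by blast
    have "partial_deriv i (conv J f) x = partial_deriv i (conv J (?g (norm x + 1))) x"
      by (simp add: partial_deriv_eq[OF D] partial_deriv_eq[OF *[OF D]])
    also have "\<dots> = conv (partial_deriv i J) (?g (norm x + 1)) x"
      by (rule conv_has_derivative_integrable(2)[OF J g])
    also have "\<dots> = conv (partial_deriv i J) f x"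
      by (rule conv_truncate[symmetric]) (use supp_in_partial_deriv[OF J(2,1)] in auto)
    finally show ?thesis .
  qed
  then show "partial_deriv i (conv J f) = conv (partial_deriv i J) f" by blast
qed

lemma conv_smooth:
  fixes J :: "real^'n::finite \<Rightarrow> real"
  assumes J: "smooth_fun J" "supp_in r J" and f: "Lloc 1 f"
  shows "smooth_fun (conv J f)"
proof (rule smooth_coinduct[of _ "{conv J f | J. smooth_fun J \<and> supp_in r J}"])
  fix g :: "real^'n \<Rightarrow> real" and x i assume "g \<in> {conv J f | J. smooth_fun J \<and> supp_in r J}"
  then obtain J where J: "smooth_fun J" "supp_in r J" and g: "g = conv J f" by auto
  show "g differentiable (at x)" unfolding g by (rule conv_partial_deriv(1)[OF J f])
  show "partial_deriv i g \<in> {conv J f | J. smooth_fun J \<and> supp_in r J}"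
    unfolding g conv_partial_deriv(2)[OF J f]
    using smooth_fun_partial_deriv[OF J(1)] supp_in_partial_deriv[OF J(2,1)] by blast
qed (use J in auto)

text \<open>The convolution of \<open>f\<close> with the constant 1 is the constant \<open>\<integral> f\<close>, and its derivative is the convolution
of the derivative with 1.\<close>

lemma integral_partial_deriv:
  fixes f :: "real^'n::finite \<Rightarrow> real"
  assumes f: "smooth_fun f" "supp_in r f"
  shows "(\<integral>x. partial_deriv i f x \<partial>lborel) = 0"
proof -
  have c: "conv g (\<lambda>y. 1) = (\<lambda>x. \<integral>y. g y \<partial>lborel)" if "smooth_fun g" for g :: "real^'n \<Rightarrow> real"
    using lborel_integral_reflect(1)[OF continuous_borel[OF smooth_fun_continuous[OF that]]]
    by (simp add: conv_def[abs_def])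
  have L: "Lloc 1 (\<lambda>y::real^'n. 1)" by (intro Lloc_continuous) auto
  have "partial_deriv i (conv f (\<lambda>y. 1)) = conv (partial_deriv i f) (\<lambda>y. 1)"
    by (rule conv_partial_deriv(2)[OF f L])
  then have "(\<lambda>x. 0) = (\<lambda>x::real^'n. \<integral>y. partial_deriv i f y \<partial>lborel)"
    by (simp add: c f smooth_fun_partial_deriv partial_deriv_const)
  then show ?thesis by metis
qed

lemma integration_by_parts:
  fixes f g :: "real^'n::finite \<Rightarrow> real"
  assumes f: "smooth_fun f" "supp_in r f" and g: "smooth_fun g"
  shows "(\<integral>x. f x * partial_deriv i g x \<partial>lborel) = - (\<integral>x. partial_deriv i f x * g x \<partial>lborel)"
proof -
  have "(\<integral>x. partial_deriv i f x * g x + f x * partial_deriv i g x \<partial>lborel) = 0"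
    using integral_partial_deriv[of "\<lambda>x. f x * g x" r i] f g
    by (simp add: smooth_fun_mult supp_in_mult partial_deriv_smooth_mult)
  moreover have "integrable lborel (\<lambda>x. partial_deriv i f x * g x)"
    by (rule integrable_continuous_supp[of _ r])
      (intro smooth_fun_continuous smooth_fun_mult smooth_fun_partial_deriv f g
        supp_in_mult supp_in_partial_deriv)+
  moreover have "integrable lborel (\<lambda>x. f x * partial_deriv i g x)"
    by (rule integrable_continuous_supp[of _ r])
      (intro smooth_fun_continuous smooth_fun_mult smooth_fun_partial_deriv f g
        supp_in_mult)+
  ultimately show ?thesis by simp
qed

text \<open>Cauchy--Schwarz with respect to the measure of density \<open>|J (x - y)|\<close>.\<close>

lemma conv_square_le:
  fixes J f :: "'a::euclidean_space \<Rightarrow> real"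
  assumes J: "continuous_on UNIV J" "supp_in r J" and f: "Lloc 2 f"
  shows "(conv J f x)\<^sup>2 \<le> (\<integral>y. \<bar>J y\<bar> \<partial>lborel) * conv (\<lambda>y. \<bar>J y\<bar>) (\<lambda>y. (f y)\<^sup>2) x"
proof -
  note [measurable] = Lloc_measurable[OF f] continuous_borel[OF J(1)]
  have aJ: "continuous_on UNIV (\<lambda>y. \<bar>J y\<bar>)" "supp_in r (\<lambda>y. \<bar>J y\<bar>)"
    using J by (auto simp: supp_in_def intro!: continuous_intros)
  have f2: "Lloc 1 (\<lambda>y. (f y)\<^sup>2)" using Lloc_mult[of 1 f f] f by (simp add: power2_eq_square)
  let ?F = "\<lambda>y. sqrt \<bar>J (x - y)\<bar>" and ?G = "\<lambda>y. sqrt \<bar>J (x - y)\<bar> * \<bar>f y\<bar>"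
  have F2: "(\<lambda>y. (?F y)\<^sup>2) = (\<lambda>y. \<bar>J (x - y)\<bar>)" by simp
  have G2: "(\<lambda>y. (?G y)\<^sup>2) = (\<lambda>y. \<bar>J (x - y)\<bar> * (f y)\<^sup>2)" by (simp add: power_mult_distrib)
  have FG: "(\<lambda>y. ?F y * ?G y) = (\<lambda>y. \<bar>J (x - y) * f y\<bar>)"
    by (simp add: abs_mult mult.assoc[symmetric])
  have iF: "integrable lborel (\<lambda>y. (?F y)\<^sup>2)"
    unfolding F2
    using integrable_continuous_supp[OF aJ] lborel_integral_reflect(2)[of "\<lambda>y. \<bar>J y\<bar>"] by simp
  have iG: "integrable lborel (\<lambda>y. (?G y)\<^sup>2)"
    unfolding G2 by (rule conv_integrable[OF aJ f2])
  have "\<bar>conv J f x\<bar> \<le> (\<integral>y. \<bar>J (x - y) * f y\<bar> \<partial>lborel)"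
    unfolding conv_def by (rule integral_abs_bound)
  also have "\<dots> \<le> \<bar>\<integral>y. ?F y * ?G y \<partial>lborel\<bar>" unfolding FG by simp
  also have "\<dots> \<le> sqrt (\<integral>y. (?F y)\<^sup>2 \<partial>lborel) * sqrt (\<integral>y. (?G y)\<^sup>2 \<partial>lborel)"
    by (rule integral_Cauchy_Schwarz(2)[OF _ _ iF iG]) measurable
  finally have "\<bar>conv J f x\<bar>\<^sup>2 \<le> (sqrt (\<integral>y. (?F y)\<^sup>2 \<partial>lborel) * sqrt (\<integral>y. (?G y)\<^sup>2 \<partial>lborel))\<^sup>2"
    by (intro power_mono) auto
  also have "\<dots> = (\<integral>y. (?F y)\<^sup>2 \<partial>lborel) * (\<integral>y. (?G y)\<^sup>2 \<partial>lborel)"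
    by (simp add: power_mult_distrib)
  also have "(\<integral>y. (?F y)\<^sup>2 \<partial>lborel) = (\<integral>y. \<bar>J y\<bar> \<partial>lborel)"
    unfolding F2 by (rule lborel_integral_reflect(1)) measurable
  finally show ?thesis unfolding G2 by (simp add: conv_def)
qed

lemma integral_conv:
  fixes J g :: "'a::euclidean_space \<Rightarrow> real"
  assumes J: "continuous_on UNIV J" "supp_in r J"
    and g: "g \<in> borel_measurable borel" "integrable lborel g"
  shows "integrable lborel (conv J g)"
    and "(\<integral>x. conv J g x \<partial>lborel) = (\<integral>y. J y \<partial>lborel) * (\<integral>y. g y \<partial>lborel)"
proof -
  note [measurable] = g(1) continuous_borel[OF J(1)]
  have iJ: "integrable lborel J" by (rule integrable_continuous_supp[OF J])
  let ?h = "\<lambda>(y, x). J (x - y) * g y"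
  have int: "integrable (lborel \<Otimes>\<^sub>M lborel) ?h"
  proof (rule lborel_pair.Fubini_integrable)
    show "integrable lborel (\<lambda>y. \<integral>x. norm (?h (y, x)) \<partial>lborel)"
      using lborel_integral_translate(1)[of "\<lambda>x. \<bar>J x\<bar>"] g(2) by (simp add: abs_mult)
    show "AE y in lborel. integrable lborel (\<lambda>x. ?h (y, x))"
      using iJ by (simp add: lborel_integral_translate(2)[of J])
  qed measurable
  show "integrable lborel (conv J g)"
    using lborel_pair.integrable_snd[OF int] by (simp add: conv_def[abs_def])
  have "(\<integral>x. conv J g x \<partial>lborel) = (\<integral>y. \<integral>x. J (x - y) * g y \<partial>lborel \<partial>lborel)"
    unfolding conv_def by (rule lborel_pair.Fubini_integral[OF int])
  also have "\<dots> = (\<integral>y. J y \<partial>lborel) * (\<integral>y. g y \<partial>lborel)"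
    by (simp add: lborel_integral_translate(1)[of J])
  finally show "(\<integral>x. conv J g x \<partial>lborel) = (\<integral>y. J y \<partial>lborel) * (\<integral>y. g y \<partial>lborel)" .
qed

lemma Young_L2:
  fixes J f :: "'a::euclidean_space \<Rightarrow> real"
  assumes J: "continuous_on UNIV J" "supp_in r J"
    and f: "f \<in> borel_measurable borel" "integrable lborel (\<lambda>x. (f x)\<^sup>2)"
  shows "integrable lborel (\<lambda>x. (conv J f x)\<^sup>2)"
    and "(\<integral>x. (conv J f x)\<^sup>2 \<partial>lborel) \<le> (\<integral>y. \<bar>J y\<bar> \<partial>lborel)\<^sup>2 * (\<integral>y. (f y)\<^sup>2 \<partial>lborel)"
proof -
  note [measurable] = f(1) continuous_borel[OF J(1)]
  have aJ: "continuous_on UNIV (\<lambda>y. \<bar>J y\<bar>)" "supp_in r (\<lambda>y. \<bar>J y\<bar>)"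
    using J by (auto simp: supp_in_def intro!: continuous_intros)
  have "Lloc 2 f" using f by (intro Lloc_global) auto
  note le = conv_square_le[OF J this]
  have f2: "(\<lambda>y. (f y)\<^sup>2) \<in> borel_measurable borel" by measurable
  note int = integral_conv[OF aJ f2 f(2)]
  let ?m = "\<integral>y. \<bar>J y\<bar> \<partial>lborel"
  have int': "integrable lborel (\<lambda>x. ?m * conv (\<lambda>y. \<bar>J y\<bar>) (\<lambda>y. (f y)\<^sup>2) x)"
    using int(1) by simp
  show i: "integrable lborel (\<lambda>x. (conv J f x)\<^sup>2)"
    by (rule Bochner_Integration.integrable_bound[OF int'])
      (use le in \<open>auto intro!: AE_I2 intro: order_trans[OF _ abs_ge_self]\<close>)
  have "(\<integral>x. (conv J f x)\<^sup>2 \<partial>lborel) \<le> (\<integral>x. ?m * conv (\<lambda>y. \<bar>J y\<bar>) (\<lambda>y. (f y)\<^sup>2) x \<partial>lborel)"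
    by (rule integral_mono[OF i int' le])
  also have "\<dots> = ?m\<^sup>2 * (\<integral>y. (f y)\<^sup>2 \<partial>lborel)"
    using int(2) by (simp add: power2_eq_square)
  finally show "(\<integral>x. (conv J f x)\<^sup>2 \<partial>lborel) \<le> ?m\<^sup>2 * (\<integral>y. (f y)\<^sup>2 \<partial>lborel)" .
qed

definition ball_sq :: "real \<Rightarrow> ('a::euclidean_space \<Rightarrow> real) \<Rightarrow> real"
  where "ball_sq r f = (\<integral>x. indicator (cball 0 r) x * (f x)\<^sup>2 \<partial>lborel)"

lemma ball_sq_nonneg: "ball_sq r f \<ge> 0"
  unfolding ball_sq_def by (intro Bochner_Integration.integral_nonneg) auto

lemma Lloc2_integrable: "Lloc 2 f \<Longrightarrow> integrable lborel (\<lambda>x. indicator (cball 0 r) x * (f x)\<^sup>2)"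
  using Lloc_integrable[of 2 f r] by simp

lemma indicator_sq: "(indicat_real A x * c)\<^sup>2 = indicator A x * c\<^sup>2"
  by (simp add: indicator_def)

lemma Young_L2_local:
  fixes J f :: "'a::euclidean_space \<Rightarrow> real"
  assumes J: "continuous_on UNIV J" "supp_in r J" and f: "Lloc 2 f"
  shows "ball_sq s (conv J f) \<le> (\<integral>y. \<bar>J y\<bar> \<partial>lborel)\<^sup>2 * ball_sq (s + r) f"
proof -
  note [measurable] = Lloc_measurable[OF f] continuous_borel[OF J(1)]
  let ?g = "\<lambda>y. indicator (cball 0 (s + r)) y * f y"
  have g: "?g \<in> borel_measurable borel" by measurable
  have g2: "(\<lambda>y. (?g y)\<^sup>2) = (\<lambda>x. indicator (cball 0 (s + r)) x * (f x)\<^sup>2)"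
    by (simp add: indicator_sq)
  have gi: "integrable lborel (\<lambda>y. (?g y)\<^sup>2)" unfolding g2 by (rule Lloc2_integrable[OF f])
  have "ball_sq s (conv J f) = (\<integral>x. indicator (cball 0 s) x * (conv J ?g x)\<^sup>2 \<partial>lborel)"
    unfolding ball_sq_def
  proof (intro Bochner_Integration.integral_cong refl)
    fix x :: 'a
    show "indicator (cball 0 s) x * (conv J f x)\<^sup>2 = indicator (cball 0 s) x * (conv J ?g x)\<^sup>2"
    proof (cases "x \<in> cball 0 s")
      case True
      then have "conv J f x = conv J ?g x" by (intro conv_truncate[OF J(2)]) simp
      then show ?thesis by simp
    qed simp
  qed
  also have "\<dots> \<le> (\<integral>x. (conv J ?g x)\<^sup>2 \<partial>lborel)"
    using Young_L2(1)[OF J g gi]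
    by (intro integral_mono' ) (auto simp: indicator_def)
  also have "\<dots> \<le> (\<integral>y. \<bar>J y\<bar> \<partial>lborel)\<^sup>2 * ball_sq (s + r) f"
    using Young_L2(2)[OF J g gi] unfolding ball_sq_def g2 .
  finally show ?thesis .
qed

section \<open>Convergence of mollifications\<close>

definition prob_kernel :: "real \<Rightarrow> ('a::euclidean_space \<Rightarrow> real) \<Rightarrow> bool"
  where "prob_kernel r K \<longleftrightarrow>
    continuous_on UNIV K \<and> (\<forall>x. 0 \<le> K x) \<and> (\<integral>x. K x \<partial>lborel) = 1 \<and> supp_in r K"

lemma prob_kernelD:
  assumes "prob_kernel r K"
  shows "continuous_on UNIV K" "0 \<le> K x" "(\<integral>x. K x \<partial>lborel) = 1" "supp_in r K"
    "(\<integral>x. \<bar>K x\<bar> \<partial>lborel) = 1" "(\<lambda>y. \<bar>K y\<bar>) = K" "K \<in> borel_measurable borel"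
  using assms by (auto simp: prob_kernel_def intro: continuous_borel)

lemma Lloc_abs_power:
  assumes "Lloc (p * q) f"
  shows "Lloc p (\<lambda>x. \<bar>f x\<bar> ^ q)"
  using assms unfolding Lloc_def by (auto simp: power_mult[symmetric] mult.commute)

lemma conv_mono_abs:
  assumes K: "prob_kernel r K" and f: "Lloc 1 f"
  shows "\<bar>conv K f x\<bar> \<le> conv K (\<lambda>y. \<bar>f y\<bar>) x" "0 \<le> conv K (\<lambda>y. \<bar>f y\<bar>) x"
proof -
  have "\<bar>conv K f x\<bar> \<le> (\<integral>y. \<bar>K (x - y) * f y\<bar> \<partial>lborel)"
    unfolding conv_def by (rule integral_abs_bound)
  also have "\<dots> = conv K (\<lambda>y. \<bar>f y\<bar>) x"
    unfolding conv_def using prob_kernelD(2)[OF K] by (simp add: abs_mult)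
  finally show "\<bar>conv K f x\<bar> \<le> conv K (\<lambda>y. \<bar>f y\<bar>) x" .
  show "0 \<le> conv K (\<lambda>y. \<bar>f y\<bar>) x"
    unfolding conv_def using prob_kernelD(2)[OF K] by (intro Bochner_Integration.integral_nonneg) auto
qed

text \<open>Jensen's inequality for the convex powers. For exponents that are powers of two it follows from the
Cauchy--Schwarz bound by repeated squaring; the exponents 1, 2 and 4 occur later.\<close>

lemma conv_power_le:
  assumes K: "prob_kernel r K" and f: "Lloc (2 ^ k) f"
  shows "\<bar>conv K f x\<bar> ^ (2 ^ k) \<le> conv K (\<lambda>y. \<bar>f y\<bar> ^ (2 ^ k)) x"
  using f
proof (induction k)
  case 0
  then show ?case using conv_mono_abs(1)[OF K] by simp
next
  case (Suc k)
  have L: "Lloc 2 (\<lambda>y. \<bar>f y\<bar> ^ (2 ^ k))" using Suc.prems by (intro Lloc_abs_power) simp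
  have "Lloc (2 ^ k) f" by (rule Lloc_mono[OF Suc.prems]) simp
  note IH = Suc.IH[OF this]
  have "\<bar>conv K f x\<bar> ^ (2 ^ Suc k) = (\<bar>conv K f x\<bar> ^ (2 ^ k))\<^sup>2"
    by (simp only: power_mult[symmetric] power_Suc2)
  also have "\<dots> \<le> (conv K (\<lambda>y. \<bar>f y\<bar> ^ (2 ^ k)) x)\<^sup>2"
    by (intro power_mono IH) auto
  also have "\<dots> \<le> conv K (\<lambda>y. (\<bar>f y\<bar> ^ (2 ^ k))\<^sup>2) x"
    using conv_square_le[OF prob_kernelD(1,4)[OF K] L, of x]
    by (simp only: prob_kernelD(3,6)[OF K] mult_1)
  also have "(\<lambda>y. (\<bar>f y\<bar> ^ (2 ^ k))\<^sup>2) = (\<lambda>y. \<bar>f y\<bar> ^ (2 ^ Suc k))"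
    by (simp only: power_mult[symmetric] power_Suc2)
  finally show ?case .
qed

lemma Young_prob_kernel:
  assumes K: "prob_kernel r K" and f: "f \<in> borel_measurable borel" "integrable lborel (\<lambda>x. \<bar>f x\<bar> ^ (2 ^ k))"
  shows "integrable lborel (\<lambda>x. \<bar>conv K f x\<bar> ^ (2 ^ k))"
    and "(\<integral>x. \<bar>conv K f x\<bar> ^ (2 ^ k) \<partial>lborel) \<le> (\<integral>x. \<bar>f x\<bar> ^ (2 ^ k) \<partial>lborel)"
proof -
  note [measurable] = f(1) prob_kernelD(7)[OF K]
  have fk: "(\<lambda>x. \<bar>f x\<bar> ^ (2 ^ k)) \<in> borel_measurable borel" by measurable
  note int = integral_conv[OF prob_kernelD(1,4)[OF K] fk f(2)]
  have "Lloc (2 ^ k) f" by (rule Lloc_global[OF f])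
  note le = conv_power_le[OF K this]
  show i: "integrable lborel (\<lambda>x. \<bar>conv K f x\<bar> ^ (2 ^ k))"
    by (rule Bochner_Integration.integrable_bound[OF int(1)])
      (use le in \<open>auto intro!: AE_I2 intro: order_trans[OF _ abs_ge_self]\<close>)
  show "(\<integral>x. \<bar>conv K f x\<bar> ^ (2 ^ k) \<partial>lborel) \<le> (\<integral>x. \<bar>f x\<bar> ^ (2 ^ k) \<partial>lborel)"
    using integral_mono[OF i int(1) le] int(2) prob_kernelD(3)[OF K] by simp
qed

lemma conv_add_right:
  assumes "continuous_on UNIV J" "supp_in r J" "Lloc 1 f" "Lloc 1 g"
  shows "conv J (\<lambda>y. f y + g y) x = conv J f x + conv J g x"
    "conv J (\<lambda>y. f y - g y) x = conv J f x - conv J g x"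
  using conv_integrable[OF assms(1,2,3), of x] conv_integrable[OF assms(1,2,4), of x]
  by (simp_all add: conv_def distrib_left right_diff_distrib)

lemma power_add_le: "\<bar>a + b\<bar> ^ p \<le> 2 ^ p * (\<bar>a\<bar> ^ p + \<bar>b\<bar> ^ p)" for a b :: real
proof -
  have "\<bar>a + b\<bar> ^ p \<le> (2 * max \<bar>a\<bar> \<bar>b\<bar>) ^ p"
    by (intro power_mono) auto
  also have "\<dots> \<le> 2 ^ p * (\<bar>a\<bar> ^ p + \<bar>b\<bar> ^ p)"
    by (simp add: power_mult_distrib max_def)
  finally show ?thesis .
qed

definition clamp :: "real \<Rightarrow> real \<Rightarrow> real"
  where "clamp M t = max (- M) (min M t)"

lemma clamp_truncation_tendsto:
  fixes f :: "'a::euclidean_space \<Rightarrow> real"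
  assumes f: "f \<in> borel_measurable borel" "integrable lborel (\<lambda>x. \<bar>f x\<bar> ^ p)" and "p > 0"
  shows "(\<lambda>n. \<integral>x. \<bar>f x - clamp (real n) (f x)\<bar> ^ p \<partial>lborel) \<longlonglongrightarrow> 0"
    and "integrable lborel (\<lambda>x. \<bar>f x - clamp (real n) (f x)\<bar> ^ p)"
proof -
  note [measurable] = f(1)
  have bound: "\<bar>f x - clamp (real n) (f x)\<bar> ^ p \<le> \<bar>f x\<bar> ^ p" for n x
    by (intro power_mono) (auto simp: clamp_def max_def min_def)
  have [measurable]: "(\<lambda>x. \<bar>f x - clamp (real n) (f x)\<bar> ^ p) \<in> borel_measurable lborel" for n
    unfolding clamp_def by measurable
  show "integrable lborel (\<lambda>x. \<bar>f x - clamp (real n) (f x)\<bar> ^ p)"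
    by (rule Bochner_Integration.integrable_bound[OF f(2)]) (use bound in auto)
  have "(\<lambda>n. \<integral>x. \<bar>f x - clamp (real n) (f x)\<bar> ^ p \<partial>lborel) \<longlonglongrightarrow> (\<integral>x. 0 \<partial>(lborel :: 'a measure))"
  proof (rule integral_dominated_convergence[where w = "\<lambda>x. \<bar>f x\<bar> ^ p"])
    show "AE x in lborel. (\<lambda>n. \<bar>f x - clamp (real n) (f x)\<bar> ^ p) \<longlonglongrightarrow> 0"
    proof (rule AE_I2)
      fix x
      obtain N where N: "\<bar>f x\<bar> \<le> real N" using real_arch_simple by blast
      have "eventually (\<lambda>n. \<bar>f x - clamp (real n) (f x)\<bar> ^ p = 0) sequentially"
        using eventually_ge_at_top[of N]
      proof eventually_elim
        case (elim n)
        then have "\<bar>f x\<bar> \<le> real n" using N by linarith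
        then have "clamp (real n) (f x) = f x" by (simp add: clamp_def abs_le_iff)
        then show ?case using \<open>p > 0\<close> by simp
      qed
      then show "(\<lambda>n. \<bar>f x - clamp (real n) (f x)\<bar> ^ p) \<longlonglongrightarrow> 0"
        by (rule tendsto_eventually)
    qed
  qed (use f bound in auto)
  then show "(\<lambda>n. \<integral>x. \<bar>f x - clamp (real n) (f x)\<bar> ^ p \<partial>lborel) \<longlonglongrightarrow> 0" by simp
qed

text \<open>A measurable function is an almost everywhere limit of continuous functions; clamping them to the bound
of \<open>f\<close> and cutting them off makes dominated convergence applicable.\<close>

lemma bounded_approx_continuous:
  fixes f :: "'a::euclidean_space \<Rightarrow> real"
  assumes f: "f \<in> borel_measurable borel" "supp_in R f" "\<And>x. \<bar>f x\<bar> \<le> M" and "p > 0" "e > 0"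
  obtains g where "continuous_on UNIV g" "supp_in (R + 1) g"
    "integrable lborel (\<lambda>x. \<bar>f x - g x\<bar> ^ p)" "(\<integral>x. \<bar>f x - g x\<bar> ^ p \<partial>lborel) < e"
proof -
  note [measurable] = f(1)
  have M: "M \<ge> 0" using f(3)[of undefined] by linarith
  have "f measurable_on UNIV"
    by (rule lebesgue_measurable_imp_measurable_on) (use f(1) in \<open>auto intro: measurable_completion\<close>)
  then obtain N g where N: "negligible N" and g: "\<And>n. continuous_on UNIV (g n)"
    and lim: "\<And>x. x \<notin> N \<Longrightarrow> (\<lambda>n. g n x) \<longlonglongrightarrow> f x"
    unfolding measurable_on_def by auto
  \<comment> \<open>A continuous cutoff between the radii \<open>R\<close> and \<open>R + 1\<close>.\<close>
  define z where "z x = max 0 (min 1 (R + 1 - norm x))" for x :: 'a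
  define h where "h n x = clamp M (g n x) * z x" for n x
  have zc: "continuous_on UNIV z" unfolding z_def by (intro continuous_intros)
  have hc: "continuous_on UNIV (h n)" for n
    unfolding h_def clamp_def by (intro continuous_intros g zc)
  note [measurable] = continuous_borel[OF hc]
  have hs: "supp_in (R + 1) (h n)" for n
    by (auto simp: supp_in_def h_def z_def)
  have z01: "0 \<le> z x" "z x \<le> 1" for x by (auto simp: z_def)
  have cb: "\<bar>clamp M t\<bar> \<le> M" for t using M by (auto simp: clamp_def)
  have hb: "\<bar>h n x\<bar> \<le> M" for n x
    using mult_mono[OF cb[of "g n x"] z01(2)[of x]] M z01(1)[of x] by (simp add: h_def abs_mult)
  have fz: "clamp M (f x) * z x = f x" for x
  proof (cases "R < norm x")
    case True
    then show ?thesis using supp_inD[OF f(2) True] M by (simp add: clamp_def)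
  next
    case False
    then have "z x = 1" by (simp add: z_def)
    moreover have "clamp M (f x) = f x" using f(3)[of x] by (simp add: clamp_def abs_le_iff)
    ultimately show ?thesis by simp
  qed
  have ae: "AE x in lborel. x \<notin> N"
    using AE_not_in[of N lebesgue] N by (simp add: negligible_iff_null_sets AE_completion_iff)
  let ?w = "\<lambda>x. (2 * M) ^ p * indicat_real (cball 0 (R + 1)) x"
  have w: "integrable lborel ?w" using integrable_indicator_cball by auto
  have bound: "\<bar>f x - h n x\<bar> ^ p \<le> ?w x" for n x
  proof (cases "x \<in> cball 0 (R + 1)")
    case True
    have "\<bar>f x - h n x\<bar> ^ p \<le> (2 * M) ^ p"
      using f(3)[of x] hb[of n x] by (intro power_mono) auto
    with True show ?thesis by simp
  next
    case False
    then have "f x = 0" "h n x = 0"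
      using supp_inD[OF f(2), of x] supp_inD[OF hs, of x n] by auto
    with False show ?thesis using \<open>p > 0\<close> by (simp add: zero_power)
  qed
  have int: "integrable lborel (\<lambda>x. \<bar>f x - h n x\<bar> ^ p)" for n
    by (rule Bochner_Integration.integrable_bound[OF w])
      (use bound in \<open>auto intro!: AE_I2 intro: order_trans[OF _ abs_ge_self]\<close>)
  have "(\<lambda>n. \<integral>x. \<bar>f x - h n x\<bar> ^ p \<partial>lborel) \<longlonglongrightarrow> (\<integral>x. 0 \<partial>(lborel :: 'a measure))"
  proof (rule integral_dominated_convergence[where w = ?w])
    show "AE x in lborel. (\<lambda>n. \<bar>f x - h n x\<bar> ^ p) \<longlonglongrightarrow> 0"
      using ae
    proof eventually_elim
      case (elim x)
      have "(\<lambda>n. h n x) \<longlonglongrightarrow> clamp M (f x) * z x"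
        unfolding h_def clamp_def by (intro tendsto_intros lim elim)
      then have "(\<lambda>n. h n x) \<longlonglongrightarrow> f x" by (simp add: fz)
      then have "(\<lambda>n. \<bar>f x - h n x\<bar> ^ p) \<longlonglongrightarrow> \<bar>f x - f x\<bar> ^ p" by (intro tendsto_intros)
      then show ?case using \<open>p > 0\<close> by (simp only: diff_self abs_zero zero_power)
    qed
  qed (use w bound in auto)
  then have "eventually (\<lambda>n. (\<integral>x. \<bar>f x - h n x\<bar> ^ p \<partial>lborel) < e) sequentially"
    using \<open>e > 0\<close> by (intro order_tendstoD) auto
  then obtain n where "(\<integral>x. \<bar>f x - h n x\<bar> ^ p \<partial>lborel) < e"
    using eventually_happens by force
  with that[OF hc hs int] show ?thesis by blast
qed

lemma Lp_approx_continuous: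
  fixes f :: "'a::euclidean_space \<Rightarrow> real"
  assumes f: "f \<in> borel_measurable borel" "integrable lborel (\<lambda>x. \<bar>f x\<bar> ^ p)" "supp_in R f"
    and "p > 0" "e > 0"
  obtains g where "continuous_on UNIV g" "supp_in (R + 1) g"
    "integrable lborel (\<lambda>x. \<bar>f x - g x\<bar> ^ p)" "(\<integral>x. \<bar>f x - g x\<bar> ^ p \<partial>lborel) < e"
proof -
  note [measurable] = f(1)
  define d where "d = e / (2 * 2 ^ p)"
  have d: "d > 0" using \<open>e > 0\<close> by (simp add: d_def)
  have "eventually (\<lambda>n. (\<integral>x. \<bar>f x - clamp (real n) (f x)\<bar> ^ p \<partial>lborel) < d) sequentially"
    using clamp_truncation_tendsto(1)[OF f(1,2) \<open>p > 0\<close>] d by (intro order_tendstoD) auto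
  then obtain n where n: "(\<integral>x. \<bar>f x - clamp (real n) (f x)\<bar> ^ p \<partial>lborel) < d"
    using eventually_happens by force
  let ?f = "\<lambda>x. clamp (real n) (f x)"
  have f1: "?f \<in> borel_measurable borel" unfolding clamp_def by measurable
  have f2: "supp_in R ?f" using f(3) by (simp add: supp_in_def clamp_def)
  have f3: "\<bar>?f x\<bar> \<le> real n" for x by (auto simp: clamp_def)
  obtain g where g: "continuous_on UNIV g" "supp_in (R + 1) g"
    "integrable lborel (\<lambda>x. \<bar>?f x - g x\<bar> ^ p)" "(\<integral>x. \<bar>?f x - g x\<bar> ^ p \<partial>lborel) < d"
    using bounded_approx_continuous[OF f1 f2 f3 \<open>p > 0\<close> d] by blast
  note [measurable] = continuous_borel[OF g(1)]
  let ?w = "\<lambda>x. 2 ^ p * (\<bar>f x - ?f x\<bar> ^ p + \<bar>?f x - g x\<bar> ^ p)"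
  have w: "integrable lborel ?w"
    using clamp_truncation_tendsto(2)[OF f(1,2) \<open>p > 0\<close>] g(3) by simp
  have bound: "\<bar>f x - g x\<bar> ^ p \<le> ?w x" for x
    using power_add_le[of "f x - ?f x" "?f x - g x" p] by simp
  have int: "integrable lborel (\<lambda>x. \<bar>f x - g x\<bar> ^ p)"
    by (rule Bochner_Integration.integrable_bound[OF w])
      (use bound in \<open>auto intro!: AE_I2 intro: order_trans[OF _ abs_ge_self]\<close>)
  have "(\<integral>x. \<bar>f x - g x\<bar> ^ p \<partial>lborel) \<le> (\<integral>x. ?w x \<partial>lborel)"
    by (rule integral_mono[OF int w bound])
  also have "\<dots> = 2 ^ p * ((\<integral>x. \<bar>f x - ?f x\<bar> ^ p \<partial>lborel) + (\<integral>x. \<bar>?f x - g x\<bar> ^ p \<partial>lborel))"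
    using clamp_truncation_tendsto(2)[OF f(1,2) \<open>p > 0\<close>] g(3) by simp
  also have "\<dots> < 2 ^ p * (d + d)"
    using n g(4) by (intro mult_strict_left_mono add_strict_mono) auto
  also have "\<dots> = e" by (simp add: d_def)
  finally show ?thesis using that[OF g(1,2) int] by blast
qed

lemma conv_near_continuous:
  fixes K :: "'a::euclidean_space \<Rightarrow> real"
  assumes K: "prob_kernel r K" and g: "continuous_on UNIV g"
    and near: "\<And>y. norm (x - y) \<le> r \<Longrightarrow> \<bar>g y - g x\<bar> \<le> e"
  shows "\<bar>conv K g x - g x\<bar> \<le> e"
proof -
  note K' = prob_kernelD[OF K]
  note [measurable] = K'(7) continuous_borel[OF g]
  have i1: "integrable lborel (\<lambda>y. K (x - y) * g y)"
    by (intro conv_integrable[OF K'(1,4)] Lloc_continuous g)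
  have i2: "integrable lborel (\<lambda>y. K (x - y) * c)" for c
    by (intro conv_integrable[OF K'(1,4)] Lloc_continuous) auto
  have one: "(\<integral>y. K (x - y) * c \<partial>lborel) = c" for c
    using lborel_integral_reflect(1)[OF K'(7), of x] K'(3) by simp
  have "conv K g x - g x = (\<integral>y. K (x - y) * g y \<partial>lborel) - (\<integral>y. K (x - y) * g x \<partial>lborel)"
    by (simp only: one conv_def)
  also have "\<dots> = (\<integral>y. K (x - y) * g y - K (x - y) * g x \<partial>lborel)"
    by (rule Bochner_Integration.integral_diff[symmetric, OF i1 i2])
  finally have eq: "conv K g x - g x = (\<integral>y. K (x - y) * g y - K (x - y) * g x \<partial>lborel)" .
  have pw: "\<bar>K (x - y) * g y - K (x - y) * g x\<bar> \<le> K (x - y) * e" for y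
  proof (cases "norm (x - y) \<le> r")
    case True
    have "\<bar>K (x - y) * g y - K (x - y) * g x\<bar> = K (x - y) * \<bar>g y - g x\<bar>"
      using K'(2)[of "x - y"] by (simp add: abs_mult flip: right_diff_distrib)
    also have "\<dots> \<le> K (x - y) * e" by (intro mult_left_mono near True K'(2))
    finally show ?thesis .
  next
    case False
    then show ?thesis using supp_inD[OF K'(4), of "x - y"] by simp
  qed
  have "\<bar>conv K g x - g x\<bar> \<le> (\<integral>y. \<bar>K (x - y) * g y - K (x - y) * g x\<bar> \<partial>lborel)"
    unfolding eq by (rule integral_abs_bound)
  also have "\<dots> \<le> (\<integral>y. K (x - y) * e \<partial>lborel)"
    by (intro integral_mono i2 pw integrable_abs Bochner_Integration.integrable_diff i1)
  finally show ?thesis by (simp only: one)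
qed

text \<open>The usual three-term estimate: \<open>f\<close> is close to a continuous function \<open>g\<close> in \<open>L\<^sup>p\<close>, mollification does not
increase the \<open>L\<^sup>p\<close> distance, and \<open>g\<close> is uniformly close to its mollification.\<close>

lemma mollifier_Lp_tendsto:
  fixes K :: "nat \<Rightarrow> 'a::euclidean_space \<Rightarrow> real"
  assumes K: "\<And>n. prob_kernel (r n) (K n)" and r: "r \<longlonglongrightarrow> 0" and f: "Lloc (2 ^ k) f"
  shows "(\<lambda>n. \<integral>x. indicator (cball 0 R) x * \<bar>conv (K n) f x - f x\<bar> ^ (2 ^ k) \<partial>lborel) \<longlonglongrightarrow> 0"
proof -
  define p where "p = (2::nat) ^ k"
  have p: "p > 0" by (simp add: p_def)
  have four: "(4::real) ^ p = 2 ^ p * 2 ^ p" by (simp flip: power_mult_distrib)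
  define F where "F y = indicator (cball 0 (R + 1)) y * f y" for y
  note [measurable] = Lloc_measurable[OF f] prob_kernelD(7)[OF K]
  have F1[measurable]: "F \<in> borel_measurable borel" unfolding F_def by measurable
  have Fp: "(\<lambda>y. \<bar>F y\<bar> ^ p) = (\<lambda>y. indicator (cball 0 (R + 1)) y * \<bar>f y\<bar> ^ p)"
    using p by (auto simp: F_def indicator_def)
  have F2: "integrable lborel (\<lambda>y. \<bar>F y\<bar> ^ p)"
    unfolding Fp using Lloc_integrable[OF f] by (simp add: p_def)
  have F3: "supp_in (R + 1) F" by (auto simp: supp_in_def F_def)
  define V where "V = (\<integral>x. indicat_real (cball (0::'a) R) x \<partial>lborel)"
  have V: "V \<ge> 0" unfolding V_def by (intro Bochner_Integration.integral_nonneg) auto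
  show ?thesis
  proof (rule tendstoI)
    fix e0 :: real assume "e0 > 0"
    define e where "e = e0 / (4 * 4 ^ p)"
    have e: "e > 0" using \<open>e0 > 0\<close> by (simp add: e_def)
    obtain g where g: "continuous_on UNIV g" "supp_in (R + 1 + 1) g"
      "integrable lborel (\<lambda>x. \<bar>F x - g x\<bar> ^ p)" "(\<integral>x. \<bar>F x - g x\<bar> ^ p \<partial>lborel) < e"
      using Lp_approx_continuous[OF F1 F2 F3 p e] by blast
    note [measurable] = continuous_borel[OF g(1)]
    \<comment> \<open>The minimum with 1 gives \<open>e'\<^bsup>p\<^esup> \<le> e'\<close>.\<close>
    define e' where "e' = min 1 (e / (1 + V))"
    have e': "e' > 0" using e V by (simp add: e'_def)
    have e'p: "e' ^ p * V \<le> e"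
    proof -
      have "e' ^ p \<le> e' ^ 1" using p e' by (intro power_decreasing) (auto simp: e'_def)
      then have "e' ^ p * V \<le> e / (1 + V) * (1 + V)"
        using V e e' by (intro mult_mono) (auto simp: e'_def)
      then show ?thesis using V by simp
    qed
    have "uniformly_continuous_on (cball 0 (R + 1)) g"
      by (intro compact_uniformly_continuous continuous_on_subset[OF g(1)]) auto
    then obtain d where d: "d > 0"
      "\<And>x y. x \<in> cball 0 (R + 1) \<Longrightarrow> y \<in> cball 0 (R + 1) \<Longrightarrow> dist y x < d \<Longrightarrow> dist (g y) (g x) < e'"
      using e' unfolding uniformly_continuous_on_def by metis
    have ev: "eventually (\<lambda>n. r n < min d 1) sequentially"
      using r d(1) by (intro order_tendstoD) auto
    show "eventually (\<lambda>n. dist (\<integral>x. indicator (cball 0 R) x * \<bar>conv (K n) f x - f x\<bar> ^ (2 ^ k) \<partial>lborel) 0 < e0) sequentially"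
      using ev
    proof eventually_elim
      case (elim n)
      note K' = prob_kernelD[OF K[of n]]
      have LF: "Lloc 1 F" by (rule Lloc_mono[OF Lloc_global[OF F1 F2]]) (use p in simp)
      let ?D = "\<lambda>x. F x - g x"
      have D: "?D \<in> borel_measurable borel" by measurable
      have Y: "integrable lborel (\<lambda>x. \<bar>conv (K n) ?D x\<bar> ^ p)"
        "(\<integral>x. \<bar>conv (K n) ?D x\<bar> ^ p \<partial>lborel) \<le> (\<integral>x. \<bar>?D x\<bar> ^ p \<partial>lborel)"
        using Young_prob_kernel[OF K D, of k n] g(3) by (auto simp: p_def)
      have split: "conv (K n) f x - f x = conv (K n) ?D x + (conv (K n) g x - g x) + - ?D x"
        if x: "x \<in> cball 0 R" for x
      proof -
        have "conv (K n) f x = conv (K n) (\<lambda>y. indicator (cball 0 (R + r n)) y * f y) x"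
          using x by (intro conv_truncate K') simp
        also have "(\<lambda>y. indicator (cball 0 (R + r n)) y * f y) = (\<lambda>y. indicator (cball 0 (R + r n)) y * F y)"
          using elim by (auto simp: F_def indicator_def fun_eq_iff)
        also have "conv (K n) \<dots> x = conv (K n) F x"
          using x by (intro conv_truncate[symmetric] K') simp
        finally have "conv (K n) f x = conv (K n) F x" .
        moreover have "f x = F x" using x by (simp add: F_def)
        moreover have "conv (K n) ?D x = conv (K n) F x - conv (K n) g x"
          by (intro conv_add_right[OF K'(1,4)] LF Lloc_continuous g)
        ultimately show ?thesis by simp
      qed
      have gx: "\<bar>conv (K n) g x - g x\<bar> \<le> e'" if x: "x \<in> cball 0 R" for x
      proof (rule conv_near_continuous[OF K g(1)])
        fix y assume "norm (x - y) \<le> r n"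
        then have "dist y x < d" "norm (x - y) \<le> 1"
          using elim by (auto simp: dist_norm norm_minus_commute)
        moreover from this(2) have "norm y \<le> R + 1"
          using x norm_triangle_ineq2[of y x] by (simp add: norm_minus_commute)
        ultimately have "dist (g y) (g x) < e'" using x by (intro d) auto
        then show "\<bar>g y - g x\<bar> \<le> e'" by (simp add: dist_real_def)
      qed
      let ?w = "\<lambda>x. 4 ^ p * (\<bar>conv (K n) ?D x\<bar> ^ p + indicat_real (cball 0 R) x * e' ^ p + \<bar>?D x\<bar> ^ p)"
      have pw: "indicator (cball 0 R) x * \<bar>conv (K n) f x - f x\<bar> ^ p \<le> ?w x" for x
      proof (cases "x \<in> cball 0 R")
        case True
        have "\<bar>conv (K n) f x - f x\<bar> ^ p
          \<le> 2 ^ p * (\<bar>conv (K n) ?D x + (conv (K n) g x - g x)\<bar> ^ p + \<bar>- ?D x\<bar> ^ p)"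
          unfolding split[OF True] by (rule power_add_le)
        also have "\<dots> \<le> 2 ^ p * (2 ^ p * (\<bar>conv (K n) ?D x\<bar> ^ p + \<bar>conv (K n) g x - g x\<bar> ^ p) + 2 ^ p * \<bar>?D x\<bar> ^ p)"
          using power_add_le[of "conv (K n) ?D x" "conv (K n) g x - g x" p]
            mult_right_mono[of 1 "2 ^ p" "\<bar>?D x\<bar> ^ p"]
          by (intro mult_left_mono add_mono) (auto simp: abs_minus_commute)
        also have "\<dots> = 4 ^ p * (\<bar>conv (K n) ?D x\<bar> ^ p + \<bar>conv (K n) g x - g x\<bar> ^ p + \<bar>?D x\<bar> ^ p)"
          unfolding four by (simp only: algebra_simps)
        also have "\<dots> \<le> ?w x"
          using True gx[OF True] by (intro mult_left_mono add_mono) (auto intro!: power_mono)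
        finally show ?thesis using True by simp
      next
        case False
        then show ?thesis by simp
      qed
      have I: "integrable lborel (\<lambda>x. indicat_real (cball (0::'a) R) x * e' ^ p)"
        by (intro integrable_mult_left integrable_indicator_cball)
      have w: "integrable lborel ?w"
        by (intro integrable_mult_right Bochner_Integration.integrable_add I Y(1) g(3))
      have "(\<integral>x. indicator (cball 0 R) x * \<bar>conv (K n) f x - f x\<bar> ^ p \<partial>lborel) \<le> (\<integral>x. ?w x \<partial>lborel)"
        by (rule integral_mono'[OF w pw], rule order_trans[OF _ pw]) simp
      also have "\<dots> = 4 ^ p * ((\<integral>x. \<bar>conv (K n) ?D x\<bar> ^ p \<partial>lborel) + V * e' ^ p + (\<integral>x. \<bar>?D x\<bar> ^ p \<partial>lborel))"
        using Y(1) g(3) I Bochner_Integration.integrable_add[OF Y(1) I] by (simp add: V_def)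
      also have "\<dots> \<le> 4 ^ p * (e + e + e)"
        using Y(2) g(4) e'p by (intro mult_left_mono add_mono) (auto simp: mult.commute)
      also have "\<dots> < e0" using \<open>e0 > 0\<close> by (simp add: e_def)
      finally have "(\<integral>x. indicator (cball 0 R) x * \<bar>conv (K n) f x - f x\<bar> ^ p \<partial>lborel) < e0" .
      moreover have "0 \<le> (\<integral>x. indicator (cball 0 R) x * \<bar>conv (K n) f x - f x\<bar> ^ p \<partial>lborel)"
        by (intro Bochner_Integration.integral_nonneg) auto
      ultimately show ?case by (simp add: p_def)
    qed
  qed
qed

section \<open>Radial kernels and a truncated Newtonian potential\<close>

text \<open>A superposition of the rescalings of one profile over the scales in \<open>{a..b}\<close>.\<close>

definition scale_int :: "real \<Rightarrow> real \<Rightarrow> nat \<Rightarrow> (real^'n \<Rightarrow> real) \<Rightarrow> real^'n::finite \<Rightarrow> real"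
  where "scale_int a b k F x = (\<integral>s. indicator {a..b} s * (F (x /\<^sub>R s) / s ^ k) \<partial>lborel)"

lemma scale_int_deriv:
  fixes F :: "real^'n::finite \<Rightarrow> real"
  assumes F: "smooth_fun F" "supp_in r F" and a: "0 < a"
  shows "scale_int a b k F differentiable (at x)"
    and "partial_deriv i (scale_int a b k F) = scale_int a b (Suc k) (partial_deriv i F)"
proof -
  have [measurable]: "grad F \<in> borel_measurable borel"
    using continuous_grad[OF F(1)] by (rule borel_measurable_continuous_onI)
  have cF: "continuous_on UNIV F" by (rule smooth_fun_continuous[OF F(1)])
  note [measurable] = continuous_borel[OF cF]
  obtain C where C: "C \<ge> 0" "\<And>x. norm (grad F x) \<le> C" using grad_bounded[OF F] by blast
  obtain B where B: "B \<ge> 0" "\<And>x. \<bar>F x\<bar> \<le> B" using continuous_supp_bounded[OF cF F(2)] by blast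
  let ?f = "\<lambda>x s. indicator {a..b} s * (F (x /\<^sub>R s) / s ^ k)"
  let ?D = "\<lambda>x s. (indicator {a..b} s / s ^ Suc k) *\<^sub>R grad F (x /\<^sub>R s)"
  have iab: "integrable lborel (indicat_real {a..b})"
    by (rule integrable_real_indicator) (auto simp: emeasure_lborel_Icc_eq)
  have pw: "1 / s ^ j \<le> 1 / a ^ j" if "s \<in> {a..b}" for s j
    using that a by (intro divide_left_mono power_mono mult_pos_pos zero_less_power) auto
  have f: "integrable lborel (?f x)" for x
  proof (rule Bochner_Integration.integrable_bound)
    show "integrable lborel (\<lambda>s. B / a ^ k * indicat_real {a..b} s)" using iab by simp
    show "AE s in lborel. norm (?f x s) \<le> norm (B / a ^ k * indicat_real {a..b} s)"
    proof (rule AE_I2)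
      fix s
      show "norm (?f x s) \<le> norm (B / a ^ k * indicat_real {a..b} s)"
      proof (cases "s \<in> {a..b}")
        case True
        have "\<bar>F (x /\<^sub>R s)\<bar> * (1 / s ^ k) \<le> B * (1 / a ^ k)"
          using True a B by (intro mult_mono pw) auto
        then show ?thesis using True a B by (simp add: abs_mult)
      qed simp
    qed
  qed measurable
  have der: "((\<lambda>x. ?f x s) has_derivative (\<lambda>h. ?D x s \<bullet> h)) (at x)" for x s
  proof -
    have "((\<lambda>x. F (x /\<^sub>R s)) has_derivative (\<lambda>h. grad F (x /\<^sub>R s) \<bullet> (h /\<^sub>R s))) (at x)"
      by (rule has_derivative_compose[OF _ grad_has_derivative[OF F(1)]])
        (auto intro!: derivative_eq_intros)
    then have "((\<lambda>x. indicator {a..b} s / s ^ k * F (x /\<^sub>R s)) has_derivative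
        (\<lambda>h. indicator {a..b} s / s ^ k * (grad F (x /\<^sub>R s) \<bullet> (h /\<^sub>R s)))) (at x)"
      by (rule has_derivative_mult_right)
    then show ?thesis by (simp add: field_simps)
  qed
  have bound: "norm (?D x s) \<le> C / a ^ Suc k * indicat_real {a..b} s" for x s
  proof (cases "s \<in> {a..b}")
    case True
    have "1 / s ^ Suc k * norm (grad F (x /\<^sub>R s)) \<le> 1 / a ^ Suc k * C"
      using True a C by (intro mult_mono pw) auto
    then show ?thesis using True a by (simp add: abs_mult)
  qed simp
  have w: "integrable lborel (\<lambda>s. C / a ^ Suc k * indicat_real {a..b} s)" using iab by simp
  have meas: "?D x \<in> borel_measurable lborel" for x by measurable
  note * = has_derivative_integral_parameter[of lborel ?f ?D, OF der f meas bound w]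
  have **: "(scale_int a b k F has_derivative (\<lambda>h. (\<integral>s. ?D x s \<partial>lborel) \<bullet> h)) (at x)" for x
    using *(1)[of x] by (simp add: scale_int_def[abs_def])
  then show "scale_int a b k F differentiable (at x)" by (auto simp: differentiable_def)
  show "partial_deriv i (scale_int a b k F) = scale_int a b (Suc k) (partial_deriv i F)"
  proof
    fix x
    have "partial_deriv i (scale_int a b k F) x = (\<integral>s. ?D x s \<partial>lborel) \<bullet> axis i 1"
      using partial_deriv_eq[OF **] by simp
    also have "\<dots> = (\<integral>s. ?D x s \<bullet> axis i 1 \<partial>lborel)"
      using *(2) by (intro integral_inner_left[symmetric]) auto
    also have "\<dots> = scale_int a b (Suc k) (partial_deriv i F) x"
      by (simp add: scale_int_def inner_axis grad_def)
    finally show "partial_deriv i (scale_int a b k F) x = scale_int a b (Suc k) (partial_deriv i F) x" .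
  qed
qed

lemma scale_int_smooth:
  fixes F :: "real^'n::finite \<Rightarrow> real"
  assumes F: "smooth_fun F" "supp_in r F" and a: "0 < a"
  shows "smooth_fun (scale_int a b k F)"
proof (rule smooth_coinduct[of _ "{scale_int a b k F | k F. smooth_fun F \<and> supp_in r F}"])
  fix g :: "real^'n \<Rightarrow> real" and x i
  assume "g \<in> {scale_int a b k F | k F. smooth_fun F \<and> supp_in r F}"
  then obtain k F where F: "smooth_fun F" "supp_in r F" and g: "g = scale_int a b k F" by auto
  show "g differentiable (at x)" unfolding g by (rule scale_int_deriv(1)[OF F a])
  show "partial_deriv i g \<in> {scale_int a b k F | k F. smooth_fun F \<and> supp_in r F}"
    unfolding g scale_int_deriv(2)[OF F a]
    using smooth_fun_partial_deriv[OF F(1)] supp_in_partial_deriv[OF F(2,1)] by blast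
qed (use F in auto)

lemma scale_int_supp_in:
  fixes F :: "real^'n::finite \<Rightarrow> real"
  assumes F: "supp_in 1 F" and a: "0 < a"
  shows "supp_in b (scale_int a b k F)"
  unfolding supp_in_def
proof (intro allI impI)
  fix x :: "real^'n" assume x: "b < norm x"
  have "indicator {a..b} s * (F (x /\<^sub>R s) / s ^ k) = 0" for s
  proof (cases "s \<in> {a..b}")
    case True
    then have "1 < norm (x /\<^sub>R s)" using x a by (simp add: field_simps)
    then show ?thesis using supp_inD[OF F] by simp
  qed simp
  then have "(\<lambda>s. indicator {a..b} s * (F (x /\<^sub>R s) / s ^ k)) = (\<lambda>s. 0)" by blast
  then show "scale_int a b k F x = 0" by (simp add: scale_int_def)
qed

definition bump :: "real^'n::finite \<Rightarrow> real"
  where "bump x = flat 0 (1 - x \<bullet> x)"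

text \<open>The gradient of the bump at \<open>x\<close> is \<open>- profile x\<close> times \<open>x\<close>. This relation between the two functions makes
\<open>moll_scale_derivative\<close> work.\<close>

definition profile :: "real^'n::finite \<Rightarrow> real"
  where "profile x = 2 * flat 2 (1 - x \<bullet> x)"

lemma flat_ball_supp_in: "supp_in 1 (\<lambda>x::real^'n::finite. flat k (1 - x \<bullet> x))"
proof -
  have "1 - x \<bullet> x \<le> 0" if "1 < norm x" for x :: "real^'n"
    using that power_mono[of 1 "norm x" 2] by (simp add: power2_norm_eq_inner)
  then show ?thesis by (force simp: supp_in_def flat_def)
qed

lemma bump_smooth: "smooth_fun bump" and bump_supp_in: "supp_in 1 bump"
  and bump_nonneg: "0 \<le> bump x" and bump_le_1: "bump x \<le> 1"
  using smooth_fun_flat_ball flat_ball_supp_in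
  by (auto simp: bump_def[abs_def] flat_def)

lemma profile_smooth: "smooth_fun profile" and profile_supp_in: "supp_in 1 profile" and profile_nonneg: "0 \<le> profile x"
  using smooth_fun_cmult[OF smooth_fun_flat_ball] supp_in_mult(2)[OF flat_ball_supp_in]
  by (auto simp: profile_def[abs_def] flat_nonneg)

lemma laplacian_bump:
  fixes x :: "real^'n::finite"
  shows "(\<Sum>i\<in>UNIV. partial_deriv i (partial_deriv i bump) x) =
    4 * (x \<bullet> x) * (flat 4 (1 - x \<bullet> x) - 2 * flat 3 (1 - x \<bullet> x)) - 2 * CARD('n) * flat 2 (1 - x \<bullet> x)"
proof -
  have 1: "partial_deriv i bump = (\<lambda>x::real^'n. flat 2 (1 - x \<bullet> x) * (- 2 * x $ i))" for i
    using partial_deriv_flat_ball[of i 0] by (simp add: bump_def[abs_def] numeral_2_eq_2)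
  have 2: "partial_deriv i (partial_deriv i bump) x =
      4 * (x $ i * x $ i) * (flat 4 (1 - x \<bullet> x) - 2 * flat 3 (1 - x \<bullet> x)) - 2 * flat 2 (1 - x \<bullet> x)" for i
  proof -
    have 3: "partial_deriv i (\<lambda>x::real^'n. - 2 * x $ i) = (\<lambda>x. - 2)"
      by (subst partial_deriv_smooth_cmult[OF smooth_fun_component]) (simp add: partial_deriv_component)
    show ?thesis
      unfolding 1 partial_deriv_smooth_mult[OF smooth_fun_flat_ball smooth_fun_cmult[OF smooth_fun_component]]
        3 partial_deriv_flat_ball
      by (simp add: eval_nat_numeral algebra_simps)
  qed
  show ?thesis
    unfolding 2 by (simp add: sum_subtractf inner_vec_def sum_distrib_left sum_distrib_right)
qed

definition profile_mass :: real
  where "profile_mass = (\<integral>x. profile (x :: real^3) \<partial>lborel)"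

lemma profile_mass_pos: "profile_mass > 0"
proof -
  have int: "integrable lborel (profile :: real^3 \<Rightarrow> real)"
    by (rule integrable_continuous_supp[OF smooth_fun_continuous[OF profile_smooth] profile_supp_in])
  have "profile_mass \<noteq> 0"
  proof
    assume "profile_mass = 0"
    then have "AE x in lborel. profile (x :: real^3) = 0"
      using integral_nonneg_eq_0_iff_AE[OF int] profile_nonneg by (auto simp: profile_mass_def)
    then have "AE x in lebesgue. profile (x :: real^3) = 0" by (rule AE_completion)
    then obtain N where "N \<in> null_sets lebesgue" "{x :: real^3. profile x \<noteq> 0} \<subseteq> N"
      by (auto simp: eventually_ae_filter)
    then have "negligible {x :: real^3. profile x \<noteq> 0}"
      by (metis negligible_iff_null_sets negligible_subset)
    moreover have "open {x :: real^3. profile x \<noteq> 0}"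
      by (intro open_Collect_neq smooth_fun_continuous profile_smooth continuous_intros)
    moreover have "0 \<in> {x :: real^3. profile x \<noteq> 0}" by (simp add: profile_def flat_def)
    ultimately show False using open_not_negligible by blast
  qed
  moreover have "profile_mass \<ge> 0"
    unfolding profile_mass_def by (intro Bochner_Integration.integral_nonneg profile_nonneg)
  ultimately show ?thesis by simp
qed

definition moll :: "real \<Rightarrow> real^3 \<Rightarrow> real"
  where "moll s x = profile (x /\<^sub>R s) / (profile_mass * s ^ 3)"

lemma moll_eq: "moll s = (\<lambda>x. (1 / (profile_mass * s ^ 3)) * profile (x /\<^sub>R s))"
  by (simp add: moll_def fun_eq_iff)

lemma moll_smooth: "smooth_fun (moll s)"
  unfolding moll_eq by (intro smooth_fun_cmult smooth_fun_scale profile_smooth)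

lemma supp_in_scale: "supp_in 1 f \<Longrightarrow> s > 0 \<Longrightarrow> supp_in s (\<lambda>x. f (x /\<^sub>R s))"
  by (auto simp: supp_in_def field_simps)

lemma moll_supp_in: "s > 0 \<Longrightarrow> supp_in s (moll s)"
  unfolding moll_eq by (rule supp_in_mult(2)[OF supp_in_scale[OF profile_supp_in]])

lemma integral_scale:
  fixes f :: "real^3 \<Rightarrow> real"
  assumes "f \<in> borel_measurable borel" "s > 0"
  shows "(\<integral>x. f (x /\<^sub>R s) \<partial>lborel) = s ^ 3 * (\<integral>x. f x \<partial>lborel)"
  using lborel_integral_affine(1)[of "inverse s" f 0] assms by (simp add: field_simps power3_eq_cube)

lemma moll_prob_kernel: "s > 0 \<Longrightarrow> prob_kernel s (moll s)"
proof -
  assume s: "s > 0"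
  have "(\<integral>x. profile (x /\<^sub>R s :: real^3) \<partial>lborel) = s ^ 3 * profile_mass"
    unfolding profile_mass_def
    by (rule integral_scale[OF continuous_borel[OF smooth_fun_continuous[OF profile_smooth]] s])
  then have one: "(\<integral>x. moll s x \<partial>lborel) = 1"
    using s profile_mass_pos by (simp add: moll_def)
  show ?thesis
    unfolding prob_kernel_def
  proof (intro conjI allI one moll_supp_in[OF s])
    show "continuous_on UNIV (moll s)" by (rule smooth_fun_continuous[OF moll_smooth])
    show "0 \<le> moll s x" for x
      unfolding moll_def using s profile_mass_pos
      by (intro divide_nonneg_pos profile_nonneg mult_pos_pos zero_less_power)
  qed
qed

lemma moll_deriv_L1:
  obtains C where "C \<ge> 0" "\<And>i s. s > 0 \<Longrightarrow> (\<integral>x. \<bar>partial_deriv i (moll s) x\<bar> \<partial>lborel) \<le> C / s"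
proof -
  define I where "I i = (\<integral>x. \<bar>partial_deriv i profile (x :: real^3)\<bar> \<partial>lborel)" for i
  have I: "I i \<ge> 0" for i unfolding I_def by (intro Bochner_Integration.integral_nonneg) auto
  have eq: "(\<integral>x. \<bar>partial_deriv i (moll s) x\<bar> \<partial>lborel) = I i / profile_mass / s" if s: "s > 0" for i s
  proof -
    have "partial_deriv i (moll s) = (\<lambda>x. (1 / (profile_mass * s ^ 3)) * (partial_deriv i profile (x /\<^sub>R s) / s))"
      unfolding moll_eq
      by (simp only: partial_deriv_smooth_cmult[OF smooth_fun_scale[OF profile_smooth]]
          partial_deriv_scale[OF profile_smooth])
    then have "(\<integral>x. \<bar>partial_deriv i (moll s) x\<bar> \<partial>lborel) =
        (\<integral>x. (1 / (profile_mass * s ^ 3 * s)) * \<bar>partial_deriv i profile (x /\<^sub>R s)\<bar> \<partial>lborel)"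
      using s profile_mass_pos by (simp add: abs_mult)
    also have "\<dots> = (1 / (profile_mass * s ^ 3 * s)) * (s ^ 3 * I i)"
      using integral_scale[OF borel_measurable_abs[OF continuous_borel[OF smooth_fun_continuous[OF
          smooth_fun_partial_deriv[OF profile_smooth]]]] s, of i]
      by (simp only: I_def integral_mult_right_zero)
    also have "\<dots> = I i / profile_mass / s" using s profile_mass_pos by (simp add: field_simps)
    finally show ?thesis .
  qed
  show ?thesis
  proof (rule that[of "(\<Sum>i\<in>UNIV. I i) / profile_mass"])
    fix i and s :: real assume s: "s > 0"
    have "I i \<le> (\<Sum>i\<in>UNIV. I i)" by (rule member_le_sum) (use I in auto)
    then show "(\<integral>x. \<bar>partial_deriv i (moll s) x\<bar> \<partial>lborel) \<le> (\<Sum>i\<in>UNIV. I i) / profile_mass / s"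
      using s profile_mass_pos by (simp add: eq divide_right_mono)
  qed (use I profile_mass_pos in \<open>auto intro!: divide_nonneg_pos sum_nonneg\<close>)
qed

text \<open>A smooth, compactly supported substitute for the Newtonian kernel that is accurate between the scales
\<open>a\<close> and \<open>b\<close>: convolution with it inverts \<open>- \<Delta>\<close> up to mollification at scale \<open>a\<close> and an error at scale \<open>b\<close>.\<close>

definition newton :: "real \<Rightarrow> real \<Rightarrow> real^3 \<Rightarrow> real"
  where "newton a b = scale_int a b 2 (\<lambda>x. (1 / profile_mass) * bump x)"

lemma newton_smooth: "0 < a \<Longrightarrow> smooth_fun (newton a b)"
  unfolding newton_def
  by (rule scale_int_smooth[OF smooth_fun_cmult[OF bump_smooth] supp_in_mult(2)[OF bump_supp_in]])

lemma newton_supp_in: "0 < a \<Longrightarrow> supp_in b (newton a b)"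
  unfolding newton_def by (rule scale_int_supp_in[OF supp_in_mult(2)[OF bump_supp_in]])

text \<open>Since the gradient of the bump is \<open>- x profile(x)\<close>, its Laplacian is minus the divergence of \<open>x profile(x)\<close>,
and that divergence is what the derivative of the rescaled profile in the scale produces in dimension 3.\<close>

lemma moll_scale_derivative:
  fixes x :: "real^3"
  assumes s: "s > 0"
  shows "((\<lambda>s. moll s x) has_real_derivative
    ((\<Sum>i\<in>UNIV. partial_deriv i (partial_deriv i bump) (x /\<^sub>R s)) / profile_mass / s ^ 4)) (at s)"
proof -
  let ?q = "x \<bullet> x"
  have q: "(x /\<^sub>R s) \<bullet> (x /\<^sub>R s) = ?q / s\<^sup>2" for s by (simp add: power2_eq_square field_simps)
  have 1: "((\<lambda>s. 1 - ?q / s\<^sup>2) has_real_derivative (2 * ?q / s ^ 3)) (at s)"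
    using s by (auto intro!: derivative_eq_intros simp: field_simps eval_nat_numeral)
  have 2: "((\<lambda>s. flat 2 (1 - ?q / s\<^sup>2)) has_real_derivative
      (flat 4 (1 - ?q / s\<^sup>2) - 2 * flat 3 (1 - ?q / s\<^sup>2)) * (2 * ?q / s ^ 3)) (at s)"
    using DERIV_chain2[OF flat_has_derivative[of 2] 1] by (simp add: eval_nat_numeral)
  have "((\<lambda>s. 2 * flat 2 (1 - ?q / s\<^sup>2) / (profile_mass * s ^ 3)) has_real_derivative
     ((4 * (?q / s\<^sup>2) * (flat 4 (1 - ?q / s\<^sup>2) - 2 * flat 3 (1 - ?q / s\<^sup>2)) - 6 * flat 2 (1 - ?q / s\<^sup>2))
       / profile_mass / s ^ 4)) (at s)"
    using s profile_mass_pos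
    by (auto intro!: derivative_eq_intros 2) (simp add: field_simps eval_nat_numeral)
  then show ?thesis
    unfolding laplacian_bump q moll_def profile_def by simp
qed

text \<open>The Laplacian of the superposition integrates the scale derivative of the mollifiers, so the fundamental
theorem of calculus leaves only the two end scales.\<close>

lemma laplacian_newton:
  assumes a: "0 < a" "a \<le> b"
  shows "(\<Sum>i\<in>UNIV. partial_deriv i (partial_deriv i (newton a b)) x) = moll b x - moll a x"
proof -
  let ?F = "\<lambda>x. (1 / profile_mass) * bump (x :: real^3)"
  have F: "smooth_fun ?F" "supp_in 1 ?F"
    by (rule smooth_fun_cmult[OF bump_smooth], rule supp_in_mult(2)[OF bump_supp_in])
  have F': "smooth_fun (partial_deriv i ?F)" "supp_in 1 (partial_deriv i ?F)" for i
    by (rule smooth_fun_partial_deriv[OF F(1)], rule supp_in_partial_deriv[OF F(2,1)])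
  have dd: "partial_deriv i (partial_deriv i (newton a b)) = scale_int a b 4 (partial_deriv i (partial_deriv i ?F))" for i
    unfolding newton_def scale_int_deriv(2)[OF F a(1)] scale_int_deriv(2)[OF F' a(1)]
    by (simp add: eval_nat_numeral)
  have Fdd: "partial_deriv i (partial_deriv i ?F) = (\<lambda>x. (1 / profile_mass) * partial_deriv i (partial_deriv i bump) x)" for i
    by (simp only: partial_deriv_smooth_cmult[OF bump_smooth]
        partial_deriv_smooth_cmult[OF smooth_fun_partial_deriv[OF bump_smooth]])
  have F'': "smooth_fun (partial_deriv i (partial_deriv i ?F))" "supp_in 1 (partial_deriv i (partial_deriv i ?F))" for i
    by (rule smooth_fun_partial_deriv[OF F'(1)], rule supp_in_partial_deriv[OF F'(2,1)])
  let ?L = "\<lambda>s. (\<Sum>i\<in>UNIV. partial_deriv i (partial_deriv i bump) (x /\<^sub>R s)) / profile_mass / s ^ 4"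
  have cont: "isCont (\<lambda>s. G (x /\<^sub>R s) / s ^ k) s" if "smooth_fun G" "s > 0" for G :: "real^3 \<Rightarrow> real" and s k
  proof -
    have "isCont (\<lambda>s. x /\<^sub>R s) s" using that(2) by (intro continuous_intros) auto
    then have "isCont (\<lambda>s. G (x /\<^sub>R s)) s"
      by (rule isCont_o2[OF _ smooth_fun_isCont[OF that(1)]])
    then show ?thesis using that(2) by (intro continuous_intros) auto
  qed
  have int: "integrable lborel (\<lambda>s. indicator {a..b} s * (G (x /\<^sub>R s) / s ^ k))" if "smooth_fun G"
    for G :: "real^3 \<Rightarrow> real" and k
  proof -
    have "set_integrable lborel {a..b} (\<lambda>s. G (x /\<^sub>R s) / s ^ k)"
      by (rule borel_integrable_atLeastAtMost') 
        (use cont[OF that] a in \<open>auto intro!: continuous_at_imp_continuous_on\<close>)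
    then show ?thesis by (simp add: set_integrable_def)
  qed
  have "(\<Sum>i\<in>UNIV. partial_deriv i (partial_deriv i (newton a b)) x)
      = (\<Sum>i\<in>UNIV. \<integral>s. indicator {a..b} s * (partial_deriv i (partial_deriv i ?F) (x /\<^sub>R s) / s ^ 4) \<partial>lborel)"
    unfolding dd scale_int_def ..
  also have "\<dots> = (\<integral>s. (\<Sum>i\<in>UNIV. indicator {a..b} s * (partial_deriv i (partial_deriv i ?F) (x /\<^sub>R s) / s ^ 4)) \<partial>lborel)"
    by (rule Bochner_Integration.integral_sum[symmetric]) (rule int[OF F''(1)])
  also have "\<dots> = (\<integral>s. ?L s * indicator {a..b} s \<partial>lborel)"
    unfolding Fdd
    by (intro Bochner_Integration.integral_cong refl)
      (simp add: sum_divide_distrib sum_distrib_left sum_distrib_right field_simps)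
  also have "\<dots> = moll b x - moll a x"
  proof (rule integral_FTC_Icc_real[OF a(2)])
    fix s assume s: "a \<le> s" "s \<le> b"
    show "((\<lambda>s. moll s x) has_real_derivative ?L s) (at s)"
      using s a by (intro moll_scale_derivative) simp
    have "isCont (\<lambda>s. \<Sum>i\<in>UNIV. partial_deriv i (partial_deriv i bump) (x /\<^sub>R s) / s ^ 4) s"
      using s a by (intro continuous_sum cont smooth_fun_partial_deriv bump_smooth) auto
    then have "isCont (\<lambda>s. (\<Sum>i\<in>UNIV. partial_deriv i (partial_deriv i bump) (x /\<^sub>R s) / s ^ 4) / profile_mass) s"
      using profile_mass_pos by (intro isCont_divide) auto
    moreover have "?L = (\<lambda>s. (\<Sum>i\<in>UNIV. partial_deriv i (partial_deriv i bump) (x /\<^sub>R s) / s ^ 4) / profile_mass)"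
      by (simp only: fun_eq_iff sum_divide_distrib divide_divide_eq_left mult.commute[of profile_mass]) blast
    ultimately show "isCont ?L s" by (simp only:)
  qed
  finally show ?thesis .
qed

section \<open>Square integrals over balls and second derivatives\<close>

lemma ball_sq_cong: "(\<And>x. norm x \<le> r \<Longrightarrow> f x = g x) \<Longrightarrow> ball_sq r f = ball_sq r g"
  unfolding ball_sq_def
  by (intro Bochner_Integration.integral_cong refl) (auto simp: indicator_def)

lemma ball_sq_le_integral:
  assumes "integrable lborel (\<lambda>x. (f x)\<^sup>2)"
  shows "ball_sq r f \<le> (\<integral>x. (f x)\<^sup>2 \<partial>lborel)"
  unfolding ball_sq_def by (rule integral_mono'[OF assms]) (auto simp: indicator_def)

lemma ball_sq_mono_radius:
  assumes "Lloc 2 f" "r \<le> s"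
  shows "ball_sq r f \<le> ball_sq s f"
  unfolding ball_sq_def
  by (rule integral_mono'[OF Lloc2_integrable[OF assms(1)]]) (use assms(2) in \<open>auto simp: indicator_def\<close>)

lemma ball_sq_mono:
  assumes "Lloc 2 g" "\<And>x. norm x \<le> r \<Longrightarrow> \<bar>f x\<bar> \<le> \<bar>g x\<bar>"
  shows "ball_sq r f \<le> ball_sq r g"
  unfolding ball_sq_def
proof (rule integral_mono'[OF Lloc2_integrable[OF assms(1)]])
  fix x
  show "indicator (cball 0 r) x * (f x)\<^sup>2 \<le> indicator (cball 0 r) x * (g x)\<^sup>2"
    using assms(2)[of x] by (auto simp: indicator_def abs_le_square_iff)
qed simp

lemma ball_sq_cmult: "ball_sq r (\<lambda>x. c * f x) = c\<^sup>2 * ball_sq r f"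
  unfolding ball_sq_def by (simp add: power_mult_distrib mult.left_commute[of _ "c\<^sup>2"])

lemma ball_sq_bounded_mult:
  assumes "Lloc 2 f" "\<And>x. \<bar>g x\<bar> \<le> c"
  shows "ball_sq r (\<lambda>x. g x * f x) \<le> c\<^sup>2 * ball_sq r f"
proof -
  have "\<bar>g x * f x\<bar> \<le> \<bar>c * f x\<bar>" for x
    using mult_right_mono[OF assms(2)[of x], of "\<bar>f x\<bar>"] assms(2)[of x] by (simp add: abs_mult)
  then show ?thesis using ball_sq_mono[of "\<lambda>x. c * f x" r "\<lambda>x. g x * f x"] assms(1)
    by (simp add: ball_sq_cmult Lloc_cmult)
qed

lemma ball_sq_add:
  assumes "Lloc 2 f" "Lloc 2 g"
  shows "ball_sq r (\<lambda>x. f x + g x) \<le> 2 * ball_sq r f + 2 * ball_sq r g"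
proof -
  note int = Lloc2_integrable[OF assms(1), of r] Lloc2_integrable[OF assms(2), of r]
  have "ball_sq r (\<lambda>x. f x + g x) \<le>
      (\<integral>x. 2 * (indicator (cball 0 r) x * (f x)\<^sup>2) + 2 * (indicator (cball 0 r) x * (g x)\<^sup>2) \<partial>lborel)"
    unfolding ball_sq_def
  proof (rule integral_mono')
    fix x
    have "(f x + g x)\<^sup>2 \<le> 2 * (f x)\<^sup>2 + 2 * (g x)\<^sup>2"
      using sum_squares_bound[of "f x" "g x"] by (simp add: power2_sum)
    then show "indicator (cball 0 r) x * (f x + g x)\<^sup>2 \<le>
      2 * (indicator (cball 0 r) x * (f x)\<^sup>2) + 2 * (indicator (cball 0 r) x * (g x)\<^sup>2)"
      by (simp add: indicator_def)
  qed (use int in auto)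
  also have "\<dots> = 2 * ball_sq r f + 2 * ball_sq r g"
    using int by (simp add: ball_sq_def)
  finally show ?thesis .
qed

lemma ball_sq_diff:
  assumes "Lloc 2 f" "Lloc 2 g"
  shows "ball_sq r (\<lambda>x. f x - g x) \<le> 2 * ball_sq r f + 2 * ball_sq r g"
  using ball_sq_add[OF assms(1) Lloc_cmult[OF assms(2), of "-1"], of r] ball_sq_cmult[of r "-1" g]
  by simp

text \<open>The factor is not sharp: it comes from applying \<open>ball_sq_add\<close> twice.\<close>

lemma ball_sq_sum3:
  fixes f :: "3 \<Rightarrow> 'a::euclidean_space \<Rightarrow> real"
  assumes "\<And>j. Lloc 2 (f j)" "\<And>j. ball_sq r (f j) \<le> c"
  shows "ball_sq r (\<lambda>x. \<Sum>j\<in>UNIV. f j x) \<le> 10 * c"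
proof -
  have "ball_sq r (\<lambda>x. f 1 x + f 2 x + f 3 x) \<le> 2 * ball_sq r (\<lambda>x. f 1 x + f 2 x) + 2 * ball_sq r (f 3)"
    by (intro ball_sq_add Lloc_add assms)
  also have "\<dots> \<le> 2 * (2 * ball_sq r (f 1) + 2 * ball_sq r (f 2)) + 2 * ball_sq r (f 3)"
    using ball_sq_add[OF assms(1)[of 1] assms(1)[of 2], of r] by simp
  also have "\<dots> \<le> 10 * c"
    using assms(2)[of 1] assms(2)[of 2] assms(2)[of 3] by simp
  finally show ?thesis by (simp add: sum_3)
qed

lemma ball_Cauchy_Schwarz:
  assumes f: "Lloc 2 f" and g: "Lloc 2 g" "supp_in r g"
  shows "integrable lborel (\<lambda>x. f x * g x)"
    and "\<bar>\<integral>x. f x * g x \<partial>lborel\<bar> \<le> sqrt (ball_sq r f) * sqrt (ball_sq r g)"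
proof -
  note [measurable] = Lloc_measurable[OF f] Lloc_measurable[OF g(1)]
  let ?i = "indicat_real (cball 0 r)"
  have eq: "(\<lambda>x. f x * g x) = (\<lambda>x. (?i x * f x) * (?i x * g x))"
    using supp_inD[OF g(2)] by (auto simp: indicator_def fun_eq_iff)
  have i: "integrable lborel (\<lambda>x. (?i x * f x)\<^sup>2)" "integrable lborel (\<lambda>x. (?i x * g x)\<^sup>2)"
    unfolding indicator_sq using f g by (auto intro: Lloc2_integrable)
  show "integrable lborel (\<lambda>x. f x * g x)"
    unfolding eq by (rule integral_Cauchy_Schwarz(1)[OF _ _ i]) measurable
  show "\<bar>\<integral>x. f x * g x \<partial>lborel\<bar> \<le> sqrt (ball_sq r f) * sqrt (ball_sq r g)"
    unfolding eq ball_sq_def indicator_sq[symmetric]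
    by (rule integral_Cauchy_Schwarz(2)[OF _ _ i]) measurable
qed

lemma hessian_integral:
  fixes b :: "real^'n::finite \<Rightarrow> real"
  assumes b: "smooth_fun b" "supp_in r b"
  shows "(\<integral>x. (partial_deriv i (partial_deriv j b) x)\<^sup>2 \<partial>lborel) =
    (\<integral>x. partial_deriv i (partial_deriv i b) x * partial_deriv j (partial_deriv j b) x \<partial>lborel)"
proof -
  note s = smooth_fun_partial_deriv[OF b(1)] smooth_fun_partial_deriv[OF smooth_fun_partial_deriv[OF b(1)]]
  have sp: "supp_in r (partial_deriv i (partial_deriv j b))" for i j
    by (intro supp_in_partial_deriv s b)
  have "(\<integral>x. (partial_deriv i (partial_deriv j b) x)\<^sup>2 \<partial>lborel) =
      - (\<integral>x. partial_deriv i (partial_deriv i (partial_deriv j b)) x * partial_deriv j b x \<partial>lborel)"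
    unfolding power2_eq_square by (rule integration_by_parts[OF s(2) sp s(1)])
  also have "partial_deriv i (partial_deriv i (partial_deriv j b)) = partial_deriv j (partial_deriv i (partial_deriv i b))"
    by (simp only: partial_deriv_commute[OF b(1), of i j] partial_deriv_commute[OF s(1), of i j i])
  also have "- (\<integral>x. partial_deriv j (partial_deriv i (partial_deriv i b)) x * partial_deriv j b x \<partial>lborel)
      = (\<integral>x. partial_deriv i (partial_deriv i b) x * partial_deriv j (partial_deriv j b) x \<partial>lborel)"
    by (rule integration_by_parts[OF s(2) sp s(1), symmetric])
  finally show ?thesis .
qed

text \<open>Integrating by parts twice moves \<open>\<integral> (\<partial>\<^sub>i \<partial>\<^sub>j b)\<^sup>2\<close> into \<open>\<integral> \<partial>\<^sub>i \<partial>\<^sub>i b \<partial>\<^sub>j \<partial>\<^sub>j b\<close>, and the sum of the latter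
over all \<open>i\<close> and \<open>j\<close> is the integral of the squared Laplacian.\<close>

lemma hessian_L2:
  fixes b :: "real^'n::finite \<Rightarrow> real"
  assumes b: "smooth_fun b" "supp_in r b"
  shows "(\<integral>x. (partial_deriv k (partial_deriv l b) x)\<^sup>2 \<partial>lborel) \<le>
    (\<integral>x. (\<Sum>i\<in>UNIV. partial_deriv i (partial_deriv i b) x)\<^sup>2 \<partial>lborel)"
proof -
  note s = smooth_fun_partial_deriv[OF b(1)] smooth_fun_partial_deriv[OF smooth_fun_partial_deriv[OF b(1)]]
  have sp: "supp_in r (partial_deriv i (partial_deriv j b))" for i j
    by (intro supp_in_partial_deriv s b)
  let ?H = "\<lambda>i j. \<integral>x. (partial_deriv i (partial_deriv j b) x)\<^sup>2 \<partial>lborel"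
  have H: "?H i j \<ge> 0" for i j by simp
  have int: "integrable lborel (\<lambda>x. partial_deriv i (partial_deriv i b) x * partial_deriv j (partial_deriv j b) x)" for i j
    by (rule integrable_continuous_supp[OF smooth_fun_continuous[OF smooth_fun_mult[OF s(2) s(2)]]
          supp_in_mult(1)[OF sp]])
  have "?H k l \<le> (\<Sum>j\<in>UNIV. ?H k j)" by (rule member_le_sum) auto
  also have "\<dots> \<le> (\<Sum>i\<in>UNIV. \<Sum>j\<in>UNIV. ?H i j)"
    by (rule member_le_sum[of k UNIV "\<lambda>i. \<Sum>j\<in>UNIV. ?H i j"]) (auto intro: sum_nonneg)
  also have "\<dots> = (\<Sum>i\<in>UNIV. \<Sum>j\<in>UNIV. \<integral>x. partial_deriv i (partial_deriv i b) x * partial_deriv j (partial_deriv j b) x \<partial>lborel)"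
    by (simp only: hessian_integral[OF b])
  also have "\<dots> = (\<integral>x. (\<Sum>i\<in>UNIV. \<Sum>j\<in>UNIV. partial_deriv i (partial_deriv i b) x * partial_deriv j (partial_deriv j b) x) \<partial>lborel)"
    using int by (simp add: Bochner_Integration.integral_sum)
  also have "\<dots> = (\<integral>x. (\<Sum>i\<in>UNIV. partial_deriv i (partial_deriv i b) x)\<^sup>2 \<partial>lborel)"
    by (simp add: power2_eq_square sum_product)
  finally show ?thesis .
qed

lemma integrable_square_smooth:
  "smooth_fun f \<Longrightarrow> supp_in r f \<Longrightarrow> integrable lborel (\<lambda>x. (f x)\<^sup>2)"
  unfolding power2_eq_square
  by (rule integrable_continuous_supp[OF smooth_fun_continuous[OF smooth_fun_mult] supp_in_mult(1)])

text \<open>Integrate \<open>\<partial>\<^sub>i (x\<^sub>i h\<^sup>2)\<close> and absorb half of \<open>\<integral> h\<^sup>2\<close> with Young's inequality.\<close>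

lemma Poincare_L2:
  fixes h :: "real^'n::finite \<Rightarrow> real"
  assumes h: "smooth_fun h" "supp_in r h"
  shows "(\<integral>x. (h x)\<^sup>2 \<partial>lborel) \<le> 4 * r\<^sup>2 * (\<integral>x. (partial_deriv i h x)\<^sup>2 \<partial>lborel)"
proof -
  have hh: "smooth_fun (\<lambda>x. h x * h x)" "supp_in r (\<lambda>x. h x * h x)"
    by (rule smooth_fun_mult[OF h(1) h(1)], rule supp_in_mult(1)[OF h(2)])
  have dh: "smooth_fun (partial_deriv i h)" "supp_in r (partial_deriv i h)"
    by (rule smooth_fun_partial_deriv[OF h(1)], rule supp_in_partial_deriv[OF h(2,1)])
  note i1 = integrable_square_smooth[OF h] and i2 = integrable_square_smooth[OF dh]
  let ?g = "\<lambda>x. partial_deriv i (\<lambda>x. h x * h x) x * x $ i"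
  have sg: "smooth_fun ?g" "supp_in r ?g"
    by (rule smooth_fun_mult[OF smooth_fun_partial_deriv[OF hh(1)] smooth_fun_component],
        rule supp_in_mult(1)[OF supp_in_partial_deriv[OF hh(2,1)]])
  have i3: "integrable lborel (\<lambda>x. - ?g x)"
    using integrable_continuous_supp[OF smooth_fun_continuous[OF sg(1)] sg(2)] by simp
  have "(\<integral>x. (h x)\<^sup>2 \<partial>lborel) = - (\<integral>x. ?g x \<partial>lborel)"
    using integration_by_parts[OF hh smooth_fun_component[of i], of i]
    by (simp add: partial_deriv_component power2_eq_square)
  also have "\<dots> = (\<integral>x. - ?g x \<partial>lborel)" by simp
  also have "\<dots> \<le> (\<integral>x. 1 / 2 * (h x)\<^sup>2 + 2 * r\<^sup>2 * (partial_deriv i h x)\<^sup>2 \<partial>lborel)"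
  proof (rule integral_mono[OF i3])
    show "integrable lborel (\<lambda>x. 1 / 2 * (h x)\<^sup>2 + 2 * r\<^sup>2 * (partial_deriv i h x)\<^sup>2)"
      using i1 i2 by auto
    fix x :: "real^'n"
    let ?d = "partial_deriv i h x"
    have g: "- ?g x = - 2 * (x $ i * ?d) * h x"
      by (simp add: partial_deriv_smooth_mult[OF h(1) h(1)] algebra_simps)
    have y: "- 2 * a * b \<le> 2 * a\<^sup>2 + 1 / 2 * b\<^sup>2" for a b :: real
      using zero_le_power2[of "2 * a + b"] by (simp add: power2_eq_square algebra_simps)
    have le: "(x $ i * ?d)\<^sup>2 \<le> r\<^sup>2 * ?d\<^sup>2"
    proof (cases "norm x \<le> r")
      case True
      then have "\<bar>x $ i\<bar> \<le> r" using component_le_norm_cart[of x i] by simp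
      then have "(x $ i)\<^sup>2 \<le> r\<^sup>2" using abs_le_square_iff[of "x $ i" r] by simp
      then show ?thesis by (simp add: power_mult_distrib mult_right_mono)
    next
      case False
      then show ?thesis using supp_inD[OF dh(2), of x] by simp
    qed
    show "- ?g x \<le> 1 / 2 * (h x)\<^sup>2 + 2 * r\<^sup>2 * ?d\<^sup>2"
      unfolding g using y[of "x $ i * ?d" "h x"] le by linarith
  qed
  also have "\<dots> = 1 / 2 * (\<integral>x. (h x)\<^sup>2 \<partial>lborel) + 2 * r\<^sup>2 * (\<integral>x. (partial_deriv i h x)\<^sup>2 \<partial>lborel)"
    using i1 i2 by simp
  finally show ?thesis by simp
qed

lemma conv_diff_left:
  assumes "continuous_on UNIV J" "supp_in r J" "continuous_on UNIV K" "supp_in s K" "Lloc 1 f"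
  shows "conv (\<lambda>x. J x - K x) f x = conv J f x - conv K f x"
  using conv_integrable[OF assms(1,2,5), of x] conv_integrable[OF assms(3,4,5), of x]
  by (simp add: conv_def left_diff_distrib)

lemma conv_sum_left:
  assumes "\<And>i. i \<in> S \<Longrightarrow> continuous_on UNIV (J i)" "\<And>i. i \<in> S \<Longrightarrow> supp_in r (J i)" "Lloc 1 f"
  shows "conv (\<lambda>x. \<Sum>i\<in>S. J i x) f x = (\<Sum>i\<in>S. conv (J i) f x)"
  unfolding conv_def
  using conv_integrable[OF assms(1,2,3)]
  by (simp add: sum_distrib_right Bochner_Integration.integral_sum)

lemma conv_partial_deriv2:
  fixes J :: "real^'n::finite \<Rightarrow> real"
  assumes J: "smooth_fun J" "supp_in r J" and f: "Lloc 1 f"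
  shows "partial_deriv i (partial_deriv j (conv J f)) = conv (partial_deriv i (partial_deriv j J)) f"
  unfolding conv_partial_deriv(2)[OF J f]
  by (rule conv_partial_deriv(2)[OF smooth_fun_partial_deriv[OF J(1)] supp_in_partial_deriv[OF J(2,1)] f])

lemma laplacian_conv_newton:
  assumes a: "0 < a" "a \<le> b" and f: "Lloc 1 f"
  shows "(\<Sum>i\<in>UNIV. partial_deriv i (partial_deriv i (conv (newton a b) f)) x) =
    conv (moll b) f x - conv (moll a) f x"
proof -
  note N = newton_smooth[OF a(1), of b] newton_supp_in[OF a(1), of b]
  have "(\<Sum>i\<in>UNIV. partial_deriv i (partial_deriv i (conv (newton a b) f)) x) =
      conv (\<lambda>x. \<Sum>i\<in>UNIV. partial_deriv i (partial_deriv i (newton a b)) x) f x"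
    unfolding conv_partial_deriv2[OF N f]
    by (intro conv_sum_left[symmetric, of _ _ b] smooth_fun_continuous smooth_fun_partial_deriv
        supp_in_partial_deriv N f)
  also have "(\<lambda>x. \<Sum>i\<in>UNIV. partial_deriv i (partial_deriv i (newton a b)) x) = (\<lambda>x. moll b x - moll a x)"
    by (simp add: laplacian_newton[OF a])
  also have "conv \<dots> f x = conv (moll b) f x - conv (moll a) f x"
    using a by (intro conv_diff_left[of _ b _ a] smooth_fun_continuous moll_smooth moll_supp_in f) auto
  finally show ?thesis .
qed

lemma moll_diff_L1:
  assumes "0 < a" "0 < b"
  shows "(\<integral>x. \<bar>moll b x - moll a x\<bar> \<partial>lborel) \<le> 2"
proof -
  note Ka = prob_kernelD[OF moll_prob_kernel[OF assms(1)]] and Kb = prob_kernelD[OF moll_prob_kernel[OF assms(2)]]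
  have i: "integrable lborel (moll a)" "integrable lborel (moll b)"
    by (rule integrable_continuous_supp[OF Ka(1,4)], rule integrable_continuous_supp[OF Kb(1,4)])
  have "(\<integral>x. \<bar>moll b x - moll a x\<bar> \<partial>lborel) \<le> (\<integral>x. moll b x + moll a x \<partial>lborel)"
    by (rule integral_mono) (use i Ka(2) Kb(2) in \<open>auto simp: abs_le_iff add_increasing add_increasing2\<close>)
  also have "\<dots> = 2" using i Ka(3) Kb(3) by simp
  finally show ?thesis .
qed

text \<open>On the ball of radius \<open>R\<close> the potential only depends on \<open>f\<close> in the ball of radius \<open>2 R\<close>. After cutting \<open>f\<close> off
there, the potential has compact support, so \<open>hessian_L2\<close> and \<open>Poincare_L2\<close> apply, and its Laplacian is a
difference of two mollifications.\<close>

lemma newton_conv_bounds: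
  assumes a: "0 < a" "a \<le> R" and f: "Lloc 2 f"
  shows "ball_sq R (partial_deriv k (partial_deriv j (conv (newton a R) f))) \<le> 4 * ball_sq (2 * R) f"
    and "ball_sq R (partial_deriv j (conv (newton a R) f)) \<le> 144 * R\<^sup>2 * ball_sq (2 * R) f"
proof -
  note [measurable] = Lloc_measurable[OF f]
  let ?N = "newton a R"
  note N = newton_smooth[OF a(1), of R] newton_supp_in[OF a(1), of R]
  note N1 = smooth_fun_partial_deriv[OF N(1)] supp_in_partial_deriv[OF N(2,1)]
  note N2 = smooth_fun_partial_deriv[OF N1(1)] supp_in_partial_deriv[OF N1(2,1)]
  have f1: "Lloc 1 f" by (rule Lloc_mono[OF f]) simp
  define g where "g y = indicator (cball 0 (R + R)) y * f y" for y
  have g_borel[measurable]: "g \<in> borel_measurable borel" unfolding g_def by measurable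
  have g2: "(\<lambda>y. (g y)\<^sup>2) = (\<lambda>x. indicator (cball 0 (R + R)) x * (f x)\<^sup>2)"
    by (simp add: g_def indicator_sq)
  have gi: "integrable lborel (\<lambda>y. (g y)\<^sup>2)" unfolding g2 by (rule Lloc2_integrable[OF f])
  have gL: "Lloc 2 g" by (rule Lloc_global) (use gi in auto)
  then have g1: "Lloc 1 g" by (rule Lloc_mono) simp
  have gs: "supp_in (2 * R) g" by (simp add: g_def supp_in_def)
  let ?b = "conv ?N g"
  have b: "smooth_fun ?b" "supp_in (3 * R) ?b"
    using conv_smooth[OF N g1] conv_supp_in[OF N(2) gs] by simp_all
  have "(\<integral>x. (\<Sum>i\<in>UNIV. partial_deriv i (partial_deriv i ?b) x)\<^sup>2 \<partial>lborel)
      = (\<integral>x. (conv (\<lambda>x. moll R x - moll a x) g x)\<^sup>2 \<partial>lborel)"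
    unfolding laplacian_conv_newton[OF a g1]
    using a by (simp only: conv_diff_left[OF smooth_fun_continuous[OF moll_smooth] moll_supp_in[of R]
          smooth_fun_continuous[OF moll_smooth] moll_supp_in[OF a(1)] g1])
  also have "\<dots> \<le> (\<integral>x. \<bar>moll R x - moll a x\<bar> \<partial>lborel)\<^sup>2 * (\<integral>x. (g x)\<^sup>2 \<partial>lborel)"
    using a supp_in_mono[OF moll_supp_in[OF a(1)] a(2)] moll_supp_in[of R]
    by (intro Young_L2(2)[of _ R] g_borel gi smooth_fun_continuous smooth_fun_diff moll_smooth)
      (auto simp: supp_in_def)
  also have "\<dots> \<le> 2\<^sup>2 * (\<integral>x. (g x)\<^sup>2 \<partial>lborel)"
    using a by (intro mult_right_mono power_mono moll_diff_L1 Bochner_Integration.integral_nonneg) auto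
  also have "(\<integral>x. (g x)\<^sup>2 \<partial>lborel) = ball_sq (2 * R) f"
    unfolding g2 ball_sq_def by simp
  finally have lap: "(\<integral>x. (\<Sum>i\<in>UNIV. partial_deriv i (partial_deriv i ?b) x)\<^sup>2 \<partial>lborel) \<le> 4 * ball_sq (2 * R) f"
    by simp
  have H: "(\<integral>x. (partial_deriv k (partial_deriv l ?b) x)\<^sup>2 \<partial>lborel) \<le> 4 * ball_sq (2 * R) f" for k l
    by (rule order_trans[OF hessian_L2[OF b] lap])
  have db: "smooth_fun (partial_deriv l ?b)" "supp_in (3 * R) (partial_deriv l ?b)" for l
    by (rule smooth_fun_partial_deriv[OF b(1)], rule supp_in_partial_deriv[OF b(2,1)])
  have ddb: "smooth_fun (partial_deriv k (partial_deriv l ?b))" "supp_in (3 * R) (partial_deriv k (partial_deriv l ?b))" for k l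
    by (rule smooth_fun_partial_deriv[OF db(1)], rule supp_in_partial_deriv[OF db(2,1)])
  have "ball_sq R (partial_deriv k (partial_deriv j (conv ?N f))) = ball_sq R (partial_deriv k (partial_deriv j ?b))"
  proof (rule ball_sq_cong)
    fix x :: "real^3" assume x: "norm x \<le> R"
    show "partial_deriv k (partial_deriv j (conv ?N f)) x = partial_deriv k (partial_deriv j ?b) x"
      unfolding conv_partial_deriv2[OF N f1] conv_partial_deriv2[OF N g1] g_def
      by (rule conv_truncate[OF N2(2) x])
  qed
  also have "\<dots> \<le> 4 * ball_sq (2 * R) f"
    by (rule order_trans[OF ball_sq_le_integral[OF integrable_square_smooth[OF ddb]] H])
  finally show "ball_sq R (partial_deriv k (partial_deriv j (conv ?N f))) \<le> 4 * ball_sq (2 * R) f" .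
  have "ball_sq R (partial_deriv j (conv ?N f)) = ball_sq R (partial_deriv j ?b)"
  proof (rule ball_sq_cong)
    fix x :: "real^3" assume x: "norm x \<le> R"
    show "partial_deriv j (conv ?N f) x = partial_deriv j ?b x"
      unfolding conv_partial_deriv(2)[OF N f1] conv_partial_deriv(2)[OF N g1] g_def
      by (rule conv_truncate[OF N1(2) x])
  qed
  also have "\<dots> \<le> (\<integral>x. (partial_deriv j ?b x)\<^sup>2 \<partial>lborel)"
    by (rule ball_sq_le_integral[OF integrable_square_smooth[OF db]])
  also have "\<dots> \<le> 4 * (3 * R)\<^sup>2 * (\<integral>x. (partial_deriv j (partial_deriv j ?b) x)\<^sup>2 \<partial>lborel)"
    by (rule Poincare_L2[OF db])
  also have "\<dots> \<le> 4 * (3 * R)\<^sup>2 * (4 * ball_sq (2 * R) f)"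
    by (intro mult_left_mono H) auto
  finally show "ball_sq R (partial_deriv j (conv ?N f)) \<le> 144 * R\<^sup>2 * ball_sq (2 * R) f"
    by (simp add: power_mult_distrib)
qed

section \<open>Weak stationary flows and their mollifications\<close>

definition moll_seq :: "nat \<Rightarrow> real^3 \<Rightarrow> real"
  where "moll_seq n = moll (inverse (real (Suc n)))"

lemma moll_seq_kernel: "prob_kernel (inverse (real (Suc n))) (moll_seq n)"
  unfolding moll_seq_def by (rule moll_prob_kernel) simp

lemma moll_seq_smooth: "smooth_fun (moll_seq n)"
  unfolding moll_seq_def by (rule moll_smooth)

lemma moll_seq_conv_smooth: "Lloc 1 f \<Longrightarrow> smooth_fun (conv (moll_seq n) f)"
  by (rule conv_smooth[OF moll_seq_smooth prob_kernelD(4)[OF moll_seq_kernel]])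

lemma moll_seq_tendsto:
  assumes "Lloc (2 ^ k) f"
  shows "(\<lambda>n. \<integral>x. indicator (cball 0 r) x * \<bar>conv (moll_seq n) f x - f x\<bar> ^ (2 ^ k) \<partial>lborel) \<longlonglongrightarrow> 0"
  by (rule mollifier_Lp_tendsto[OF moll_seq_kernel LIMSEQ_inverse_real_of_nat assms])

lemma moll_seq_ball_sq_tendsto:
  assumes "Lloc 2 f"
  shows "(\<lambda>n. ball_sq r (\<lambda>x. conv (moll_seq n) f x - f x)) \<longlonglongrightarrow> 0"
  using moll_seq_tendsto[of 1 f r] assms by (simp add: ball_sq_def)

lemma moll_seq_integral_tendsto:
  assumes a: "Lloc 2 a" "supp_in r a" and f: "Lloc 2 f"
  shows "(\<lambda>n. \<integral>x. a x * conv (moll_seq n) f x \<partial>lborel) \<longlonglongrightarrow> (\<integral>x. a x * f x \<partial>lborel)"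
proof -
  have f1: "Lloc 1 f" by (rule Lloc_mono[OF f]) simp
  let ?c = "\<lambda>n. conv (moll_seq n) f"
  have c: "Lloc 2 (?c n)" for n by (rule Lloc_smooth[OF moll_seq_conv_smooth[OF f1]])
  have d: "Lloc 2 (\<lambda>x. ?c n x - f x)" for n by (rule Lloc_diff[OF c f])
  have eq: "(\<integral>x. (?c n x - f x) * a x \<partial>lborel) = (\<integral>x. a x * ?c n x \<partial>lborel) - (\<integral>x. a x * f x \<partial>lborel)" for n
    using ball_Cauchy_Schwarz(1)[OF c a, of n] ball_Cauchy_Schwarz(1)[OF f a]
    by (simp add: left_diff_distrib mult.commute[of "a _"])
  have "(\<lambda>n. \<integral>x. (?c n x - f x) * a x \<partial>lborel) \<longlonglongrightarrow> 0"
  proof (rule Lim_null_comparison)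
    show "\<forall>\<^sub>F n in sequentially. norm (\<integral>x. (?c n x - f x) * a x \<partial>lborel)
        \<le> sqrt (ball_sq r (\<lambda>x. ?c n x - f x)) * sqrt (ball_sq r a)"
      using ball_Cauchy_Schwarz(2)[OF d a] by (intro always_eventually allI) simp
    show "(\<lambda>n. sqrt (ball_sq r (\<lambda>x. ?c n x - f x)) * sqrt (ball_sq r a)) \<longlonglongrightarrow> 0"
      by (rule tendsto_eq_intros moll_seq_ball_sq_tendsto[OF f] refl)+ simp
  qed
  then show ?thesis unfolding eq by (rule LIM_zero_cancel)
qed

lemma ball_sq_mult_le:
  assumes b: "Lloc 4 b" and d: "Lloc 4 d"
  shows "ball_sq r (\<lambda>x. b x * d x) \<le> sqrt (ball_sq r (\<lambda>x. (b x)\<^sup>2)) * sqrt (ball_sq r (\<lambda>x. (d x)\<^sup>2))"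
proof -
  note [measurable] = Lloc_measurable[OF b] Lloc_measurable[OF d]
  have b2: "Lloc 2 (\<lambda>x. (b x)\<^sup>2)" and d2: "Lloc 2 (\<lambda>x. (d x)\<^sup>2)"
    using Lloc_mult[of 2 b b] Lloc_mult[of 2 d d] b d by (simp_all add: power2_eq_square)
  let ?g = "\<lambda>x. indicator (cball 0 r) x * (d x)\<^sup>2"
  have g: "Lloc 2 ?g" "supp_in r ?g"
    using Lloc_bounded_mult[OF d2, of "indicator (cball 0 r)" 1]
    by (auto simp: supp_in_def indicator_def)
  have "ball_sq r (\<lambda>x. b x * d x) = (\<integral>x. (b x)\<^sup>2 * ?g x \<partial>lborel)"
    unfolding ball_sq_def by (intro Bochner_Integration.integral_cong refl) (simp add: power_mult_distrib)
  also have "\<dots> \<le> \<bar>\<integral>x. (b x)\<^sup>2 * ?g x \<partial>lborel\<bar>" by simp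
  also have "\<dots> \<le> sqrt (ball_sq r (\<lambda>x. (b x)\<^sup>2)) * sqrt (ball_sq r ?g)"
    by (rule ball_Cauchy_Schwarz(2)[OF b2 g])
  also have "ball_sq r ?g = ball_sq r (\<lambda>x. (d x)\<^sup>2)"
    by (rule ball_sq_cong) simp
  finally show ?thesis .
qed

text \<open>The product of a square integrable function and two fourth power integrable ones: the convergence of the
mollification is needed in \<open>L\<^sup>4\<close> here.\<close>

lemma moll_seq_integral_tendsto4:
  assumes a: "Lloc 2 a" and b: "Lloc 4 b" "supp_in r b" and f: "Lloc 4 f"
  shows "(\<lambda>n. \<integral>x. a x * (b x * conv (moll_seq n) f x) \<partial>lborel) \<longlonglongrightarrow> (\<integral>x. a x * (b x * f x) \<partial>lborel)"
proof -
  have f1: "Lloc 1 f" by (rule Lloc_mono[OF f]) simp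
  let ?c = "\<lambda>n. conv (moll_seq n) f"
  have c: "Lloc 4 (?c n)" for n by (rule Lloc_smooth[OF moll_seq_conv_smooth[OF f1]])
  have m: "Lloc 2 (\<lambda>x. b x * g x)" "supp_in r (\<lambda>x. b x * g x)" if "Lloc 4 g" for g
    using Lloc_mult[of 2 b g] b that supp_in_mult(1)[OF b(2)] by simp_all
  have d: "Lloc 4 (\<lambda>x. ?c n x - f x)" for n by (rule Lloc_diff[OF c f])
  have eq: "(\<integral>x. a x * (b x * (?c n x - f x)) \<partial>lborel) =
      (\<integral>x. a x * (b x * ?c n x) \<partial>lborel) - (\<integral>x. a x * (b x * f x) \<partial>lborel)" for n
    using ball_Cauchy_Schwarz(1)[OF a m[OF c], of n] ball_Cauchy_Schwarz(1)[OF a m[OF f]]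
    by (simp add: right_diff_distrib)
  let ?B = "\<lambda>n. sqrt (ball_sq r a) * sqrt (sqrt (ball_sq r (\<lambda>x. (b x)\<^sup>2)) * sqrt (ball_sq r (\<lambda>x. (?c n x - f x)\<^sup>2)))"
  have "(\<lambda>n. \<integral>x. a x * (b x * (?c n x - f x)) \<partial>lborel) \<longlonglongrightarrow> 0"
  proof (rule Lim_null_comparison)
    show "\<forall>\<^sub>F n in sequentially. norm (\<integral>x. a x * (b x * (?c n x - f x)) \<partial>lborel) \<le> ?B n"
    proof (intro always_eventually allI)
      fix n
      have "\<bar>\<integral>x. a x * (b x * (?c n x - f x)) \<partial>lborel\<bar> \<le> sqrt (ball_sq r a) * sqrt (ball_sq r (\<lambda>x. b x * (?c n x - f x)))"
        by (rule ball_Cauchy_Schwarz(2)[OF a m[OF d]])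
      also have "\<dots> \<le> ?B n"
        by (intro mult_left_mono real_sqrt_le_mono ball_sq_mult_le b d) (simp add: ball_sq_nonneg)
      finally show "norm (\<integral>x. a x * (b x * (?c n x - f x)) \<partial>lborel) \<le> ?B n" by simp
    qed
    have "(\<lambda>n. ball_sq r (\<lambda>x. (?c n x - f x)\<^sup>2)) \<longlonglongrightarrow> 0"
      using moll_seq_tendsto[of 2 f r] f by (simp add: ball_sq_def flip: power_mult)
    then show "?B \<longlonglongrightarrow> 0"
      by (intro tendsto_eq_intros refl | simp)+
  qed
  then show ?thesis unfolding eq by (rule LIM_zero_cancel)
qed

lemma bump_derivative_bounds:
  obtains C where "C \<ge> 0" "\<And>i x. \<bar>partial_deriv i bump (x :: real^3)\<bar> \<le> C"
    "\<And>i j x. \<bar>partial_deriv i (partial_deriv j bump) (x :: real^3)\<bar> \<le> C"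
proof -
  have b: "\<exists>C\<ge>0. \<forall>x. \<bar>f x\<bar> \<le> C" if "smooth_fun f" "supp_in 1 f" for f :: "real^3 \<Rightarrow> real"
    by (rule continuous_supp_bounded[OF smooth_fun_continuous[OF that(1)] that(2)])
      (intro exI conjI allI)
  note s1 = smooth_fun_partial_deriv[OF bump_smooth] supp_in_partial_deriv[OF bump_supp_in bump_smooth]
  note s2 = smooth_fun_partial_deriv[OF s1(1)] supp_in_partial_deriv[OF s1(2,1)]
  have "\<forall>i. \<exists>C. C \<ge> 0 \<and> (\<forall>x. \<bar>partial_deriv i bump (x :: real^3)\<bar> \<le> C)"
    using b[OF s1] by blast
  from choice[OF this] obtain c1 :: "3 \<Rightarrow> real"
    where c1: "\<And>i. c1 i \<ge> 0" "\<And>i x. \<bar>partial_deriv i bump x\<bar> \<le> c1 i" by blast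
  have "\<forall>p. \<exists>C. C \<ge> 0 \<and> (\<forall>x. \<bar>partial_deriv (fst p) (partial_deriv (snd p) bump) (x :: real^3)\<bar> \<le> C)"
    using b[OF s2] by blast
  from choice[OF this] obtain c :: "3 \<times> 3 \<Rightarrow> real"
    where c: "\<And>p. c p \<ge> 0" "\<And>p x. \<bar>partial_deriv (fst p) (partial_deriv (snd p) bump) x\<bar> \<le> c p" by blast
  define c2 where "c2 i j = c (i, j)" for i j
  have c2: "\<And>i j. c2 i j \<ge> 0" "\<And>i j x. \<bar>partial_deriv i (partial_deriv j bump) x\<bar> \<le> c2 i j"
    using c(1) c(2)[of "(i, j)" x for i j x] by (auto simp: c2_def)
  show ?thesis
  proof (rule that[of "(\<Sum>i\<in>UNIV. c1 i) + (\<Sum>i\<in>UNIV. \<Sum>j\<in>UNIV. c2 i j)"])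
    have p1: "0 \<le> (\<Sum>i\<in>UNIV. c1 i)" and p2: "0 \<le> (\<Sum>i\<in>UNIV. \<Sum>j\<in>UNIV. c2 i j)"
      using c1 c2 by (auto intro!: sum_nonneg)
    then show "0 \<le> (\<Sum>i\<in>UNIV. c1 i) + (\<Sum>i\<in>UNIV. \<Sum>j\<in>UNIV. c2 i j)" by simp
    fix i j and x :: "real^3"
    have "c1 i \<le> (\<Sum>i\<in>UNIV. c1 i)" by (rule member_le_sum) (use c1 in auto)
    with c1(2)[of i x] p2
    show "\<bar>partial_deriv i bump x\<bar> \<le> (\<Sum>i\<in>UNIV. c1 i) + (\<Sum>i\<in>UNIV. \<Sum>j\<in>UNIV. c2 i j)" by linarith
    have "c2 i j \<le> (\<Sum>j\<in>UNIV. c2 i j)" by (rule member_le_sum) (use c2 in auto)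
    also have "\<dots> \<le> (\<Sum>i\<in>UNIV. \<Sum>j\<in>UNIV. c2 i j)"
      by (rule member_le_sum[of i UNIV "\<lambda>i. \<Sum>j\<in>UNIV. c2 i j"]) (use c2 in \<open>auto intro: sum_nonneg\<close>)
    finally show "\<bar>partial_deriv i (partial_deriv j bump) x\<bar> \<le> (\<Sum>i\<in>UNIV. c1 i) + (\<Sum>i\<in>UNIV. \<Sum>j\<in>UNIV. c2 i j)"
      using c2(2)[of i j x] p1 by linarith
  qed
qed

text \<open>A weak solution in which the pressure has been eliminated: the momentum equation is only tested with
divergence-free fields. The matrix \<open>G\<close> is the weak gradient of \<open>U\<close>.\<close>

locale stationary_flow =
  fixes U :: "3 \<Rightarrow> real^3 \<Rightarrow> real" and G :: "3 \<Rightarrow> 3 \<Rightarrow> real^3 \<Rightarrow> real"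
  assumes U4: "Lloc 4 (U i)"
    and G_borel: "G i j \<in> borel_measurable borel"
    and G_sq: "integrable lborel (\<lambda>x. (G i j x)\<^sup>2)"
    and weak_gradient: "smooth_fun \<phi> \<Longrightarrow> supp_in r \<phi> \<Longrightarrow>
      (\<integral>x. U i x * partial_deriv j \<phi> x \<partial>lborel) = - (\<integral>x. G i j x * \<phi> x \<partial>lborel)"
    and divergence_free: "smooth_fun \<phi> \<Longrightarrow> supp_in r \<phi> \<Longrightarrow>
      (\<Sum>i\<in>UNIV. \<integral>x. U i x * partial_deriv i \<phi> x \<partial>lborel) = 0"
    and momentum: "(\<And>i. smooth_fun (\<Phi> i)) \<Longrightarrow> (\<And>i. supp_in r (\<Phi> i)) \<Longrightarrow>
      (\<And>x. (\<Sum>i\<in>UNIV. partial_deriv i (\<Phi> i) x) = 0) \<Longrightarrow>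
      (\<Sum>i\<in>UNIV. \<Sum>k\<in>UNIV. \<integral>x. G i k x * partial_deriv k (\<Phi> i) x \<partial>lborel) +
      (\<Sum>i\<in>UNIV. \<Sum>k\<in>UNIV. \<integral>x. G i k x * (U k x * \<Phi> i x) \<partial>lborel) = 0"
begin

lemma U2: "Lloc 2 (U i)" and U1: "Lloc 1 (U i)"
  by (rule Lloc_mono[OF U4], simp)+

lemma UU: "Lloc 2 (\<lambda>x. U i x * U k x)"
  using Lloc_mult[of 2 "U i" "U k"] U4 by simp

lemma G2: "Lloc 2 (G i j)"
  by (rule Lloc_global[OF G_borel]) (simp add: G_sq)

lemma G1: "Lloc 1 (G i j)"
  by (rule Lloc_mono[OF G2]) simp

text \<open>Testing with the reflected kernel \<open>y \<mapsto> J (x - y)\<close> moves a derivative from the kernel to \<open>U\<close>.\<close>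

lemma conv_weak_gradient:
  assumes "smooth_fun J" "supp_in r J"
  shows "conv (partial_deriv j J) (U i) = conv J (G i j)"
proof
  fix x
  show "conv (partial_deriv j J) (U i) x = conv J (G i j) x"
    using weak_gradient[OF smooth_fun_reflect[OF assms(1), of x] supp_in_reflect[OF assms(2), of x], of i j]
    by (simp add: partial_deriv_reflect[OF assms(1)] conv_def mult.commute)
qed

lemma conv_divergence_free:
  assumes "smooth_fun J" "supp_in r J"
  shows "(\<Sum>i\<in>UNIV. conv (partial_deriv i J) (U i) x) = 0"
  using divergence_free[OF smooth_fun_reflect[OF assms(1), of x] supp_in_reflect[OF assms(2), of x]]
  by (simp add: partial_deriv_reflect[OF assms(1)] conv_def mult.commute sum_negf)

lemma partial_deriv_mollified:
  "partial_deriv k (conv (moll_seq n) (U i)) = conv (moll_seq n) (G i k)"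
  using conv_partial_deriv(2)[OF moll_seq_smooth prob_kernelD(4)[OF moll_seq_kernel] U1]
    conv_weak_gradient[OF moll_seq_smooth prob_kernelD(4)[OF moll_seq_kernel]] by simp

text \<open>Formally the divergence theorem for \<open>U\<^sub>i U \<psi>\<close> with \<open>div U = 0\<close>. The product \<open>U\<^sub>i \<psi>\<close> is not smooth, so \<open>U\<^sub>i\<close> is
mollified and the limit is taken afterwards.\<close>

lemma convection_by_parts:
  assumes \<psi>: "smooth_fun \<psi>" "supp_in r \<psi>"
  shows "(\<Sum>k\<in>UNIV. \<integral>x. G i k x * (U k x * \<psi> x) \<partial>lborel) =
    - (\<Sum>k\<in>UNIV. \<integral>x. (U i x * U k x) * partial_deriv k \<psi> x \<partial>lborel)"
proof -
  let ?u = "\<lambda>n. conv (moll_seq n) (U i)"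
  note su = moll_seq_conv_smooth[OF U1]
  note d\<psi> = smooth_fun_partial_deriv[OF \<psi>(1)] supp_in_partial_deriv[OF \<psi>(2,1)]
  have U\<psi>: "Lloc 2 (\<lambda>x. U k x * g x)" "supp_in r (\<lambda>x. U k x * g x)"
    if "smooth_fun g" "supp_in r g" for k g
    using Lloc_mult[of 2 "U k" g] U4 Lloc_smooth[OF that(1)] supp_in_mult(2)[OF that(2)] by simp_all
  have zero: "(\<Sum>k\<in>UNIV. (\<integral>x. (U k x * \<psi> x) * conv (moll_seq n) (G i k) x \<partial>lborel) +
      (\<integral>x. (U k x * partial_deriv k \<psi> x) * ?u n x \<partial>lborel)) = 0" for n
  proof -
    have "(\<Sum>k\<in>UNIV. \<integral>x. U k x * partial_deriv k (\<lambda>x. ?u n x * \<psi> x) x \<partial>lborel) = 0"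
      by (rule divergence_free[OF smooth_fun_mult[OF su \<psi>(1)] supp_in_mult(2)[OF \<psi>(2)]])
    moreover have "(\<integral>x. U k x * partial_deriv k (\<lambda>x. ?u n x * \<psi> x) x \<partial>lborel) =
        (\<integral>x. (U k x * \<psi> x) * conv (moll_seq n) (G i k) x \<partial>lborel) +
        (\<integral>x. (U k x * partial_deriv k \<psi> x) * ?u n x \<partial>lborel)" for k
    proof -
      have 1: "integrable lborel (\<lambda>x. conv (moll_seq n) (G i k) x * (U k x * \<psi> x))"
        by (rule ball_Cauchy_Schwarz(1)[OF Lloc_smooth[OF moll_seq_conv_smooth[OF G1]] U\<psi>[OF \<psi>]])
      have 2: "integrable lborel (\<lambda>x. ?u n x * (U k x * partial_deriv k \<psi> x))"
        by (rule ball_Cauchy_Schwarz(1)[OF Lloc_smooth[OF su] U\<psi>[OF d\<psi>]])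
      have "(\<lambda>x. U k x * partial_deriv k (\<lambda>x. ?u n x * \<psi> x) x) =
          (\<lambda>x. conv (moll_seq n) (G i k) x * (U k x * \<psi> x) + ?u n x * (U k x * partial_deriv k \<psi> x))"
        unfolding partial_deriv_smooth_mult[OF su \<psi>(1)] partial_deriv_mollified
        by (simp add: algebra_simps)
      then show ?thesis using 1 2 by (simp add: mult.commute)
    qed
    ultimately show ?thesis by simp
  qed
  have "(\<lambda>n. \<Sum>k\<in>UNIV. (\<integral>x. (U k x * \<psi> x) * conv (moll_seq n) (G i k) x \<partial>lborel) +
      (\<integral>x. (U k x * partial_deriv k \<psi> x) * ?u n x \<partial>lborel)) \<longlonglongrightarrow>
      (\<Sum>k\<in>UNIV. (\<integral>x. (U k x * \<psi> x) * G i k x \<partial>lborel) +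
      (\<integral>x. (U k x * partial_deriv k \<psi> x) * U i x \<partial>lborel))"
    by (intro tendsto_sum tendsto_add moll_seq_integral_tendsto[of _ r] U\<psi> \<psi> d\<psi> G2 U2)
  then have "(\<Sum>k\<in>UNIV. (\<integral>x. (U k x * \<psi> x) * G i k x \<partial>lborel) +
      (\<integral>x. (U k x * partial_deriv k \<psi> x) * U i x \<partial>lborel)) = 0"
    unfolding zero by (simp add: LIMSEQ_const_iff)
  then show ?thesis by (simp add: sum.distrib ac_simps)
qed

text \<open>Formally \<open>U\<^sub>i U\<^sub>k \<partial>\<^sub>k U\<^sub>i\<close> is half of \<open>U\<^sub>k \<partial>\<^sub>k (U\<^sub>i)\<^sup>2\<close>. The identity is \<open>convection_by_parts\<close> with a mollification of
\<open>U\<^sub>i\<close> times the cutoff as test function; the term sought appears on both sides of the limit.\<close>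

lemma cubic_term:
  assumes \<phi>: "smooth_fun \<phi>" "supp_in r \<phi>"
  shows "2 * (\<Sum>k\<in>UNIV. \<integral>x. G i k x * ((U k x * \<phi> x) * U i x) \<partial>lborel) =
    - (\<Sum>k\<in>UNIV. \<integral>x. ((U i x * U k x) * partial_deriv k \<phi> x) * U i x \<partial>lborel)"
proof -
  let ?u = "\<lambda>n. conv (moll_seq n) (U i)"
  note su = moll_seq_conv_smooth[OF U1]
  note d\<phi> = smooth_fun_partial_deriv[OF \<phi>(1)] supp_in_partial_deriv[OF \<phi>(2,1)]
  have U4\<phi>: "Lloc 4 (\<lambda>x. U k x * g x)" "supp_in r (\<lambda>x. U k x * g x)"
    if "smooth_fun g" "supp_in r g" for k g
    using Lloc_continuous_mult[OF U4[of k] smooth_fun_continuous[OF that(1)]]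
    by (simp add: mult.commute, intro supp_in_mult(2)[OF that(2)])
  have UU\<phi>: "Lloc 2 (\<lambda>x. (U i x * U k x) * g x)" "supp_in r (\<lambda>x. (U i x * U k x) * g x)"
    if "smooth_fun g" "supp_in r g" for k g
    using Lloc_continuous_mult[OF UU[of i k] smooth_fun_continuous[OF that(1)]]
    by (simp add: mult.commute, intro supp_in_mult(2)[OF that(2)])
  have eq: "(\<Sum>k\<in>UNIV. \<integral>x. G i k x * ((U k x * \<phi> x) * ?u n x) \<partial>lborel) =
    - (\<Sum>k\<in>UNIV. (\<integral>x. ((U i x * U k x) * \<phi> x) * conv (moll_seq n) (G i k) x \<partial>lborel) +
      (\<integral>x. ((U i x * U k x) * partial_deriv k \<phi> x) * ?u n x \<partial>lborel))" for n
  proof -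
    have "(\<Sum>k\<in>UNIV. \<integral>x. G i k x * (U k x * (\<phi> x * ?u n x)) \<partial>lborel) =
      - (\<Sum>k\<in>UNIV. \<integral>x. (U i x * U k x) * partial_deriv k (\<lambda>x. \<phi> x * ?u n x) x \<partial>lborel)"
      by (rule convection_by_parts[OF smooth_fun_mult[OF \<phi>(1) su] supp_in_mult(1)[OF \<phi>(2)]])
    moreover have "(\<integral>x. (U i x * U k x) * partial_deriv k (\<lambda>x. \<phi> x * ?u n x) x \<partial>lborel) =
      (\<integral>x. ((U i x * U k x) * \<phi> x) * conv (moll_seq n) (G i k) x \<partial>lborel) +
      (\<integral>x. ((U i x * U k x) * partial_deriv k \<phi> x) * ?u n x \<partial>lborel)" for k
    proof -
      have 1: "integrable lborel (\<lambda>x. conv (moll_seq n) (G i k) x * ((U i x * U k x) * \<phi> x))"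
        by (rule ball_Cauchy_Schwarz(1)[OF Lloc_smooth[OF moll_seq_conv_smooth[OF G1]] UU\<phi>[OF \<phi>]])
      have 2: "integrable lborel (\<lambda>x. ?u n x * ((U i x * U k x) * partial_deriv k \<phi> x))"
        by (rule ball_Cauchy_Schwarz(1)[OF Lloc_smooth[OF su] UU\<phi>[OF d\<phi>]])
      have "(\<lambda>x. (U i x * U k x) * partial_deriv k (\<lambda>x. \<phi> x * ?u n x) x) =
          (\<lambda>x. conv (moll_seq n) (G i k) x * ((U i x * U k x) * \<phi> x) + ?u n x * ((U i x * U k x) * partial_deriv k \<phi> x))"
        unfolding partial_deriv_smooth_mult[OF \<phi>(1) su] partial_deriv_mollified
        by (simp add: algebra_simps)
      then show ?thesis using 1 2 by (simp add: mult.commute)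
    qed
    ultimately show ?thesis by (simp add: mult.assoc)
  qed
  have "(\<lambda>n. \<Sum>k\<in>UNIV. \<integral>x. G i k x * ((U k x * \<phi> x) * ?u n x) \<partial>lborel) \<longlonglongrightarrow>
      (\<Sum>k\<in>UNIV. \<integral>x. G i k x * ((U k x * \<phi> x) * U i x) \<partial>lborel)"
    by (intro tendsto_sum moll_seq_integral_tendsto4[of _ _ r] G2 U4\<phi> \<phi> U4)
  moreover have "(\<lambda>n. - (\<Sum>k\<in>UNIV. (\<integral>x. ((U i x * U k x) * \<phi> x) * conv (moll_seq n) (G i k) x \<partial>lborel) +
      (\<integral>x. ((U i x * U k x) * partial_deriv k \<phi> x) * ?u n x \<partial>lborel))) \<longlonglongrightarrow>
     - (\<Sum>k\<in>UNIV. (\<integral>x. ((U i x * U k x) * \<phi> x) * G i k x \<partial>lborel) +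
      (\<integral>x. ((U i x * U k x) * partial_deriv k \<phi> x) * U i x \<partial>lborel))"
    by (intro tendsto_minus tendsto_sum tendsto_add moll_seq_integral_tendsto[of _ r] UU\<phi> \<phi> d\<phi> G2 U2)
  ultimately have "(\<Sum>k\<in>UNIV. \<integral>x. G i k x * ((U k x * \<phi> x) * U i x) \<partial>lborel) =
     - (\<Sum>k\<in>UNIV. (\<integral>x. ((U i x * U k x) * \<phi> x) * G i k x \<partial>lborel) +
      (\<integral>x. ((U i x * U k x) * partial_deriv k \<phi> x) * U i x \<partial>lborel))"
    unfolding eq by (rule LIMSEQ_unique)
  then show ?thesis by (simp add: sum.distrib ac_simps)
qed

end

section \<open>The energy estimate without pressure\<close>

context stationary_flow
begin

definition L2_mass :: "real \<Rightarrow> real"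
  where "L2_mass r = (\<Sum>i\<in>UNIV. ball_sq r (U i))"

lemma L2_mass_ge: "ball_sq r (U i) \<le> L2_mass r"
  unfolding L2_mass_def by (rule member_le_sum) (auto simp: ball_sq_nonneg)

lemma L2_mass_nonneg: "0 \<le> L2_mass r"
  unfolding L2_mass_def by (intro sum_nonneg) (simp add: ball_sq_nonneg)

text \<open>The momentum equation says that the divergence of this matrix is a gradient.\<close>

definition flux :: "3 \<Rightarrow> 3 \<Rightarrow> real^3 \<Rightarrow> real"
  where "flux i k x = G i k x - U i x * U k x"

lemma flux_L2: "Lloc 2 (flux i k)"
  unfolding flux_def[abs_def] by (rule Lloc_diff[OF G2 UU])

lemma test_flux:
  assumes \<Phi>: "\<And>i. smooth_fun (\<Phi> i)" "\<And>i. supp_in r (\<Phi> i)"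
    and div: "\<And>x. (\<Sum>i\<in>UNIV. partial_deriv i (\<Phi> i) x) = 0"
  shows "(\<Sum>i\<in>UNIV. \<Sum>k\<in>UNIV. \<integral>x. flux i k x * partial_deriv k (\<Phi> i) x \<partial>lborel) = 0"
proof -
  note d\<Phi> = smooth_fun_partial_deriv[OF \<Phi>(1)] supp_in_partial_deriv[OF \<Phi>(2,1)]
  have "(\<integral>x. flux i k x * partial_deriv k (\<Phi> i) x \<partial>lborel) =
      (\<integral>x. G i k x * partial_deriv k (\<Phi> i) x \<partial>lborel) -
      (\<integral>x. (U i x * U k x) * partial_deriv k (\<Phi> i) x \<partial>lborel)" for i k
    using ball_Cauchy_Schwarz(1)[OF G2[of i k] Lloc_smooth[OF d\<Phi>(1)] d\<Phi>(2)]
      ball_Cauchy_Schwarz(1)[OF UU[of i k] Lloc_smooth[OF d\<Phi>(1)] d\<Phi>(2)]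
    by (simp add: flux_def left_diff_distrib)
  then have "(\<Sum>i\<in>UNIV. \<Sum>k\<in>UNIV. \<integral>x. flux i k x * partial_deriv k (\<Phi> i) x \<partial>lborel) =
      (\<Sum>i\<in>UNIV. \<Sum>k\<in>UNIV. \<integral>x. G i k x * partial_deriv k (\<Phi> i) x \<partial>lborel) +
      (\<Sum>i\<in>UNIV. - (\<Sum>k\<in>UNIV. \<integral>x. (U i x * U k x) * partial_deriv k (\<Phi> i) x \<partial>lborel))"
    by (simp add: sum_subtractf sum_negf)
  also have "\<dots> = 0"
    using momentum[OF \<Phi> div] by (simp only: convection_by_parts[OF \<Phi>])
  finally show ?thesis .
qed

text \<open>The divergence of the row divergences of an antisymmetric matrix vanishes because partial derivatives
commute. This is the source of divergence-free test fields with compact support.\<close>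

lemma antisymmetric_test_field:
  fixes F :: "3 \<Rightarrow> 3 \<Rightarrow> real^3 \<Rightarrow> real"
  assumes F: "\<And>i j. smooth_fun (F i j)" and anti: "\<And>i j. F j i = (\<lambda>x. - F i j x)"
  shows "(\<Sum>i\<in>UNIV. partial_deriv i (\<lambda>x. - (\<Sum>j\<in>UNIV. partial_deriv j (F i j) x)) x) = 0"
proof -
  define D where "D i j = partial_deriv i (partial_deriv j (F i j)) x" for i j
  note dF = smooth_fun_partial_deriv[OF F]
  have DD: "D j i = - D i j" for i j
  proof -
    have "D j i = partial_deriv j (partial_deriv i (\<lambda>x. - F i j x)) x"
      unfolding D_def by (subst anti) simp
    also have "\<dots> = - partial_deriv j (partial_deriv i (F i j)) x"
      by (simp only: partial_deriv_smooth_uminus[OF F] partial_deriv_smooth_uminus[OF dF])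
    also have "\<dots> = - D i j"
      unfolding D_def by (simp only: partial_deriv_commute[OF F, of j i])
    finally show ?thesis .
  qed
  have "(\<Sum>i\<in>UNIV. \<Sum>j\<in>UNIV. D i j) = (\<Sum>j\<in>UNIV. \<Sum>i\<in>UNIV. D i j)" by (rule sum.swap)
  also have "\<dots> = (\<Sum>j\<in>UNIV. \<Sum>i\<in>UNIV. - D j i)"
    by (intro sum.cong refl) (rule DD)
  also have "\<dots> = - (\<Sum>i\<in>UNIV. \<Sum>j\<in>UNIV. D i j)" by (simp add: sum_negf)
  finally have "(\<Sum>i\<in>UNIV. \<Sum>j\<in>UNIV. D i j) = 0" by simp
  moreover have "partial_deriv i (\<lambda>x. - (\<Sum>j\<in>UNIV. partial_deriv j (F i j) x)) x = - (\<Sum>j\<in>UNIV. D i j)" for i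
    by (simp add: partial_deriv_smooth_uminus smooth_fun_sum dF partial_deriv_smooth_sum D_def)
  ultimately show ?thesis by (simp add: sum_negf)
qed

definition cutoff :: "real \<Rightarrow> real^3 \<Rightarrow> real"
  where "cutoff R x = bump (x /\<^sub>R R)"

lemma cutoff_smooth: "smooth_fun (cutoff R)"
  unfolding cutoff_def[abs_def] by (rule smooth_fun_scale[OF bump_smooth])

lemma cutoff_supp_in: "R > 0 \<Longrightarrow> supp_in R (cutoff R)"
  unfolding cutoff_def[abs_def] by (rule supp_in_scale[OF bump_supp_in])

lemma cutoff_partial_deriv:
  "partial_deriv i (cutoff R) = (\<lambda>x. partial_deriv i bump (x /\<^sub>R R) / R)"
  unfolding cutoff_def[abs_def] by (rule partial_deriv_scale[OF bump_smooth])

lemma cutoff_partial_deriv2: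
  "partial_deriv k (partial_deriv i (cutoff R)) = (\<lambda>x. partial_deriv k (partial_deriv i bump) (x /\<^sub>R R) / R / R)"
proof -
  have "partial_deriv k (\<lambda>x. (1 / R) * partial_deriv i bump (x /\<^sub>R R)) =
      (\<lambda>x. (1 / R) * (partial_deriv k (partial_deriv i bump) (x /\<^sub>R R) / R))"
    by (simp only: partial_deriv_smooth_cmult[OF smooth_fun_scale[OF smooth_fun_partial_deriv[OF bump_smooth]]]
      partial_deriv_scale[OF smooth_fun_partial_deriv[OF bump_smooth]])
  then show ?thesis unfolding cutoff_partial_deriv by simp
qed

text \<open>The test field is \<open>- \<Sum>\<^sub>j \<partial>\<^sub>j (\<phi> \<omega>\<^sub>i\<^sub>j)\<close>, with \<open>\<omega>\<close> the antisymmetric gradient of the potential of \<open>U\<close>. The left-hand side is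
the part of the tested equation in which the derivative falls on the mollified velocity; in all other terms it falls
on the cutoff, on the coarse mollification or on \<open>\<omega>\<close>, and each gains a factor \<open>1/R\<close>.\<close>

lemma energy_step:
  assumes C: "\<And>i x. \<bar>partial_deriv i bump (x :: real^3)\<bar> \<le> C"
    "\<And>i j x. \<bar>partial_deriv i (partial_deriv j bump) (x :: real^3)\<bar> \<le> C"
    and C0: "C0 \<ge> 0" "\<And>i s. s > 0 \<Longrightarrow> (\<integral>x. \<bar>partial_deriv i (moll s) x\<bar> \<partial>lborel) \<le> C0 / s"
    and R: "R \<ge> 1"
  shows "\<bar>\<Sum>i\<in>UNIV. \<Sum>k\<in>UNIV. \<integral>x. (cutoff R x * flux i k x) * conv (moll_seq n) (G i k) x \<partial>lborel\<bar>
    \<le> (\<Sum>i\<in>UNIV. \<Sum>k\<in>UNIV. sqrt (ball_sq R (flux i k)) * sqrt ((23696 * C\<^sup>2 + 4 * C0\<^sup>2) / R\<^sup>2 * L2_mass (2 * R)))"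
proof -
  define \<epsilon> where "\<epsilon> = inverse (real (Suc n))"
  have \<epsilon>: "0 < \<epsilon>" "\<epsilon> \<le> R" "\<epsilon> \<le> 1" using R by (auto simp: \<epsilon>_def inverse_le_1_iff intro: order_trans[of _ 1])
  have R0: "R > 0" using R by simp
  have ms: "moll_seq n = moll \<epsilon>" by (simp add: moll_seq_def \<epsilon>_def)
  let ?\<phi> = "cutoff R" and ?L = "L2_mass (2 * R)"
  let ?N = "newton \<epsilon> R"
  note N = newton_smooth[OF \<epsilon>(1), of R] newton_supp_in[OF \<epsilon>(1), of R]
  note N1 = smooth_fun_partial_deriv[OF N(1)] supp_in_partial_deriv[OF N(2,1)]
  \<comment> \<open>The fields \<open>ue\<close> and \<open>uR\<close> are the fine and coarse mollifications; \<open>B\<close> is divergence-free with \<open>- \<Delta>B = ue - uR\<close>.\<close>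
  define B where "B i = conv ?N (U i)" for i
  define ue where "ue i = conv (moll \<epsilon>) (U i)" for i
  define uR where "uR i = conv (moll R) (U i)" for i
  \<comment> \<open>The matrix \<open>\<omega>\<close> and the divergence-free test field \<open>\<Phi>\<close> built from it.\<close>
  define Om where "Om i j x = partial_deriv j (B i) x - partial_deriv i (B j) x" for i j x
  define F where "F i j x = ?\<phi> x * Om i j x" for i j x
  define \<Phi> where "\<Phi> i x = - (\<Sum>j\<in>UNIV. partial_deriv j (F i j) x)" for i x
  have sB: "smooth_fun (B i)" for i unfolding B_def by (rule conv_smooth[OF N U1])
  note sdB = smooth_fun_partial_deriv[OF sB] and sddB = smooth_fun_partial_deriv[OF smooth_fun_partial_deriv[OF sB]]
  have sue: "smooth_fun (ue i)" and suR: "smooth_fun (uR i)" for i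
    unfolding ue_def uR_def
    by (rule conv_smooth[OF moll_smooth moll_supp_in[OF \<epsilon>(1)] U1],
        rule conv_smooth[OF moll_smooth moll_supp_in[OF R0] U1])
  have sOm: "smooth_fun (Om i j)" for i j
    unfolding Om_def[abs_def] by (rule smooth_fun_diff[OF sdB sdB])
  have dOm: "partial_deriv k (Om i j) = (\<lambda>x. partial_deriv k (partial_deriv j (B i)) x - partial_deriv k (partial_deriv i (B j)) x)" for i j k
    unfolding Om_def[abs_def] by (rule partial_deriv_smooth_diff[OF sdB sdB])
  have sF: "smooth_fun (F i j)" for i j
    unfolding F_def[abs_def] by (rule smooth_fun_mult[OF cutoff_smooth sOm])
  have suppF: "supp_in R (F i j)" for i j
    unfolding F_def[abs_def] by (rule supp_in_mult(1)[OF cutoff_supp_in[OF R0]])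
  have s\<Phi>: "smooth_fun (\<Phi> i)" for i
    unfolding \<Phi>_def[abs_def] by (rule smooth_fun_uminus[OF smooth_fun_sum[OF smooth_fun_partial_deriv[OF sF]]])
  have supp\<Phi>: "supp_in R (\<Phi> i)" for i
    using supp_in_partial_deriv[OF suppF sF] by (simp add: supp_in_def \<Phi>_def)
  have div: "(\<Sum>i\<in>UNIV. partial_deriv i (\<Phi> i) x) = 0" for x
    unfolding \<Phi>_def[abs_def]
    by (rule antisymmetric_test_field[OF sF]) (simp add: F_def Om_def fun_eq_iff algebra_simps)
  note zero = test_flux[OF s\<Phi> supp\<Phi> div]
  have divB: "(\<Sum>j\<in>UNIV. partial_deriv j (partial_deriv i (B j)) x) = 0" for i x
  proof -
    have "partial_deriv j (partial_deriv i (B j)) = conv (partial_deriv j (partial_deriv i ?N)) (U j)" for j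
      unfolding B_def by (rule conv_partial_deriv2[OF N U1])
    then show ?thesis using conv_divergence_free[OF N1] by simp
  qed
  have lapB: "(\<Sum>j\<in>UNIV. partial_deriv j (partial_deriv j (B i)) x) = uR i x - ue i x" for i x
    unfolding B_def uR_def ue_def by (rule laplacian_conv_newton[OF \<epsilon>(1,2) U1])
  have \<Phi>_eq: "\<Phi> i = (\<lambda>x. ?\<phi> x * (ue i x - uR i x) - (\<Sum>j\<in>UNIV. partial_deriv j ?\<phi> x * Om i j x))" for i
  proof
    fix x
    have "(\<Sum>j\<in>UNIV. partial_deriv j (Om i j) x) = uR i x - ue i x"
      unfolding dOm by (simp add: sum_subtractf lapB divB)
    then have "(\<Sum>j\<in>UNIV. ?\<phi> x * partial_deriv j (Om i j) x) = ?\<phi> x * (uR i x - ue i x)"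
      by (simp flip: sum_distrib_left)
    then show "\<Phi> i x = ?\<phi> x * (ue i x - uR i x) - (\<Sum>j\<in>UNIV. partial_deriv j ?\<phi> x * Om i j x)"
      unfolding \<Phi>_def F_def[abs_def] partial_deriv_smooth_mult[OF cutoff_smooth sOm]
      by (simp add: sum.distrib algebra_simps)
  qed
  \<comment> \<open>Everything in \<open>\<partial>\<^sub>k \<Phi>\<^sub>i\<close> apart from \<open>\<phi> \<partial>\<^sub>k ue\<close>.\<close>
  define E1 where "E1 i k x = partial_deriv k ?\<phi> x * (ue i x - uR i x)" for i k x
  define E2 where "E2 i k x = ?\<phi> x * partial_deriv k (uR i) x" for i k x
  define E3 where "E3 i k j x = partial_deriv k (partial_deriv j ?\<phi>) x * Om i j x + partial_deriv j ?\<phi> x * partial_deriv k (Om i j) x" for i k j x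
  define Er where "Er i k x = (E1 i k x - E2 i k x) - (\<Sum>j\<in>UNIV. E3 i k j x)" for i k x
  note s\<phi> = cutoff_smooth[of R] smooth_fun_partial_deriv[OF cutoff_smooth[of R]]
  have due: "partial_deriv k (ue i) = conv (moll_seq n) (G i k)" for i k
    using partial_deriv_mollified[of k n i] by (simp add: ue_def ms)
  have d\<Phi>: "partial_deriv k (\<Phi> i) x = ?\<phi> x * conv (moll_seq n) (G i k) x + Er i k x" for i k x
    unfolding \<Phi>_eq partial_deriv_smooth_diff[OF smooth_fun_mult[OF s\<phi>(1) smooth_fun_diff[OF sue suR]]
          smooth_fun_sum[OF smooth_fun_mult[OF s\<phi>(2) sOm]]]
      partial_deriv_smooth_sum[OF smooth_fun_mult[OF s\<phi>(2) sOm]]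
      partial_deriv_smooth_mult[OF s\<phi>(1) smooth_fun_diff[OF sue suR]]
      partial_deriv_smooth_mult[OF s\<phi>(2) sOm] partial_deriv_smooth_diff[OF sue suR] due
      Er_def E1_def E2_def E3_def
    by (simp add: algebra_simps)
  have sE1: "smooth_fun (E1 i k)" and sE2: "smooth_fun (E2 i k)" and sE3: "smooth_fun (E3 i k j)" for i k j
    unfolding E1_def[abs_def] E2_def[abs_def] E3_def[abs_def]
    by (intro smooth_fun_mult smooth_fun_add smooth_fun_diff smooth_fun_partial_deriv cutoff_smooth sue suR sOm)+
  have sEr: "smooth_fun (Er i k)" for i k
    unfolding Er_def[abs_def] by (intro smooth_fun_diff smooth_fun_sum sE1 sE2 sE3)
  have supp\<phi>: "supp_in R ?\<phi>" "supp_in R (partial_deriv j ?\<phi>)" "supp_in R (partial_deriv k (partial_deriv j ?\<phi>))" for j k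
    by (intro supp_in_partial_deriv cutoff_supp_in[OF R0] s\<phi>)+
  have suppEr: "supp_in R (Er i k)" for i k
    using supp\<phi> by (simp add: supp_in_def Er_def E1_def E2_def E3_def)
  have b1: "\<bar>partial_deriv k ?\<phi> x\<bar> \<le> C / R" for k x
    unfolding cutoff_partial_deriv using C(1) R0 by (simp add: abs_divide divide_right_mono)
  have b2: "\<bar>partial_deriv k (partial_deriv j ?\<phi>) x\<bar> \<le> C / R / R" for k j x
    unfolding cutoff_partial_deriv2 using C(2) R0 by (simp add: abs_divide divide_right_mono)
  have b0: "\<bar>?\<phi> x\<bar> \<le> 1" for x
    unfolding cutoff_def using bump_nonneg[of "x /\<^sub>R R"] bump_le_1[of "x /\<^sub>R R"] by linarith
  have moll_bound: "ball_sq R (conv (moll s) (U i)) \<le> ?L" if s: "0 < s" "s \<le> R" for s i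
  proof -
    note K = prob_kernelD[OF moll_prob_kernel[OF s(1)]]
    have "ball_sq R (conv (moll s) (U i)) \<le> ball_sq (R + s) (U i)"
      using Young_L2_local[OF K(1,4) U2, of R i] by (simp add: K(5))
    also have "\<dots> \<le> ball_sq (2 * R) (U i)" using s by (intro ball_sq_mono_radius U2) simp
    also have "\<dots> \<le> ?L" by (rule L2_mass_ge)
    finally show ?thesis .
  qed
  have L: "0 \<le> ?L" by (rule L2_mass_nonneg)
  have B1: "ball_sq R (E1 i k) \<le> 4 * C\<^sup>2 * (?L / R\<^sup>2)" for i k
  proof -
    have "ball_sq R (E1 i k) \<le> (C / R)\<^sup>2 * ball_sq R (\<lambda>x. ue i x - uR i x)"
      unfolding E1_def[abs_def] by (rule ball_sq_bounded_mult[OF Lloc_smooth[OF smooth_fun_diff[OF sue suR]] b1])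
    also have "\<dots> \<le> (C / R)\<^sup>2 * (4 * ?L)"
    proof (rule mult_left_mono)
      have "ball_sq R (\<lambda>x. ue i x - uR i x) \<le> 2 * ball_sq R (ue i) + 2 * ball_sq R (uR i)"
        by (rule ball_sq_diff[OF Lloc_smooth[OF sue] Lloc_smooth[OF suR]])
      also have "\<dots> \<le> 4 * ?L"
        using moll_bound[OF \<epsilon>(1,2), of i] moll_bound[of R i] R0 by (simp add: ue_def uR_def)
      finally show "ball_sq R (\<lambda>x. ue i x - uR i x) \<le> 4 * ?L" .
    qed simp
    finally show ?thesis by (simp add: power_divide mult_ac)
  qed
  have B2: "ball_sq R (E2 i k) \<le> C0\<^sup>2 * (?L / R\<^sup>2)" for i k
  proof -
    note K = moll_smooth[of R] moll_supp_in[OF R0]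
    note K1 = smooth_fun_continuous[OF smooth_fun_partial_deriv[OF K(1)]] supp_in_partial_deriv[OF K(2,1)]
    have "ball_sq R (E2 i k) \<le> ball_sq R (partial_deriv k (uR i))"
    proof -
      have "ball_sq R (\<lambda>x. ?\<phi> x * partial_deriv k (uR i) x) \<le> 1\<^sup>2 * ball_sq R (partial_deriv k (uR i))"
        by (rule ball_sq_bounded_mult[OF Lloc_smooth[OF smooth_fun_partial_deriv[OF suR]] b0])
      then show ?thesis by (simp add: E2_def[abs_def])
    qed
    also have "partial_deriv k (uR i) = conv (partial_deriv k (moll R)) (U i)"
      unfolding uR_def by (rule conv_partial_deriv(2)[OF K U1])
    also have "ball_sq R \<dots> \<le> (\<integral>x. \<bar>partial_deriv k (moll R) x\<bar> \<partial>lborel)\<^sup>2 * ball_sq (R + R) (U i)"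
      by (rule Young_L2_local[OF K1 U2])
    also have "\<dots> \<le> (C0 / R)\<^sup>2 * ?L"
      using C0(2)[OF R0] L2_mass_ge[of "2 * R" i]
      by (intro mult_mono power_mono) (auto simp: ball_sq_nonneg)
    finally show ?thesis by (simp add: power_divide)
  qed
  have BOm: "ball_sq R (Om i j) \<le> 576 * R\<^sup>2 * ?L" for i j
  proof -
    have d: "ball_sq R (partial_deriv j (B i)) \<le> 144 * R\<^sup>2 * ?L" for i j
    proof -
      have "ball_sq R (partial_deriv j (B i)) \<le> 144 * R\<^sup>2 * ball_sq (2 * R) (U i)"
        unfolding B_def by (rule newton_conv_bounds(2)[OF \<epsilon>(1,2) U2])
      also have "\<dots> \<le> 144 * R\<^sup>2 * ?L" by (intro mult_left_mono L2_mass_ge) simp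
      finally show ?thesis .
    qed
    have "ball_sq R (Om i j) \<le> 2 * ball_sq R (partial_deriv j (B i)) + 2 * ball_sq R (partial_deriv i (B j))"
      unfolding Om_def[abs_def] by (rule ball_sq_diff[OF Lloc_smooth[OF sdB] Lloc_smooth[OF sdB]])
    then show ?thesis using d[of j i] d[of i j] by simp
  qed
  have BdOm: "ball_sq R (partial_deriv k (Om i j)) \<le> 16 * ?L" for i j k
  proof -
    have d: "ball_sq R (partial_deriv k (partial_deriv j (B i))) \<le> 4 * ?L" for i j
    proof -
      have "ball_sq R (partial_deriv k (partial_deriv j (B i))) \<le> 4 * ball_sq (2 * R) (U i)"
        unfolding B_def by (rule newton_conv_bounds(1)[OF \<epsilon>(1,2) U2])
      also have "\<dots> \<le> 4 * ?L" by (intro mult_left_mono L2_mass_ge) simp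
      finally show ?thesis .
    qed
    have "ball_sq R (partial_deriv k (Om i j)) \<le> 2 * ball_sq R (partial_deriv k (partial_deriv j (B i))) + 2 * ball_sq R (partial_deriv k (partial_deriv i (B j)))"
      unfolding dOm by (rule ball_sq_diff[OF Lloc_smooth[OF sddB] Lloc_smooth[OF sddB]])
    then show ?thesis using d[of j i] d[of i j] by simp
  qed
  have B3: "ball_sq R (E3 i k j) \<le> 1184 * C\<^sup>2 * (?L / R\<^sup>2)" for i k j
  proof -
    have 1: "ball_sq R (\<lambda>x. partial_deriv k (partial_deriv j ?\<phi>) x * Om i j x) \<le> (C / R / R)\<^sup>2 * (576 * R\<^sup>2 * ?L)"
      by (rule order_trans[OF ball_sq_bounded_mult[OF Lloc_smooth[OF sOm] b2]])
        (intro mult_left_mono BOm zero_le_power2)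
    have 2: "ball_sq R (\<lambda>x. partial_deriv j ?\<phi> x * partial_deriv k (Om i j) x) \<le> (C / R)\<^sup>2 * (16 * ?L)"
      by (rule order_trans[OF ball_sq_bounded_mult[OF Lloc_smooth[OF smooth_fun_partial_deriv[OF sOm]] b1]])
        (intro mult_left_mono BdOm zero_le_power2)
    have "ball_sq R (E3 i k j) \<le> 2 * ball_sq R (\<lambda>x. partial_deriv k (partial_deriv j ?\<phi>) x * Om i j x)
        + 2 * ball_sq R (\<lambda>x. partial_deriv j ?\<phi> x * partial_deriv k (Om i j) x)"
      unfolding E3_def[abs_def]
      by (intro ball_sq_add Lloc_smooth smooth_fun_mult smooth_fun_partial_deriv cutoff_smooth sOm)
    also have "\<dots> \<le> 2 * ((C / R / R)\<^sup>2 * (576 * R\<^sup>2 * ?L)) + 2 * ((C / R)\<^sup>2 * (16 * ?L))"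
      using 1 2 by simp
    also have "\<dots> = 1184 * C\<^sup>2 * (?L / R\<^sup>2)"
      using R0 by (simp add: power_divide field_simps)
    finally show ?thesis .
  qed
  have BEr: "ball_sq R (Er i k) \<le> (23696 * C\<^sup>2 + 4 * C0\<^sup>2) / R\<^sup>2 * ?L" for i k
  proof -
    have "ball_sq R (Er i k) \<le> 2 * ball_sq R (\<lambda>x. E1 i k x - E2 i k x) + 2 * ball_sq R (\<lambda>x. \<Sum>j\<in>UNIV. E3 i k j x)"
      unfolding Er_def[abs_def]
      by (intro ball_sq_diff Lloc_smooth smooth_fun_diff smooth_fun_sum sE1 sE2 sE3)
    also have "\<dots> \<le> 2 * (2 * ball_sq R (E1 i k) + 2 * ball_sq R (E2 i k)) + 2 * (10 * (1184 * C\<^sup>2 * (?L / R\<^sup>2)))"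
      by (intro add_mono mult_left_mono ball_sq_diff ball_sq_sum3 B3 Lloc_smooth sE1 sE2 sE3) simp_all
    also have "\<dots> \<le> 2 * (2 * (4 * C\<^sup>2 * (?L / R\<^sup>2)) + 2 * (C0\<^sup>2 * (?L / R\<^sup>2))) + 2 * (10 * (1184 * C\<^sup>2 * (?L / R\<^sup>2)))"
      by (intro add_mono mult_left_mono B1 B2) simp_all
    also have "\<dots> = (23696 * C\<^sup>2 + 4 * C0\<^sup>2) / R\<^sup>2 * ?L"
      by (simp add: add_divide_distrib algebra_simps)
    finally show ?thesis .
  qed
  have main: "(\<integral>x. (?\<phi> x * flux i k x) * conv (moll_seq n) (G i k) x \<partial>lborel) =
      (\<integral>x. flux i k x * partial_deriv k (\<Phi> i) x \<partial>lborel) - (\<integral>x. flux i k x * Er i k x \<partial>lborel)" for i k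
  proof -
    note 1 = ball_Cauchy_Schwarz(1)[OF flux_L2[of i k] Lloc_smooth[OF sEr] suppEr, of i k]
    note 2 = ball_Cauchy_Schwarz(1)[OF flux_L2[of i k] Lloc_smooth[OF smooth_fun_partial_deriv[OF s\<Phi>]]
        supp_in_partial_deriv[OF supp\<Phi> s\<Phi>], of k i]
    have "(\<integral>x. (?\<phi> x * flux i k x) * conv (moll_seq n) (G i k) x \<partial>lborel) =
        (\<integral>x. flux i k x * partial_deriv k (\<Phi> i) x - flux i k x * Er i k x \<partial>lborel)"
      by (simp add: d\<Phi> algebra_simps)
    then show ?thesis using 1 2 by simp
  qed
  have "\<bar>\<Sum>i\<in>UNIV. \<Sum>k\<in>UNIV. \<integral>x. (?\<phi> x * flux i k x) * conv (moll_seq n) (G i k) x \<partial>lborel\<bar> =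
      \<bar>\<Sum>i\<in>UNIV. \<Sum>k\<in>UNIV. \<integral>x. flux i k x * Er i k x \<partial>lborel\<bar>"
    unfolding main by (simp add: sum_subtractf zero)
  also have "\<dots> \<le> (\<Sum>i\<in>UNIV. \<bar>\<Sum>k\<in>UNIV. \<integral>x. flux i k x * Er i k x \<partial>lborel\<bar>)"
    by (rule sum_abs)
  also have "\<dots> \<le> (\<Sum>i\<in>UNIV. \<Sum>k\<in>UNIV. \<bar>\<integral>x. flux i k x * Er i k x \<partial>lborel\<bar>)"
    by (intro sum_mono sum_abs)
  also have "\<dots> \<le> (\<Sum>i\<in>UNIV. \<Sum>k\<in>UNIV. sqrt (ball_sq R (flux i k)) * sqrt ((23696 * C\<^sup>2 + 4 * C0\<^sup>2) / R\<^sup>2 * ?L))"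
  proof (intro sum_mono)
    fix i k
    have "\<bar>\<integral>x. flux i k x * Er i k x \<partial>lborel\<bar> \<le> sqrt (ball_sq R (flux i k)) * sqrt (ball_sq R (Er i k))"
      by (rule ball_Cauchy_Schwarz(2)[OF flux_L2 Lloc_smooth[OF sEr] suppEr])
    also have "\<dots> \<le> sqrt (ball_sq R (flux i k)) * sqrt ((23696 * C\<^sup>2 + 4 * C0\<^sup>2) / R\<^sup>2 * ?L)"
      by (intro mult_left_mono real_sqrt_le_mono BEr) (simp add: ball_sq_nonneg)
    finally show "\<bar>\<integral>x. flux i k x * Er i k x \<partial>lborel\<bar> \<le> \<dots>" .
  qed
  finally show ?thesis .
qed

end

section \<open>A Liouville theorem under a growth condition\<close>

lemma AE_zero_of_balls:
  fixes f :: "'a::real_normed_vector \<Rightarrow> real"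
  assumes "\<And>n. AE x in M. indicator (cball 0 (real n)) x * f x = 0"
  shows "AE x in M. f x = 0"
proof -
  have "AE x in M. \<forall>n. indicator (cball 0 (real n)) x * f x = 0"
    by (intro AE_all_countable[THEN iffD2] allI assms)
  then show ?thesis
  proof eventually_elim
    case (elim x)
    obtain n where "norm x \<le> real n" using real_arch_simple by blast
    with elim[rule_format, of n] show ?case by simp
  qed
qed

lemma AE_zero_of_ball_sq:
  assumes f: "Lloc 2 f" and z: "\<And>r. ball_sq r f = 0"
  shows "AE x in lborel. f x = 0"
proof -
  have "AE x in lborel. indicator (cball 0 (real n)) x * (f x)\<^sup>2 = 0" for n
    using z[of "real n"] integral_nonneg_eq_0_iff_AE[OF Lloc2_integrable[OF f, of "real n"]]
    by (simp add: ball_sq_def)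
  then have "AE x in lborel. (f x)\<^sup>2 = 0" by (rule AE_zero_of_balls)
  then show ?thesis by simp
qed

definition unit_vol :: real
  where "unit_vol = (\<integral>x. indicat_real (cball (0 :: real^3) 1) x \<partial>lborel)"

lemma ball_sq_const:
  assumes "r > 0"
  shows "ball_sq r (\<lambda>x :: real^3. c) = c\<^sup>2 * (unit_vol * r ^ 3)"
proof -
  have "(\<integral>x. indicat_real (cball (0 :: real^3) 1) (x /\<^sub>R r) \<partial>lborel) = r ^ 3 * unit_vol"
    unfolding unit_vol_def by (rule integral_scale) (use assms in auto)
  also have "(\<lambda>x. indicat_real (cball (0 :: real^3) 1) (x /\<^sub>R r)) = indicat_real (cball 0 r)"
    using assms by (auto simp: indicator_def fun_eq_iff field_simps)
  finally show ?thesis by (simp add: ball_sq_def mult.commute)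
qed

lemma unit_vol_pos: "unit_vol > 0"
proof -
  have "measure lborel (cball (0 :: real^3) 1) > 0"
    using content_cball_pos[of 1 "0 :: real^3"] by simp
  then show ?thesis by (simp add: unit_vol_def)
qed

context stationary_flow
begin

definition dirichlet :: real
  where "dirichlet = (\<Sum>i\<in>UNIV. \<Sum>k\<in>UNIV. \<integral>x. (G i k x)\<^sup>2 \<partial>lborel)"

definition L4_mass :: "real \<Rightarrow> real"
  where "L4_mass r = (\<Sum>i\<in>UNIV. ball_sq r (\<lambda>x. (U i x)\<^sup>2))"

lemma dirichlet_ge: "(\<integral>x. (G i k x)\<^sup>2 \<partial>lborel) \<le> dirichlet"
proof -
  have "(\<integral>x. (G i k x)\<^sup>2 \<partial>lborel) \<le> (\<Sum>k\<in>UNIV. \<integral>x. (G i k x)\<^sup>2 \<partial>lborel)"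
    by (rule member_le_sum) auto
  also have "\<dots> \<le> dirichlet" unfolding dirichlet_def
    by (rule member_le_sum[of i UNIV "\<lambda>i. \<Sum>k\<in>UNIV. \<integral>x. (G i k x)\<^sup>2 \<partial>lborel"]) (auto intro: sum_nonneg)
  finally show ?thesis .
qed

lemma dirichlet_nonneg: "0 \<le> dirichlet"
  unfolding dirichlet_def by (intro sum_nonneg) simp

lemma L4_mass_ge: "ball_sq r (\<lambda>x. (U i x)\<^sup>2) \<le> L4_mass r"
  unfolding L4_mass_def by (rule member_le_sum) (auto simp: ball_sq_nonneg)

lemma L4_mass_nonneg: "0 \<le> L4_mass r"
  unfolding L4_mass_def by (intro sum_nonneg) (simp add: ball_sq_nonneg)

lemma U_sq: "Lloc 2 (\<lambda>x. (U i x)\<^sup>2)"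
  using UU[of i i] by (simp add: power2_eq_square)

lemma ball_sq_UU:
  assumes "r \<le> s"
  shows "ball_sq r (\<lambda>x. U i x * U k x) \<le> L4_mass s"
proof -
  have le: "ball_sq r (\<lambda>x. (U i x)\<^sup>2) \<le> L4_mass s" for i
    using ball_sq_mono_radius[OF U_sq assms, of i] L4_mass_ge[of s i] by simp
  have "ball_sq r (\<lambda>x. U i x * U k x) \<le> sqrt (ball_sq r (\<lambda>x. (U i x)\<^sup>2)) * sqrt (ball_sq r (\<lambda>x. (U k x)\<^sup>2))"
    by (rule ball_sq_mult_le[OF U4 U4])
  also have "\<dots> \<le> sqrt (L4_mass s) * sqrt (L4_mass s)"
    by (intro mult_mono real_sqrt_le_mono le) (auto simp: ball_sq_nonneg L4_mass_nonneg)
  finally show ?thesis by (simp add: L4_mass_nonneg)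
qed

text \<open>The limit of \<open>energy_step\<close> for vanishing mollification. The convective part of the left-hand side has no sign,
but by \<open>cubic_term\<close> it equals an integral against the gradient of the cutoff.\<close>

lemma energy_inequality:
  obtains K where "K \<ge> 0"
    "\<And>R. R \<ge> 1 \<Longrightarrow> (\<Sum>i\<in>UNIV. \<Sum>k\<in>UNIV. \<integral>x. cutoff R x * (G i k x)\<^sup>2 \<partial>lborel)
      \<le> K * (sqrt (L2_mass (2 * R)) / R) * (sqrt dirichlet + sqrt (L4_mass (2 * R)))"
proof -
  obtain C where C: "C \<ge> 0" "\<And>i x. \<bar>partial_deriv i bump (x :: real^3)\<bar> \<le> C"
    "\<And>i j x. \<bar>partial_deriv i (partial_deriv j bump) (x :: real^3)\<bar> \<le> C"
    by (rule bump_derivative_bounds) blast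
  obtain C0 where C0: "C0 \<ge> 0" "\<And>i s. s > 0 \<Longrightarrow> (\<integral>x. \<bar>partial_deriv i (moll s) x\<bar> \<partial>lborel) \<le> C0 / s"
    by (rule moll_deriv_L1) blast
  define D where "D = 23696 * C\<^sup>2 + 4 * C0\<^sup>2"
  have D: "D \<ge> 0" by (simp add: D_def)
  show ?thesis
  proof (rule that[of "18 * sqrt D + 9 * C"])
    show "0 \<le> 18 * sqrt D + 9 * C" using C(1) D by simp
    fix R :: real assume R: "R \<ge> 1"
    then have R0: "R > 0" by simp
    let ?\<phi> = "cutoff R" and ?L = "L2_mass (2 * R)" and ?Y = "L4_mass (2 * R)"
    let ?T = "sqrt ?L / R" and ?S = "sqrt dirichlet + sqrt ?Y"
    note \<phi> = cutoff_smooth[of R] cutoff_supp_in[OF R0]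
    note d\<phi> = smooth_fun_partial_deriv[OF \<phi>(1)] supp_in_partial_deriv[OF \<phi>(2,1)]
    have T0: "?T \<ge> 0" using R0 L2_mass_nonneg by simp
    have \<phi>f: "Lloc 2 (\<lambda>x. ?\<phi> x * f x)" "supp_in R (\<lambda>x. ?\<phi> x * f x)" if "Lloc 2 f" for f
      by (rule Lloc_continuous_mult[OF that smooth_fun_continuous[OF \<phi>(1)]], rule supp_in_mult(1)[OF \<phi>(2)])
    have Qb: "sqrt (ball_sq R (flux i k)) \<le> 2 * ?S" for i k
    proof -
      have g: "ball_sq R (G i k) \<le> dirichlet"
        by (rule order_trans[OF ball_sq_le_integral[OF G_sq] dirichlet_ge])
      have "ball_sq R (flux i k) \<le> 2 * ball_sq R (G i k) + 2 * ball_sq R (\<lambda>x. U i x * U k x)"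
        unfolding flux_def[abs_def] by (rule ball_sq_diff[OF G2 UU])
      also have "\<dots> \<le> 4 * (dirichlet + ?Y)"
        using g ball_sq_UU[of R "2 * R" i k] R0 dirichlet_nonneg L4_mass_nonneg[of "2 * R"] by simp
      finally have "sqrt (ball_sq R (flux i k)) \<le> sqrt (4 * (dirichlet + ?Y))" by (rule real_sqrt_le_mono)
      also have "\<dots> = 2 * sqrt (dirichlet + ?Y)" by (simp only: real_sqrt_mult real_sqrt_four)
      also have "\<dots> \<le> 2 * ?S"
        using sqrt_add_le_add_sqrt[OF dirichlet_nonneg L4_mass_nonneg, of "2 * R"] by simp
      finally show ?thesis .
    qed
    have "(\<lambda>n. \<bar>\<Sum>i\<in>UNIV. \<Sum>k\<in>UNIV. \<integral>x. (?\<phi> x * flux i k x) * conv (moll_seq n) (G i k) x \<partial>lborel\<bar>)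
      \<longlonglongrightarrow> \<bar>\<Sum>i\<in>UNIV. \<Sum>k\<in>UNIV. \<integral>x. (?\<phi> x * flux i k x) * G i k x \<partial>lborel\<bar>"
      by (intro tendsto_rabs tendsto_sum moll_seq_integral_tendsto[of _ R] \<phi>f flux_L2 G2)
    then have "\<bar>\<Sum>i\<in>UNIV. \<Sum>k\<in>UNIV. \<integral>x. (?\<phi> x * flux i k x) * G i k x \<partial>lborel\<bar> \<le>
        (\<Sum>i\<in>UNIV. \<Sum>k\<in>UNIV. sqrt (ball_sq R (flux i k)) * sqrt (D / R\<^sup>2 * ?L))"
      using energy_step[OF C(2,3) C0 R] unfolding D_def by (intro LIMSEQ_le_const2) blast+
    also have "\<dots> \<le> (\<Sum>i\<in>(UNIV :: 3 set). \<Sum>k\<in>(UNIV :: 3 set). 2 * ?S * (sqrt D * ?T))"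
    proof (intro sum_mono)
      fix i k
      have "sqrt (D / R\<^sup>2 * ?L) = sqrt D * ?T"
        using R0 by (simp add: real_sqrt_mult real_sqrt_divide)
      moreover have "0 \<le> sqrt D * ?T" using D T0 by (intro mult_nonneg_nonneg) auto
      ultimately show "sqrt (ball_sq R (flux i k)) * sqrt (D / R\<^sup>2 * ?L) \<le> 2 * ?S * (sqrt D * ?T)"
        using mult_right_mono[OF Qb[of i k]] by (simp only:)
    qed
    also have "\<dots> = 18 * (sqrt D * ?T * ?S)" by simp
    finally have A: "\<bar>\<Sum>i\<in>UNIV. \<Sum>k\<in>UNIV. \<integral>x. (?\<phi> x * flux i k x) * G i k x \<partial>lborel\<bar> \<le> 18 * (sqrt D * ?T * ?S)" .
    let ?c = "\<lambda>i k. \<integral>x. G i k x * ((U k x * ?\<phi> x) * U i x) \<partial>lborel"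
    let ?d = "\<lambda>i k. \<integral>x. ((U i x * U k x) * partial_deriv k ?\<phi> x) * U i x \<partial>lborel"
    have split: "(\<integral>x. (?\<phi> x * flux i k x) * G i k x \<partial>lborel) = (\<integral>x. ?\<phi> x * (G i k x)\<^sup>2 \<partial>lborel) - ?c i k" for i k
    proof -
      have "(\<lambda>x. (?\<phi> x * flux i k x) * G i k x) = (\<lambda>x. G i k x * (?\<phi> x * G i k x) - G i k x * (?\<phi> x * (U i x * U k x)))"
        by (simp add: flux_def algebra_simps)
      then have "(\<integral>x. (?\<phi> x * flux i k x) * G i k x \<partial>lborel) =
          (\<integral>x. G i k x * (?\<phi> x * G i k x) \<partial>lborel) - (\<integral>x. G i k x * (?\<phi> x * (U i x * U k x)) \<partial>lborel)"
        using ball_Cauchy_Schwarz(1)[OF G2[of i k] \<phi>f[OF G2[of i k]]]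
          ball_Cauchy_Schwarz(1)[OF G2[of i k] \<phi>f[OF UU[of i k]]] by simp
      then show ?thesis by (simp add: power2_eq_square ac_simps)
    qed
    have dbound: "\<bar>?d i k\<bar> \<le> C * ?T * ?S" for i k
    proof -
      have m: "Lloc 2 (\<lambda>x. partial_deriv k ?\<phi> x * U i x)" "supp_in R (\<lambda>x. partial_deriv k ?\<phi> x * U i x)"
        by (rule Lloc_continuous_mult[OF U2 smooth_fun_continuous[OF d\<phi>(1)]], rule supp_in_mult(1)[OF d\<phi>(2)])
      have b1: "\<bar>partial_deriv k ?\<phi> x\<bar> \<le> C / R" for x
        unfolding cutoff_partial_deriv using C(2) R0 by (simp add: abs_divide divide_right_mono)
      have "\<bar>?d i k\<bar> = \<bar>\<integral>x. (U i x * U k x) * (partial_deriv k ?\<phi> x * U i x) \<partial>lborel\<bar>"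
        by (simp add: mult.assoc)
      also have "\<dots> \<le> sqrt (ball_sq R (\<lambda>x. U i x * U k x)) * sqrt (ball_sq R (\<lambda>x. partial_deriv k ?\<phi> x * U i x))"
        by (rule ball_Cauchy_Schwarz(2)[OF UU m])
      also have "\<dots> \<le> sqrt ?Y * sqrt ((C / R)\<^sup>2 * ?L)"
      proof (intro mult_mono real_sqrt_le_mono)
        show "ball_sq R (\<lambda>x. U i x * U k x) \<le> ?Y" using R0 by (intro ball_sq_UU) simp
        have "ball_sq R (\<lambda>x. partial_deriv k ?\<phi> x * U i x) \<le> (C / R)\<^sup>2 * ball_sq R (U i)"
          by (rule ball_sq_bounded_mult[OF U2 b1])
        also have "\<dots> \<le> (C / R)\<^sup>2 * ?L"
          using ball_sq_mono_radius[OF U2, of R "2 * R" i] L2_mass_ge[of "2 * R" i] R0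
          by (intro mult_left_mono) auto
        finally show "ball_sq R (\<lambda>x. partial_deriv k ?\<phi> x * U i x) \<le> (C / R)\<^sup>2 * ?L" .
      qed (auto simp: L4_mass_nonneg ball_sq_nonneg)
      also have "\<dots> = C * ?T * sqrt ?Y"
        using C(1) R0 by (simp add: real_sqrt_mult)
      also have "\<dots> \<le> C * ?T * ?S"
        using mult_nonneg_nonneg[OF C(1) T0] dirichlet_nonneg by (intro mult_left_mono) auto
      finally show ?thesis .
    qed
    have cd: "\<bar>\<Sum>i\<in>UNIV. \<Sum>k\<in>UNIV. ?c i k\<bar> \<le> 9 * (C * ?T * ?S)"
    proof -
      have "2 * (\<Sum>i\<in>UNIV. \<Sum>k\<in>UNIV. ?c i k) = (\<Sum>i\<in>UNIV. 2 * (\<Sum>k\<in>UNIV. ?c i k))"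
        by (simp only: sum_distrib_left)
      also have "\<dots> = - (\<Sum>i\<in>UNIV. \<Sum>k\<in>UNIV. ?d i k)"
        by (simp only: cubic_term[OF \<phi>] sum_negf)
      finally have "2 * \<bar>\<Sum>i\<in>UNIV. \<Sum>k\<in>UNIV. ?c i k\<bar> = \<bar>\<Sum>i\<in>UNIV. \<Sum>k\<in>UNIV. ?d i k\<bar>" by linarith
      also have "\<dots> \<le> (\<Sum>i\<in>UNIV. \<Sum>k\<in>UNIV. \<bar>?d i k\<bar>)"
        by (rule order_trans[OF sum_abs sum_mono[OF sum_abs]])
      also have "\<dots> \<le> (\<Sum>i\<in>(UNIV :: 3 set). \<Sum>k\<in>(UNIV :: 3 set). C * ?T * ?S)"
        by (intro sum_mono dbound)
      also have "\<dots> = 9 * (C * ?T * ?S)" by simp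
      finally show ?thesis by linarith
    qed
    have "(\<Sum>i\<in>UNIV. \<Sum>k\<in>UNIV. \<integral>x. ?\<phi> x * (G i k x)\<^sup>2 \<partial>lborel) =
        (\<Sum>i\<in>UNIV. \<Sum>k\<in>UNIV. \<integral>x. (?\<phi> x * flux i k x) * G i k x \<partial>lborel) + (\<Sum>i\<in>UNIV. \<Sum>k\<in>UNIV. ?c i k)"
      unfolding split by (simp add: sum_subtractf)
    also have "\<dots> \<le> 18 * (sqrt D * ?T * ?S) + 9 * (C * ?T * ?S)"
      using A cd by linarith
    also have "\<dots> = (18 * sqrt D + 9 * C) * ?T * ?S" by (simp only: algebra_simps)
    finally show "(\<Sum>i\<in>UNIV. \<Sum>k\<in>UNIV. \<integral>x. ?\<phi> x * (G i k x)\<^sup>2 \<partial>lborel) \<le> (18 * sqrt D + 9 * C) * ?T * ?S" .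
  qed
qed

text \<open>Cauchy--Schwarz against the constant 1 on the ball.\<close>

lemma L2_mass_le:
  assumes r: "r > 0"
  shows "L2_mass r \<le> 3 * (sqrt (L4_mass r) * sqrt (unit_vol * r ^ 3))"
proof -
  have "ball_sq r (U i) \<le> sqrt (L4_mass r) * sqrt (unit_vol * r ^ 3)" for i
  proof -
    have "ball_sq r (\<lambda>x. U i x * 1) \<le> sqrt (ball_sq r (\<lambda>x. (U i x)\<^sup>2)) * sqrt (ball_sq r (\<lambda>x :: real^3. 1\<^sup>2))"
      by (rule ball_sq_mult_le[OF U4 Lloc_continuous]) simp
    also have "\<dots> \<le> sqrt (L4_mass r) * sqrt (unit_vol * r ^ 3)"
      using ball_sq_const[OF r, of 1] L4_mass_ge[of r i] unit_vol_pos r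
      by (intro mult_mono) (auto simp: L4_mass_nonneg)
    finally show ?thesis by simp
  qed
  then have "L2_mass r \<le> (\<Sum>i\<in>(UNIV :: 3 set). sqrt (L4_mass r) * sqrt (unit_vol * r ^ 3))"
    unfolding L2_mass_def by (intro sum_mono)
  then show ?thesis by simp
qed

text \<open>With \<open>s = r\<^bsup>1/6\<^esup>\<close> and \<open>y\<close> the normalised \<open>L\<^sup>4\<close> mass, the right-hand side of \<open>energy_inequality\<close> is of order \<open>y\<^bsup>1/4\<^esup>\<close>, hence
the gradient vanishes. The same growth bound excludes a nonzero constant.\<close>

theorem flow_vanishes:
  assumes growth: "((\<lambda>r. L4_mass r / r powr (1/3)) \<longlongrightarrow> 0) at_top"
  shows "AE x in lborel. U i x = 0"
proof -
  \<comment> \<open>The powers of \<open>r\<^bsup>1/6\<^esup>\<close> below keep all exponents integral.\<close>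
  define y where "y r = L4_mass r / r powr (1/3)" for r
  define c where "c = 3 * sqrt unit_vol"
  have c: "c > 0" using unit_vol_pos by (simp add: c_def)
  have y: "(y \<longlongrightarrow> 0) at_top" using growth by (simp add: y_def[abs_def])
  have y0: "y r \<ge> 0" for r by (simp add: y_def L4_mass_nonneg)
  have s: "(r powr (1/6)) ^ 6 = r" "(r powr (1/6)) ^ 2 = r powr (1/3)" "r powr (1/6) \<ge> 1" if "r \<ge> 1" for r :: real
    using that by (simp_all add: powr_realpow[symmetric] powr_powr ge_one_powr_ge_zero)
  have Yy: "sqrt (L4_mass r) = r powr (1/6) * sqrt (y r)" if "r \<ge> 1" for r
  proof -
    have "L4_mass r = (r powr (1/6)) ^ 2 * y r" using that s(2)[OF that] by (simp add: y_def)
    then show ?thesis by (simp add: real_sqrt_mult)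
  qed
  have Lamy: "L2_mass r \<le> c * (r powr (1/6)) ^ 10 * sqrt (y r)" if r: "r \<ge> 1" for r
  proof -
    let ?s = "r powr (1/6)"
    have "r ^ 3 = (?s ^ 6) ^ 3" by (simp only: s(1)[OF r])
    also have "\<dots> = (?s ^ 9)\<^sup>2" by (simp flip: power_mult)
    finally have "r ^ 3 = (?s ^ 9)\<^sup>2" .
    then have r3: "sqrt (r ^ 3) = ?s ^ 9" by (intro real_sqrt_unique) simp_all
    have "L2_mass r \<le> 3 * (sqrt (L4_mass r) * sqrt (unit_vol * r ^ 3))" using r by (intro L2_mass_le) simp
    also have "\<dots> = 3 * ((?s * sqrt (y r)) * (sqrt unit_vol * ?s ^ 9))"
      by (simp only: Yy[OF r] real_sqrt_mult r3)
    also have "\<dots> = c * ?s ^ 10 * sqrt (y r)"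
      by (simp add: c_def eval_nat_numeral)
    finally show ?thesis .
  qed
  have G0: "AE x in lborel. G i k x = 0" for i k
  proof (rule AE_zero_of_ball_sq[OF G2])
    fix \<rho> :: real
    obtain K where K: "K \<ge> 0" "\<And>R. R \<ge> 1 \<Longrightarrow> (\<Sum>i\<in>UNIV. \<Sum>k\<in>UNIV. \<integral>x. cutoff R x * (G i k x)\<^sup>2 \<partial>lborel)
      \<le> K * (sqrt (L2_mass (2 * R)) / R) * (sqrt dirichlet + sqrt (L4_mass (2 * R)))"
      by (rule energy_inequality) blast
    let ?B = "\<lambda>r. K * (2 * sqrt c * sqrt (sqrt (y r))) * (sqrt dirichlet + sqrt (y r))"
    have B: "K * (sqrt (L2_mass r) / (r / 2)) * (sqrt dirichlet + sqrt (L4_mass r)) \<le> ?B r" if r: "r \<ge> 1" for r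
    proof -
      let ?s = "r powr (1/6)"
      note s1 = s(3)[OF r]
      have "sqrt (L2_mass r) \<le> sqrt (c * (?s ^ 5)\<^sup>2 * sqrt (y r))"
        using Lamy[OF r] by (intro real_sqrt_le_mono) (simp flip: power_mult)
      also have "\<dots> = sqrt c * ?s ^ 5 * sqrt (sqrt (y r))"
      proof -
        have "sqrt ((?s ^ 5)\<^sup>2) = ?s ^ 5" by (rule real_sqrt_unique) simp_all
        then show ?thesis by (simp only: real_sqrt_mult)
      qed
      finally have 1: "sqrt (L2_mass r) \<le> sqrt c * ?s ^ 5 * sqrt (sqrt (y r))" .
      have 2: "sqrt dirichlet + sqrt (L4_mass r) \<le> ?s * (sqrt dirichlet + sqrt (y r))"
        unfolding Yy[OF r] using mult_right_mono[OF s1, of "sqrt dirichlet"] dirichlet_nonneg by (simp add: distrib_left)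
      have "sqrt (L2_mass r) * (sqrt dirichlet + sqrt (L4_mass r)) \<le>
          (sqrt c * ?s ^ 5 * sqrt (sqrt (y r))) * (?s * (sqrt dirichlet + sqrt (y r)))"
        using 1 2 c y0[of r] s1 by (intro mult_mono) (auto simp: dirichlet_nonneg L4_mass_nonneg L2_mass_nonneg)
      also have "\<dots> = ?s ^ 6 * (sqrt c * sqrt (sqrt (y r)) * (sqrt dirichlet + sqrt (y r)))"
        by (simp add: eval_nat_numeral)
      also have "\<dots> = r * (sqrt c * sqrt (sqrt (y r)) * (sqrt dirichlet + sqrt (y r)))"
        by (simp only: s(1)[OF r])
      finally have le: "sqrt (L2_mass r) * (sqrt dirichlet + sqrt (L4_mass r)) / r \<le> sqrt c * sqrt (sqrt (y r)) * (sqrt dirichlet + sqrt (y r))"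
        using r by (simp add: divide_le_eq mult.commute)
      have "K * (l / (r / 2)) * m = (2 * K) * (l * m / r)" for l m
        using r by (simp add: field_simps)
      then have "K * (sqrt (L2_mass r) / (r / 2)) * (sqrt dirichlet + sqrt (L4_mass r)) =
          (2 * K) * (sqrt (L2_mass r) * (sqrt dirichlet + sqrt (L4_mass r)) / r)" .
      also have "\<dots> \<le> (2 * K) * (sqrt c * sqrt (sqrt (y r)) * (sqrt dirichlet + sqrt (y r)))"
        using K(1) by (intro mult_left_mono le) simp
      also have "\<dots> = ?B r" by (simp only: mult_ac)
      finally show ?thesis .
    qed
    \<comment> \<open>A lower bound of the cutoff on half of its ball.\<close>
    define b where "b = flat 0 (3/4)"
    have b: "b > 0" by (simp add: b_def flat_def)
    have "b * ball_sq \<rho> (G i k) \<le> ?B r" if r: "r \<ge> max 2 (4 * \<rho>)" for r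
    proof -
      let ?R = "r / 2"
      have R: "?R \<ge> 1" "\<rho> \<le> ?R / 2" using r by auto
      have int: "integrable lborel (\<lambda>x. cutoff ?R x * (G i k x)\<^sup>2)" for i k
      proof (rule Bochner_Integration.integrable_bound[OF G_sq])
        have [measurable]: "cutoff ?R \<in> borel_measurable borel"
          by (rule continuous_borel[OF smooth_fun_continuous[OF cutoff_smooth]])
        note [measurable] = G_borel[of i k]
        show "(\<lambda>x. cutoff ?R x * (G i k x)\<^sup>2) \<in> borel_measurable lborel" by measurable
        show "AE x in lborel. norm (cutoff ?R x * (G i k x)\<^sup>2) \<le> norm ((G i k x)\<^sup>2)"
        proof (rule AE_I2)
          fix x
          show "norm (cutoff ?R x * (G i k x)\<^sup>2) \<le> norm ((G i k x)\<^sup>2)"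
            using bump_nonneg[of "x /\<^sub>R ?R"] bump_le_1[of "x /\<^sub>R ?R"]
              mult_right_mono[of "bump (x /\<^sub>R ?R)" 1 "(G i k x)\<^sup>2"]
            by (simp add: cutoff_def abs_mult)
        qed
      qed
      have nn: "0 \<le> (\<integral>x. cutoff ?R x * (G i k x)\<^sup>2 \<partial>lborel)" for i k
        by (intro Bochner_Integration.integral_nonneg) (simp add: cutoff_def bump_nonneg)
      have "b * ball_sq \<rho> (G i k) = (\<integral>x. b * (indicator (cball 0 \<rho>) x * (G i k x)\<^sup>2) \<partial>lborel)"
        by (simp add: ball_sq_def)
      also have "\<dots> \<le> (\<integral>x. cutoff ?R x * (G i k x)\<^sup>2 \<partial>lborel)"
      proof (rule integral_mono'[OF int])
        fix x
        show "b * (indicator (cball 0 \<rho>) x * (G i k x)\<^sup>2) \<le> cutoff ?R x * (G i k x)\<^sup>2"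
        proof (cases "x \<in> cball 0 \<rho>")
          case True
          let ?z = "x /\<^sub>R ?R"
          have *: "3 / 4 \<le> 1 - z \<bullet> z" if "norm z \<le> 1 / 2" for z :: "real^3"
            using power_mono[OF that norm_ge_zero, of 2] power2_norm_eq_inner[of z]
            by (simp add: power_divide)
          have z: "3 / 4 \<le> 1 - ?z \<bullet> ?z"
            by (rule *) (use True R in \<open>simp add: field_simps\<close>)
          then have "b \<le> bump ?z"
            using flat_mono[OF z] by (simp only: b_def bump_def)
          then show ?thesis using True by (simp add: cutoff_def mult_right_mono)
        next
          case False
          then show ?thesis by (simp add: cutoff_def bump_nonneg)
        qed
        show "0 \<le> cutoff ?R x * (G i k x)\<^sup>2" by (simp add: cutoff_def bump_nonneg)
      qed
      also have "\<dots> \<le> (\<Sum>k\<in>UNIV. \<integral>x. cutoff ?R x * (G i k x)\<^sup>2 \<partial>lborel)"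
        by (rule member_le_sum) (use nn in auto)
      also have "\<dots> \<le> (\<Sum>i\<in>UNIV. \<Sum>k\<in>UNIV. \<integral>x. cutoff ?R x * (G i k x)\<^sup>2 \<partial>lborel)"
        by (rule member_le_sum[of i UNIV "\<lambda>i. \<Sum>k\<in>UNIV. \<integral>x. cutoff ?R x * (G i k x)\<^sup>2 \<partial>lborel"])
          (use nn in \<open>auto intro: sum_nonneg\<close>)
      also have "\<dots> \<le> ?B r"
        using K(2)[OF R(1)] B[of r] r by simp
      finally show ?thesis .
    qed
    then have "eventually (\<lambda>r. b * ball_sq \<rho> (G i k) \<le> ?B r) at_top"
      by (intro eventually_mono[OF eventually_ge_at_top[of "max 2 (4 * \<rho>)"]])
    moreover have "(?B \<longlongrightarrow> 0) at_top"
      by (rule tendsto_eq_intros refl y | simp)+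
    ultimately have "b * ball_sq \<rho> (G i k) \<le> 0"
      by (intro tendsto_lowerbound[of ?B 0 at_top]) auto
    then show "ball_sq \<rho> (G i k) = 0"
      using b ball_sq_nonneg[of \<rho> "G i k"] by (simp add: mult_le_0_iff)
  qed
  have conv0: "conv (moll_seq n) (U i) x = 0" for n x
  proof -
    let ?u = "conv (moll_seq n) (U i)"
    have su: "smooth_fun ?u" by (rule moll_seq_conv_smooth[OF U1])
    have "partial_deriv k ?u = (\<lambda>x. 0)" for k
    proof
      fix x
      have "conv (moll_seq n) (G i k) x = (\<integral>y. 0 \<partial>(lborel :: (real^3) measure))"
        unfolding conv_def
      proof (rule integral_cong_AE)
        have [measurable]: "moll_seq n \<in> borel_measurable borel"
          by (rule continuous_borel[OF smooth_fun_continuous[OF moll_seq_smooth]])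
        note [measurable] = G_borel[of i k]
        show "(\<lambda>y. moll_seq n (x - y) * G i k y) \<in> borel_measurable lborel" by measurable
        show "AE y in lborel. moll_seq n (x - y) * G i k y = 0"
          using G0[of i k] by eventually_elim simp
      qed simp
      then show "partial_deriv k ?u x = 0" by (simp add: partial_deriv_mollified)
    qed
    then have "(?u has_derivative (\<lambda>h. 0)) (at x within UNIV)" for x
      using smooth_fun_has_derivative[OF su, of x] by simp
    then obtain a where a: "\<And>x. ?u x = a"
      using has_derivative_zero_constant[of UNIV ?u] by auto
    have "a\<^sup>2 * unit_vol \<le> 8 * c * sqrt (y r)" if r: "r \<ge> 2" for r
    proof -
      let ?r = "r / 2"
      have r1: "?r \<ge> 1" "?r > 0" "r \<ge> 1" using r by auto
      note K = prob_kernelD[OF moll_seq_kernel[of n]]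
      have "a\<^sup>2 * (unit_vol * ?r ^ 3) = ball_sq ?r ?u"
      proof -
        have "?u = (\<lambda>x. a)" using a by blast
        then show ?thesis by (simp only: ball_sq_const[OF r1(2)])
      qed
      also have "\<dots> \<le> ball_sq (?r + inverse (real (Suc n))) (U i)"
        using Young_L2_local[OF K(1,4) U2, of ?r i] by (simp add: K(5))
      also have "\<dots> \<le> ball_sq r (U i)"
      proof (rule ball_sq_mono_radius[OF U2])
        have "inverse (real (Suc n)) \<le> 1" by (simp add: inverse_le_1_iff)
        then show "?r + inverse (real (Suc n)) \<le> r" using r1 by simp
      qed
      also have "\<dots> \<le> L2_mass r" by (rule L2_mass_ge)
      also have "\<dots> \<le> c * (r powr (1/6)) ^ 10 * sqrt (y r)" by (rule Lamy[OF r1(3)])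
      also have "\<dots> \<le> c * (r powr (1/6)) ^ 18 * sqrt (y r)"
        using c y0[of r] s(3)[OF r1(3)] by (intro mult_left_mono mult_right_mono power_increasing) auto
      also have "(r powr (1/6)) ^ 18 = r ^ 3"
        using s(1)[OF r1(3)] power_mult[of "r powr (1/6)" 6 3] by simp
      finally have "r ^ 3 * (a\<^sup>2 * unit_vol) \<le> r ^ 3 * (8 * c * sqrt (y r))"
        by (simp add: power_divide ac_simps)
      then show ?thesis using r1 by (simp add: mult_le_cancel_left)
    qed
    then have "eventually (\<lambda>r. a\<^sup>2 * unit_vol \<le> 8 * c * sqrt (y r)) at_top"
      by (intro eventually_mono[OF eventually_ge_at_top[of 2]])
    moreover have "((\<lambda>r. 8 * c * sqrt (y r)) \<longlongrightarrow> 0) at_top"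
      by (rule tendsto_eq_intros refl y | simp)+
    ultimately have "a\<^sup>2 * unit_vol \<le> 0"
      by (intro tendsto_lowerbound[of "\<lambda>r. 8 * c * sqrt (y r)" 0 at_top]) auto
    then have "a = 0" using unit_vol_pos by (simp add: mult_le_0_iff)
    then show ?thesis using a by simp
  qed
  show ?thesis
  proof (rule AE_zero_of_ball_sq[OF U2])
    fix r
    have "(\<lambda>n. ball_sq r (\<lambda>x. conv (moll_seq n) (U i) x - U i x)) \<longlonglongrightarrow> 0"
      by (rule moll_seq_ball_sq_tendsto[OF U2])
    then show "ball_sq r (U i) = 0"
      by (simp add: conv0 ball_sq_def LIMSEQ_const_iff)
  qed
qed

end

section \<open>Distributions, almost everywhere identities and growth\<close>

text \<open>The mollifications of \<open>f\<close> are integrals against test functions, hence vanish, and they converge to \<open>f\<close> locally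
in \<open>L\<^sup>1\<close>.\<close>

lemma fundamental_lemma_of_variations:
  fixes f :: "real^3 \<Rightarrow> real"
  assumes f: "Lloc 1 f"
    and z: "\<And>\<phi> r. smooth_fun \<phi> \<Longrightarrow> supp_in r \<phi> \<Longrightarrow> (\<integral>x. f x * \<phi> x \<partial>lborel) = 0"
  shows "AE x in lborel. f x = 0"
proof -
  have "conv (moll_seq n) f x = 0" for n x
  proof -
    have "(\<integral>y. f y * moll_seq n (x - y) \<partial>lborel) = 0"
      by (rule z[OF smooth_fun_reflect[OF moll_seq_smooth] supp_in_reflect[OF prob_kernelD(4)[OF moll_seq_kernel]]])
    then show ?thesis by (simp add: conv_def mult.commute)
  qed
  then have "(\<integral>x. indicator (cball 0 r) x * \<bar>f x\<bar> \<partial>lborel) = 0" for r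
    using moll_seq_tendsto[of 0 f r] f by (simp add: LIMSEQ_const_iff)
  moreover have "integrable lborel (\<lambda>x. indicator (cball 0 r) x * \<bar>f x\<bar>)" for r
    using Lloc_integrable[OF f] by simp
  ultimately have "AE x in lborel. indicator (cball 0 (real n)) x * \<bar>f x\<bar> = 0" for n
    by (intro iffD1[OF integral_nonneg_eq_0_iff_AE]) auto
  then have "AE x in lborel. \<bar>f x\<bar> = 0" by (rule AE_zero_of_balls)
  then show ?thesis by simp
qed

lemma AE_lebesgue_iff: "(AE x in lebesgue. P x) \<longleftrightarrow> (AE x in lborel. P x)"
  by (rule AE_completion_iff)

lemma integral_lebesgue_lborel:
  fixes f g :: "'a::euclidean_space \<Rightarrow> real"
  assumes "f \<in> borel_measurable lebesgue" "g \<in> borel_measurable borel" "AE x in lborel. f x = g x"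
  shows "(\<integral>x. f x \<partial>lebesgue) = (\<integral>x. g x \<partial>lborel)"
    and "integrable lebesgue f \<longleftrightarrow> integrable lborel g"
proof -
  have g: "g \<in> borel_measurable lborel" "g \<in> borel_measurable lebesgue"
    using assms(2) by (auto intro: measurable_completion)
  have ae: "AE x in lebesgue. f x = g x" using assms(3) by (simp add: AE_lebesgue_iff)
  show "(\<integral>x. f x \<partial>lebesgue) = (\<integral>x. g x \<partial>lborel)"
    using integral_cong_AE[OF assms(1) g(2) ae] integral_completion[OF g(1)] by simp
  show "integrable lebesgue f \<longleftrightarrow> integrable lborel g"
    using integrable_cong_AE[OF assms(1) g(2) ae] integrable_completion[OF g(1)] by simp
qed

lemma regular_dist_lborel:
  assumes "f \<in> borel_measurable lebesgue" "g \<in> borel_measurable borel" "AE x in lborel. f x = g x"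
    and "smooth_fun \<phi>"
  shows "regular_dist f \<phi> = (\<integral>x. g x * \<phi> x \<partial>lborel)"
proof -
  have \<phi>: "\<phi> \<in> borel_measurable borel"
    by (rule continuous_borel[OF smooth_fun_continuous[OF assms(4)]])
  then have [measurable]: "\<phi> \<in> borel_measurable lebesgue" by (auto intro: measurable_completion)
  note [measurable] = assms(1,2) \<phi>
  show ?thesis unfolding regular_dist_def
  proof (rule integral_lebesgue_lborel(1))
    show "AE x in lborel. f x * \<phi> x = g x * \<phi> x" using assms(3) by eventually_elim simp
  qed measurable
qed

lemma locally_integrable_Lloc:
  assumes f: "locally_integrable f" and g: "g \<in> borel_measurable borel" "AE x in lborel. f x = g x"
  shows "Lloc 1 g"
  unfolding Lloc_def
proof (intro conjI allI g(1))
  fix r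
  have fm: "f \<in> borel_measurable lebesgue"
    and "set_integrable lebesgue (cball 0 r) f" using f by (auto simp: locally_integrable_def)
  then have int: "integrable lebesgue (\<lambda>x. indicator (cball 0 r) x * f x)"
    by (simp add: set_integrable_def)
  note [measurable] = g(1)
  have "integrable lborel (\<lambda>x. indicator (cball 0 r) x * g x)"
  proof (rule iffD1[OF integral_lebesgue_lborel(2) int])
    show "AE x in lborel. indicator (cball 0 r) x * f x = indicator (cball 0 r) x * g x"
      using g(2) by eventually_elim simp
    show "(\<lambda>x. indicator (cball 0 r) x * f x) \<in> borel_measurable lebesgue"
      using int by (rule borel_measurable_integrable)
  qed measurable
  from integrable_abs[OF this]
  show "integrable lborel (\<lambda>x. indicator (cball 0 r) x * \<bar>g x\<bar> ^ 1)" by (simp add: abs_mult)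
qed

lemma distribution_sum:
  assumes T: "distribution T" and f: "\<And>j. j \<in> S \<Longrightarrow> f j \<in> test_functions"
  shows "T (\<lambda>x. \<Sum>j\<in>S. f j x) = (\<Sum>j\<in>S. T (f j))"
proof -
  have z: "(\<lambda>x. 0) \<in> test_functions"
    by (rule test_functionsI[OF smooth_fun_const, of 0 0]) (simp add: supp_in_def)
  have add: "T (\<lambda>x. \<phi> x + \<psi> x) = T \<phi> + T \<psi>" if "\<phi> \<in> test_functions" "\<psi> \<in> test_functions" for \<phi> \<psi>
    using T that by (simp add: distribution_def)
  have T0: "T (\<lambda>x. 0) = 0" using add[OF z z] by simp
  have mem: "(\<lambda>x. \<phi> x + \<psi> x) \<in> test_functions" if "\<phi> \<in> test_functions" "\<psi> \<in> test_functions" for \<phi> \<psi> :: "real^'a \<Rightarrow> real"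
  proof -
    obtain r s where "smooth_fun \<phi>" "supp_in r \<phi>" "smooth_fun \<psi>" "supp_in s \<psi>"
      using \<open>\<phi> \<in> test_functions\<close> \<open>\<psi> \<in> test_functions\<close> by (auto simp: test_functions_iff)
    then show ?thesis
      by (intro test_functionsI[of _ "max r s"] smooth_fun_add) (auto simp: supp_in_def)
  qed
  have "T (\<lambda>x. \<Sum>j\<in>S. f j x) = (\<Sum>j\<in>S. T (f j)) \<and> (\<lambda>x. \<Sum>j\<in>S. f j x) \<in> test_functions"
    using f
  proof (induction S rule: infinite_finite_induct)
    case (insert a S)
    then show ?case using add[of "f a" "\<lambda>x. \<Sum>j\<in>S. f j x"] mem[of "f a" "\<lambda>x. \<Sum>j\<in>S. f j x"]
      by simp
  qed (use T0 z in auto)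
  then show ?thesis by blast
qed

lemma powr_power_eq: "0 < r \<Longrightarrow> (r powr a) ^ n = r powr (a * real n)" for r :: real
  by (subst powr_realpow[symmetric]) (auto simp: powr_powr)

text \<open>Each summand on the right dominates in one of three regimes. For \<open>a < exp (- \<rho>)\<close> it is the last one. Otherwise
the extra exponent \<open>c / \<rho>\<close> costs at most the factor \<open>exp c\<close>, and the first or the second one dominates according to
whether \<open>K a\<^bsup>1/2\<^esup>\<close> is above or below \<open>r\<^bsup>-1/3\<^esup>\<close>; this is Young's inequality with exponents 9/8 and 9.\<close>

lemma pointwise_growth_bound:
  fixes a :: real
  assumes a: "a \<ge> 0" and c: "c \<ge> 0" and K: "K > 0" and r: "r > 0" and \<rho>: "\<rho> > 0"
  shows "a ^ 4 / r powr (1/3) \<le>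
    K * exp c * a powr (9/2 + c / \<rho>) + 1 / (K ^ 8 * r ^ 3) + exp (- 4 * \<rho>) / r powr (1/3)"
proof -
  let ?R = "r powr (1/3)"
  have R: "?R > 0" using r by simp
  have R9: "?R ^ 9 = r ^ 3" using r by (subst powr_power_eq) auto
  have t1: "0 \<le> K * exp c * a powr (9/2 + c / \<rho>)" using K by simp
  have t2: "0 \<le> 1 / (K ^ 8 * r ^ 3)" using K r by simp
  have t3: "0 \<le> exp (- 4 * \<rho>) / ?R" using R by simp
  consider "a < exp (- \<rho>)" | "a \<ge> exp (- \<rho>)" "1 / ?R \<le> K * sqrt a" | "K * sqrt a \<le> 1 / ?R"
    by linarith
  then show ?thesis
  proof cases
    case 1
    have "a ^ 4 \<le> exp (- \<rho>) ^ 4" using 1 a by (intro power_mono) auto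
    also have "\<dots> = exp (- 4 * \<rho>)" by (simp add: exp_of_nat_mult[symmetric])
    finally have "a ^ 4 / ?R \<le> exp (- 4 * \<rho>) / ?R" using R by (intro divide_right_mono) auto
    then show ?thesis using t1 t2 by linarith
  next
    case 2
    have a0: "a > 0" using 2(1) exp_gt_zero[of "- \<rho>"] by linarith
    have "a powr (- (c / \<rho>)) \<le> exp (- \<rho>) powr (- (c / \<rho>))"
      using 2(1) c \<rho> by (intro powr_mono2') auto
    also have "\<dots> = exp c" using \<rho> by (simp add: powr_def)
    finally have e: "a powr (- (c / \<rho>)) \<le> exp c" .
    have "a ^ 4 * sqrt a = a powr 4 * a powr (1/2)"
      using a0 by (simp add: powr_half_sqrt)
    also have "\<dots> = a powr (9/2)" by (simp add: powr_add[symmetric])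
    also have "\<dots> = a powr (9/2 + c / \<rho>) * a powr (- (c / \<rho>))" by (simp add: powr_add[symmetric])
    also have "\<dots> \<le> a powr (9/2 + c / \<rho>) * exp c" by (intro mult_left_mono e) simp
    finally have m: "a ^ 4 * sqrt a \<le> exp c * a powr (9/2 + c / \<rho>)" by (simp add: mult.commute)
    have "a ^ 4 / ?R = a ^ 4 * (1 / ?R)" by simp
    also have "\<dots> \<le> a ^ 4 * (K * sqrt a)" using 2(2) a by (intro mult_left_mono) auto
    also have "\<dots> = K * (a ^ 4 * sqrt a)" by simp
    also have "\<dots> \<le> K * (exp c * a powr (9/2 + c / \<rho>))" using m K by (intro mult_left_mono) auto
    also have "\<dots> = K * exp c * a powr (9/2 + c / \<rho>)" by (simp only: mult.assoc)
    finally show ?thesis using t2 t3 by linarith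
  next
    case 3
    have "(K * sqrt a) ^ 8 \<le> (1 / ?R) ^ 8" using 3 K a by (intro power_mono) auto
    moreover have "sqrt a ^ 8 = a ^ 4"
      using a power_mult[of "sqrt a" 2 4] by simp
    ultimately have "K ^ 8 * a ^ 4 \<le> 1 / ?R ^ 8" by (simp add: power_mult_distrib power_one_over)
    then have "a ^ 4 \<le> 1 / (K ^ 8 * ?R ^ 8)" using K R by (simp add: field_simps)
    then have "a ^ 4 / ?R \<le> 1 / (K ^ 8 * ?R ^ 8) / ?R" using R by (intro divide_right_mono) auto
    also have "\<dots> = 1 / (K ^ 8 * r ^ 3)" unfolding R9[symmetric] by (simp add: eval_nat_numeral)
    finally show ?thesis using t1 t3 by linarith
  qed
qed

text \<open>Integrate \<open>pointwise_growth_bound\<close> over the ball of radius \<open>r\<close> outside a fixed ball. The second summand contributes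
a multiple of \<open>K\<^bsup>-8\<^esup>\<close>, because the volume is proportional to \<open>r\<^sup>3\<close>; the first is small by the finiteness of the modular
once the fixed ball is large. So \<open>K\<close> is chosen first, then the fixed ball, then \<open>r\<close>.\<close>

lemma fourth_power_growth:
  fixes v :: "real^3 \<Rightarrow> real"
  assumes v: "Lloc 4 v" "\<And>x. 0 \<le> v x" and R0: "R0 > 0"
    and m: "integrable lborel (\<lambda>x. indicator {x. R0 \<le> norm x} x * v x powr (9/2 + eps_bar R0 x))"
  shows "((\<lambda>r. ball_sq r (\<lambda>x. (v x)\<^sup>2) / r powr (1/3)) \<longlongrightarrow> 0) at_top"
proof -
  define c where "c = 3/2 * R0"
  have c: "c \<ge> 0" using R0 by (simp add: c_def)
  define w where "w x = v x powr (9/2 + eps_bar R0 x)" for x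
  note [measurable] = Lloc_measurable[OF v(1)]
  have [measurable]: "w \<in> borel_measurable borel"
    unfolding w_def[abs_def] eps_bar_def by measurable
  have w0: "w x \<ge> 0" for x by (simp add: w_def)
  define \<Omega> where "\<Omega> M = {x :: real^3. M \<le> norm x}" for M
  have [measurable]: "\<Omega> M \<in> sets borel" for M unfolding \<Omega>_def by measurable
  have m': "integrable lborel (\<lambda>x. indicator (\<Omega> R0) x * w x)"
    using m by (simp add: \<Omega>_def w_def)
  define T where "T n = (\<integral>x. indicator (\<Omega> (real n)) x * w x \<partial>lborel)" for n
  have int: "integrable lborel (\<lambda>x. indicator (\<Omega> M) x * w x)" if "M \<ge> R0" for M
    by (rule Bochner_Integration.integrable_bound[OF m'])
      (use that w0 in \<open>auto simp: indicator_def \<Omega>_def\<close>)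
  obtain n0 where n0: "R0 \<le> real n0" using real_arch_simple by blast
  have "(\<lambda>n. T (n + n0)) \<longlonglongrightarrow> (\<integral>x. 0 \<partial>(lborel :: (real^3) measure))"
    unfolding T_def
  proof (rule integral_dominated_convergence[OF _ _ m'])
    show "AE x in lborel. (\<lambda>n. indicator (\<Omega> (real (n + n0))) x * w x) \<longlonglongrightarrow> 0"
    proof (rule AE_I2)
      fix x :: "real^3"
      obtain N where N: "norm x < real N" using reals_Archimedean2 by blast
      have "eventually (\<lambda>n. indicator (\<Omega> (real (n + n0))) x * w x = 0) sequentially"
        using eventually_ge_at_top[of N]
      proof eventually_elim
        case (elim n)
        then have "norm x < real (n + n0)" using N by simp
        then show ?case by (simp add: \<Omega>_def)
      qed
      then show "(\<lambda>n. indicator (\<Omega> (real (n + n0))) x * w x) \<longlonglongrightarrow> 0" by (rule tendsto_eventually)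
    qed
    show "AE x in lborel. norm (indicator (\<Omega> (real (n + n0))) x * w x) \<le> indicator (\<Omega> R0) x * w x" for n
      using w0 n0 by (intro AE_I2) (auto simp: indicator_def \<Omega>_def)
  qed simp_all
  then have T: "T \<longlonglongrightarrow> 0" using LIMSEQ_offset[of T n0 0] by simp
  let ?f = "\<lambda>x. ((v x)\<^sup>2)\<^sup>2"
  have fint: "integrable lborel (\<lambda>x. indicator (cball 0 r) x * ?f x)" for r
    using Lloc_integrable[OF v(1), of r] v(2) by (simp flip: power_mult)
  \<comment> \<open>The decaying term is split at the radius \<open>r\<^bsup>1/12\<^esup>\<close>: inside, the volume \<open>r\<^bsup>1/4\<^esup>\<close> is smaller than \<open>r\<^bsup>1/3\<^esup>\<close>; outside, the
exponential is negligible.\<close>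
  have bound: "ball_sq r (\<lambda>x. (v x)\<^sup>2) / r powr (1/3) \<le>
      ball_sq M (\<lambda>x. (v x)\<^sup>2) / r powr (1/3) + K * exp c * T n + unit_vol / K ^ 8 +
      unit_vol * (r powr (1/4) / r powr (1/3) + r ^ 3 * exp (- 4 * r powr (1/12)) / r powr (1/3))"
    if M: "M = real n" "M \<ge> R0" and K: "K > 0" and r: "r \<ge> 1" for M n K r
  proof -
    let ?q = "r powr (1/3)" and ?\<rho> = "r powr (1/12)"
    have q: "?q > 0" using r by simp
    have \<rho>: "?\<rho> > 0" using r by simp
    let ?i = "\<lambda>s. indicat_real (cball (0 :: real^3) s)"
    let ?g = "\<lambda>x. (?i M x * ?f x) / ?q + K * exp c * (indicator (\<Omega> M) x * w x) + ?i r x * (1 / (K ^ 8 * r ^ 3))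
      + (?i ?\<rho> x * (1 / ?q) + ?i r x * (exp (- 4 * ?\<rho>) / ?q))"
    have pw: "(?i r x * ?f x) / ?q \<le> ?g x" for x
    proof (cases "x \<in> cball 0 r \<and> norm x > M")
      case False
      have t: "0 \<le> K * exp c * (indicator (\<Omega> M) x * w x)" "0 \<le> ?i r x * (1 / (K ^ 8 * r ^ 3))"
        "0 \<le> ?i ?\<rho> x * (1 / ?q)" "0 \<le> ?i r x * (exp (- 4 * ?\<rho>) / ?q)"
        using K r w0[of x] by simp_all
      have "(?i r x * ?f x) / ?q \<le> (?i M x * ?f x) / ?q"
        using False q by (intro divide_right_mono mult_right_mono) (auto simp: indicator_def)
      then show ?thesis using t by linarith
    next
      case True
      then have x: "norm x > 0" "norm x \<ge> M" "x \<in> cball 0 r" using M R0 by auto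
      have "?f x / ?q = v x ^ 4 / ?q" by (simp flip: power_mult)
      also have "\<dots> \<le> K * exp c * v x powr (9/2 + c / norm x) + 1 / (K ^ 8 * r ^ 3) + exp (- 4 * norm x) / ?q"
        using r by (intro pointwise_growth_bound v c K x) auto
      also have "v x powr (9/2 + c / norm x) = w x"
        by (simp add: w_def eps_bar_def c_def)
      finally have 1: "?f x / ?q \<le> K * exp c * w x + 1 / (K ^ 8 * r ^ 3) + exp (- 4 * norm x) / ?q" .
      have 2: "exp (- 4 * norm x) / ?q \<le> ?i ?\<rho> x * (1 / ?q) + ?i r x * (exp (- 4 * ?\<rho>) / ?q)"
      proof (cases "norm x \<le> ?\<rho>")
        case True
        have "exp (- 4 * norm x) / ?q \<le> 1 / ?q" using q by (intro divide_right_mono) auto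
        moreover have "0 \<le> exp (- 4 * ?\<rho>) / ?q" using q by simp
        moreover have "?i ?\<rho> x = 1" "?i r x = 1" using True x by auto
        ultimately show ?thesis by (simp only: mult_1)
      next
        case False
        then have "exp (- 4 * norm x) / ?q \<le> exp (- 4 * ?\<rho>) / ?q"
          using q by (intro divide_right_mono) auto
        then show ?thesis using False x by simp
      qed
      have 3: "0 \<le> (?i M x * ?f x) / ?q" using q by simp
      have i: "indicator (\<Omega> M) x = (1 :: real)" "?i r x = 1" using x by (auto simp: \<Omega>_def)
      show ?thesis unfolding i mult_1 using 1 2[unfolded i mult_1] 3 by linarith
    qed
    have I: "integrable lborel (\<lambda>x. ?i s x * k)" for s k
      by (intro integrable_mult_left integrable_indicator_cball)
    have vol: "(\<integral>x. ?i s x * k \<partial>lborel) = unit_vol * s ^ 3 * k" if "s > 0" for s k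
      using ball_sq_const[OF that, of 1] by (simp add: ball_sq_def)
    note parts = integrable_divide[OF fint[of M], of ?q] integrable_mult_right[OF int[OF M(2)], of "K * exp c"]
    have gint: "integrable lborel ?g"
      by (intro Bochner_Integration.integrable_add parts I)
    have "ball_sq r (\<lambda>x. (v x)\<^sup>2) / ?q = (\<integral>x. (?i r x * ?f x) / ?q \<partial>lborel)"
      by (simp add: ball_sq_def)
    also have "\<dots> \<le> (\<integral>x. ?g x \<partial>lborel)"
      by (rule integral_mono[OF integrable_divide[OF fint] gint pw])
    also have "\<dots> = ball_sq M (\<lambda>x. (v x)\<^sup>2) / ?q + K * exp c * T n + unit_vol * r ^ 3 * (1 / (K ^ 8 * r ^ 3))
      + (unit_vol * ?\<rho> ^ 3 * (1 / ?q) + unit_vol * r ^ 3 * (exp (- 4 * ?\<rho>) / ?q))"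
    proof -
      have e1: "(\<integral>x. (?i M x * ?f x) / ?q \<partial>lborel) = ball_sq M (\<lambda>x. (v x)\<^sup>2) / ?q"
        by (simp add: ball_sq_def)
      have e2: "(\<integral>x. K * exp c * (indicator (\<Omega> M) x * w x) \<partial>lborel) = K * exp c * T n"
        by (simp add: T_def M(1))
      note add = Bochner_Integration.integral_add Bochner_Integration.integrable_add
      have "(\<integral>x. ?g x \<partial>lborel) = (\<integral>x. (?i M x * ?f x) / ?q \<partial>lborel)
        + (\<integral>x. K * exp c * (indicator (\<Omega> M) x * w x) \<partial>lborel) + (\<integral>x. ?i r x * (1 / (K ^ 8 * r ^ 3)) \<partial>lborel)
        + ((\<integral>x. ?i ?\<rho> x * (1 / ?q) \<partial>lborel) + (\<integral>x. ?i r x * (exp (- 4 * ?\<rho>) / ?q) \<partial>lborel))"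
        by (simp only: add parts I)
      moreover have "r > 0" using r by simp
      ultimately show ?thesis by (simp only: e1 e2 vol[OF \<open>r > 0\<close>] vol[OF \<rho>])
    qed
    also have "?\<rho> ^ 3 = r powr (1/4)" using r by (subst powr_power_eq) auto
    also have "unit_vol * r ^ 3 * (1 / (K ^ 8 * r ^ 3)) = unit_vol / K ^ 8" using r by simp
    finally show ?thesis by (simp add: algebra_simps)
  qed
  show ?thesis
  proof (rule tendstoI)
    fix d :: real assume d: "d > 0"
    define K where "K = max 1 (4 * unit_vol / d)"
    have K: "K \<ge> 1" "K > 0" by (auto simp: K_def)
    have Kd: "unit_vol / K ^ 8 \<le> d / 4"
    proof -
      have "4 * unit_vol / d \<le> K ^ 1" by (simp add: K_def)
      also have "\<dots> \<le> K ^ 8" using K(1) by (intro power_increasing) auto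
      finally show ?thesis using d K by (simp add: field_simps)
    qed
    have "eventually (\<lambda>n. K * exp c * T n < d / 4) sequentially"
      by (rule order_tendstoD(2)[where y = 0]) (rule tendsto_eq_intros refl T | use d in simp)+
    then obtain n where n: "n \<ge> n0" "K * exp c * T n < d / 4"
      using eventually_happens'[OF _ eventually_conj[OF eventually_ge_at_top[of n0]]] by force
    define M where "M = real n"
    have M: "M \<ge> R0" using n n0 by (simp add: M_def)
    have "((\<lambda>r::real. 1 / r powr (1/3)) \<longlongrightarrow> 0) at_top" by real_asymp
    from tendsto_mult_right_zero[OF this, of "ball_sq M (\<lambda>x. (v x)\<^sup>2)"]
    have "((\<lambda>r. ball_sq M (\<lambda>x. (v x)\<^sup>2) / r powr (1/3)) \<longlongrightarrow> 0) at_top" by simp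
    then have ev1: "eventually (\<lambda>r. ball_sq M (\<lambda>x. (v x)\<^sup>2) / r powr (1/3) < d / 4) at_top"
      using d by (intro order_tendstoD) auto
    have "((\<lambda>r::real. r powr (1/4) / r powr (1/3) + r ^ 3 * exp (- 4 * r powr (1/12)) / r powr (1/3)) \<longlongrightarrow> 0) at_top"
      by real_asymp
    then have "((\<lambda>r::real. unit_vol * (r powr (1/4) / r powr (1/3) + r ^ 3 * exp (- 4 * r powr (1/12)) / r powr (1/3))) \<longlongrightarrow> 0) at_top"
      by (rule tendsto_mult_right_zero)
    then have ev2: "eventually (\<lambda>r. unit_vol * (r powr (1/4) / r powr (1/3) + r ^ 3 * exp (- 4 * r powr (1/12)) / r powr (1/3)) < d / 4) at_top"
      using d by (intro order_tendstoD) auto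
    show "eventually (\<lambda>r. dist (ball_sq r (\<lambda>x. (v x)\<^sup>2) / r powr (1/3)) 0 < d) at_top"
      using ev1 ev2 eventually_ge_at_top[of 1]
    proof eventually_elim
      case (elim r)
      have "ball_sq r (\<lambda>x. (v x)\<^sup>2) / r powr (1/3) < d"
        using bound[OF M_def M K(2) elim(3)] elim(1,2) Kd n(2) by linarith
      moreover have "0 \<le> ball_sq r (\<lambda>x. (v x)\<^sup>2) / r powr (1/3)" by (simp add: ball_sq_nonneg)
      ultimately show ?case by simp
    qed
  qed
qed

section \<open>The Liouville theorem for the variable exponent\<close>

text \<open>Identifies the square integrable gradient of the function space with the one in the equation.\<close>

lemma weak_gradient_unique:
  assumes "has_weak_gradient u G" "has_weak_gradient u H"
    and g: "g \<in> borel_measurable borel" "AE x in lborel. G x $ i $ j = g x"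
  shows "AE x in lborel. H x $ i $ j = g (x :: real^3)"
proof -
  have G: "locally_integrable (\<lambda>x. G x $ i $ j)" and H: "locally_integrable (\<lambda>x. H x $ i $ j)"
    using assms by (auto simp: has_weak_gradient_def)
  have Hm: "(\<lambda>x. H x $ i $ j) \<in> borel_measurable lebesgue" and Gm: "(\<lambda>x. G x $ i $ j) \<in> borel_measurable lebesgue"
    using G H by (auto simp: locally_integrable_def)
  obtain h where h: "h \<in> borel_measurable borel" "AE x in lborel. H x $ i $ j = h x"
    using completion_ex_borel_measurable_real[OF Hm] by auto
  have Lg: "Lloc 1 g" by (rule locally_integrable_Lloc[OF G g])
  have Lh: "Lloc 1 h" by (rule locally_integrable_Lloc[OF H h])
  have "AE x in lborel. h x - g x = 0"
  proof (rule fundamental_lemma_of_variations)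
    show "Lloc 1 (\<lambda>x. h x - g x)" by (rule Lloc_diff[OF Lh Lg])
    fix \<phi> :: "real^3 \<Rightarrow> real" and r assume \<phi>: "smooth_fun \<phi>" "supp_in r \<phi>"
    have "regular_dist (\<lambda>x. G x $ i $ j) \<phi> = regular_dist (\<lambda>x. H x $ i $ j) \<phi>"
      using assms(1,2) test_functionsI[OF \<phi>] unfolding has_weak_gradient_def by metis
    then have "(\<integral>x. g x * \<phi> x \<partial>lborel) = (\<integral>x. h x * \<phi> x \<partial>lborel)"
      by (simp add: regular_dist_lborel[OF Gm g \<phi>(1)] regular_dist_lborel[OF Hm h \<phi>(1)])
    moreover have "integrable lborel (\<lambda>x. g x * \<phi> x)" "integrable lborel (\<lambda>x. h x * \<phi> x)"
      by (rule integrable_mult_supp[OF Lg smooth_fun_continuous[OF \<phi>(1)] \<phi>(2)],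
          rule integrable_mult_supp[OF Lh smooth_fun_continuous[OF \<phi>(1)] \<phi>(2)])
    ultimately show "(\<integral>x. (h x - g x) * \<phi> x \<partial>lborel) = 0" by (simp add: left_diff_distrib)
  qed
  with h(2) show ?thesis by eventually_elim simp
qed

lemma borel_power_integrable:
  fixes f :: "real^3 \<Rightarrow> real"
  assumes w: "integrable lebesgue w" and f: "f \<in> borel_measurable lebesgue" "\<And>x. \<bar>f x\<bar> ^ p \<le> w x"
    and g: "g \<in> borel_measurable borel" "AE x in lborel. f x = g x"
  shows "integrable lborel (\<lambda>x. \<bar>g x\<bar> ^ p)"
proof (rule iffD1[OF integral_lebesgue_lborel(2)])
  note [measurable] = f(1) g(1)
  show fm: "(\<lambda>x. \<bar>f x\<bar> ^ p) \<in> borel_measurable lebesgue" by measurable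
  show "integrable lebesgue (\<lambda>x. \<bar>f x\<bar> ^ p)"
    by (rule Bochner_Integration.integrable_bound[OF w fm])
      (use f(2) in \<open>auto intro!: AE_I2 intro: order_trans[OF _ abs_ge_self]\<close>)
  show "(\<lambda>x. \<bar>g x\<bar> ^ p) \<in> borel_measurable borel" by measurable
  show "AE x in lborel. \<bar>f x\<bar> ^ p = \<bar>g x\<bar> ^ p" using g(2) by eventually_elim simp
qed

text \<open>Passing to Borel representatives changes no integral. For a divergence-free test field the three
pressure terms add up to the value of the distribution \<open>P\<close> at the divergence, which is 0.\<close>

lemma stationary_flow_of_solution:
  fixes u :: "real^3 \<Rightarrow> real^3"
  assumes u: "u \<in> homogeneous_H1" and NS: "stationary_NS_solution u"
  obtains U G where "stationary_flow U G" "\<And>i. AE x in lborel. u x $ i = U i x"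
proof -
  obtain G where u6: "u \<in> Lebesgue_space 6" and wg: "has_weak_gradient u G" and G2: "G \<in> Lebesgue_space 2"
    using u by (auto simp: homogeneous_H1_def)
  obtain G' P where wg': "has_weak_gradient u G'" and P: "distribution P"
    and li: "\<And>i. locally_integrable (\<lambda>x. (G' x *v u x) $ i)"
    and eq: "\<And>i \<phi>. \<phi> \<in> test_functions \<Longrightarrow> - dist_laplacian (regular_dist (\<lambda>x. u x $ i)) \<phi>
         + regular_dist (\<lambda>x. (G' x *v u x) $ i) \<phi> + dist_deriv i P \<phi> = 0"
    and div: "\<And>\<phi>. \<phi> \<in> test_functions \<Longrightarrow> (\<Sum>i\<in>UNIV. dist_deriv i (regular_dist (\<lambda>x. u x $ i)) \<phi>) = 0"
    using NS unfolding stationary_NS_solution_def by blast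
  have um: "(\<lambda>x. u x $ i) \<in> borel_measurable lebesgue" for i
    using wg by (auto simp: has_weak_gradient_def locally_integrable_def)
  have Gm: "(\<lambda>x. G x $ i $ j) \<in> borel_measurable lebesgue" for i j
    using wg by (auto simp: has_weak_gradient_def locally_integrable_def)
  have "\<forall>i. \<exists>g. g \<in> borel_measurable borel \<and> (AE x in lborel. u x $ i = g x)"
    using completion_ex_borel_measurable_real[OF um] by auto
  from choice[OF this] obtain U where U: "\<And>i. U i \<in> borel_measurable borel" "\<And>i. AE x in lborel. u x $ i = U i x"
    by blast
  have "\<forall>p. \<exists>g. g \<in> borel_measurable borel \<and> (AE x in lborel. G x $ fst p $ snd p = g x)"
    using completion_ex_borel_measurable_real[OF Gm] by auto
  from choice[OF this] obtain g0 where g0: "\<And>p. g0 p \<in> borel_measurable borel"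
    "\<And>p. AE x in lborel. G x $ fst p $ snd p = g0 p x" by blast
  define g where "g i j = g0 (i, j)" for i j
  have g: "g i j \<in> borel_measurable borel" "AE x in lborel. G x $ i $ j = g i j x" for i j
    using g0(1)[of "(i, j)"] g0(2)[of "(i, j)"] by (simp_all add: g_def)
  have g': "AE x in lborel. G' x $ i $ j = g i j x" for i j
    by (rule weak_gradient_unique[OF wg wg' g])
  note regU = regular_dist_lborel[OF um U]
  have U6: "integrable lborel (\<lambda>x. \<bar>U i x\<bar> ^ 6)" for i
  proof (rule borel_power_integrable[OF _ um _ U])
    show "integrable lebesgue (\<lambda>x. norm (u x) powr 6)" using u6 by (simp add: Lebesgue_space_def)
    show "\<bar>u x $ i\<bar> ^ 6 \<le> norm (u x) powr 6" for x
      using power_mono[OF component_le_norm_cart[of "u x" i], of 6] by simp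
  qed
  have U4: "Lloc 4 (U i)" for i
    by (rule Lloc_mono[OF Lloc_global[OF U(1) U6]]) simp
  have gsq: "integrable lborel (\<lambda>x. (g i j x)\<^sup>2)" for i j
  proof -
    have "integrable lborel (\<lambda>x. \<bar>g i j x\<bar> ^ 2)"
    proof (rule borel_power_integrable[OF _ Gm _ g])
      show "integrable lebesgue (\<lambda>x. norm (G x) powr 2)" using G2 by (simp add: Lebesgue_space_def)
      show "\<bar>G x $ i $ j\<bar> ^ 2 \<le> norm (G x) powr 2" for x
      proof -
        have "\<bar>G x $ i $ j\<bar> \<le> norm (G x $ i)" by (rule component_le_norm_cart)
        also have "\<dots> \<le> norm (G x)" by (rule Finite_Cartesian_Product.norm_nth_le)
        finally show ?thesis using power_mono[of "\<bar>G x $ i $ j\<bar>" "norm (G x)" 2] by simp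
      qed
    qed
    then show ?thesis by simp
  qed
  have weak: "(\<integral>x. U i x * partial_deriv j \<phi> x \<partial>lborel) = - (\<integral>x. g i j x * \<phi> x \<partial>lborel)"
    if \<phi>: "smooth_fun \<phi>" "supp_in r \<phi>" for \<phi> r i j
  proof -
    have "dist_deriv j (regular_dist (\<lambda>x. u x $ i)) \<phi> = regular_dist (\<lambda>x. G x $ i $ j) \<phi>"
      using wg test_functionsI[OF \<phi>] by (simp add: has_weak_gradient_def)
    then show ?thesis
      by (simp add: dist_deriv_def regU[OF smooth_fun_partial_deriv[OF \<phi>(1)]]
          regular_dist_lborel[OF Gm g \<phi>(1)])
  qed
  have "stationary_flow U g"
  proof
    show "Lloc 4 (U i)" for i by (rule U4)
    show "g i j \<in> borel_measurable borel" for i j by (rule g(1))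
    show "integrable lborel (\<lambda>x. (g i j x)\<^sup>2)" for i j by (rule gsq)
    show "(\<integral>x. U i x * partial_deriv j \<phi> x \<partial>lborel) = - (\<integral>x. g i j x * \<phi> x \<partial>lborel)"
      if "smooth_fun \<phi>" "supp_in r \<phi>" for \<phi> r i j by (rule weak[OF that])
    show "(\<Sum>i\<in>UNIV. \<integral>x. U i x * partial_deriv i \<phi> x \<partial>lborel) = 0"
      if "smooth_fun \<phi>" "supp_in r \<phi>" for \<phi> r
      using div[OF test_functionsI[OF that]]
      by (simp add: dist_deriv_def regU[OF smooth_fun_partial_deriv[OF that(1)]] sum_negf)
    fix \<Phi> :: "3 \<Rightarrow> real^3 \<Rightarrow> real" and r
    assume \<Phi>: "\<And>i. smooth_fun (\<Phi> i)" "\<And>i. supp_in r (\<Phi> i)"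
      and dv: "\<And>x. (\<Sum>i\<in>UNIV. partial_deriv i (\<Phi> i) x) = 0"
    note d\<Phi> = smooth_fun_partial_deriv[OF \<Phi>(1)] supp_in_partial_deriv[OF \<Phi>(2,1)]
    have lap: "dist_laplacian (regular_dist (\<lambda>x. u x $ i)) (\<Phi> i) =
        - (\<Sum>k\<in>UNIV. \<integral>x. g i k x * partial_deriv k (\<Phi> i) x \<partial>lborel)" for i
      by (simp add: dist_laplacian_def dist_deriv_def regU[OF smooth_fun_partial_deriv[OF d\<Phi>(1)]]
          weak[OF d\<Phi>] sum_negf)
    have convection: "regular_dist (\<lambda>x. (G' x *v u x) $ i) (\<Phi> i) =
        (\<Sum>k\<in>UNIV. \<integral>x. g i k x * (U k x * \<Phi> i x) \<partial>lborel)" for i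
    proof -
      note [measurable] = g(1) U(1)
      have int: "integrable lborel (\<lambda>x. g i k x * (U k x * \<Phi> i x))" for k
      proof (rule ball_Cauchy_Schwarz(1))
        show "Lloc 2 (g i k)" by (rule Lloc_global[OF g(1)]) (simp add: gsq)
        show "Lloc 2 (\<lambda>x. U k x * \<Phi> i x)"
          using Lloc_mult[of 2 "U k" "\<Phi> i"] U4 Lloc_smooth[OF \<Phi>(1)] by simp
        show "supp_in r (\<lambda>x. U k x * \<Phi> i x)" by (rule supp_in_mult(2)[OF \<Phi>(2)])
      qed
      have "regular_dist (\<lambda>x. (G' x *v u x) $ i) (\<Phi> i) = (\<integral>x. (\<Sum>k\<in>UNIV. g i k x * U k x) * \<Phi> i x \<partial>lborel)"
      proof (rule regular_dist_lborel[OF _ _ _ \<Phi>(1)])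
        show "(\<lambda>x. (G' x *v u x) $ i) \<in> borel_measurable lebesgue"
          using li by (simp add: locally_integrable_def)
        show "(\<lambda>x. \<Sum>k\<in>UNIV. g i k x * U k x) \<in> borel_measurable borel" by measurable
        have "AE x in lborel. \<forall>k. G' x $ i $ k = g i k x" using g' by (intro eventually_all_finite)
        moreover have "AE x in lborel. \<forall>k. u x $ k = U k x" using U(2) by (intro eventually_all_finite)
        ultimately show "AE x in lborel. (G' x *v u x) $ i = (\<Sum>k\<in>UNIV. g i k x * U k x)"
          by eventually_elim (simp add: matrix_vector_mult_def)
      qed
      also have "\<dots> = (\<integral>x. (\<Sum>k\<in>UNIV. g i k x * (U k x * \<Phi> i x)) \<partial>lborel)"
        by (simp add: sum_distrib_right mult.assoc)
      also have "\<dots> = (\<Sum>k\<in>UNIV. \<integral>x. g i k x * (U k x * \<Phi> i x) \<partial>lborel)"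
        using int by (intro Bochner_Integration.integral_sum)
      finally show ?thesis .
    qed
    have "(\<Sum>i\<in>UNIV. dist_deriv i P (\<Phi> i)) = - P (\<lambda>x. \<Sum>i\<in>UNIV. partial_deriv i (\<Phi> i) x)"
      using distribution_sum[OF P, of UNIV "\<lambda>i. partial_deriv i (\<Phi> i)"] test_functionsI[OF d\<Phi>]
      by (simp add: dist_deriv_def sum_negf)
    also have "\<dots> = 0"
      using distribution_sum[OF P, of "{} :: 3 set" "\<lambda>i. partial_deriv i (\<Phi> i)"] by (simp add: dv)
    finally have pressure: "(\<Sum>i\<in>UNIV. dist_deriv i P (\<Phi> i)) = 0" .
    have "(\<Sum>i\<in>UNIV. - dist_laplacian (regular_dist (\<lambda>x. u x $ i)) (\<Phi> i)
         + regular_dist (\<lambda>x. (G' x *v u x) $ i) (\<Phi> i) + dist_deriv i P (\<Phi> i)) = 0"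
      using eq[OF test_functionsI[OF \<Phi>]] by simp
    then show "(\<Sum>i\<in>UNIV. \<Sum>k\<in>UNIV. \<integral>x. g i k x * partial_deriv k (\<Phi> i) x \<partial>lborel) +
        (\<Sum>i\<in>UNIV. \<Sum>k\<in>UNIV. \<integral>x. g i k x * (U k x * \<Phi> i x) \<partial>lborel) = 0"
      by (simp add: sum.distrib pressure lap convection)
  qed
  then show ?thesis using U(2) by (rule that)
qed

theorem corollary1p1:
  fixes R0 :: real and u :: "real^3 \<Rightarrow> real^3"
  assumes "R0 > 3/2"
    and "u \<in> homogeneous_H1"
    and "stationary_NS_solution u"
    and "u \<in> var_Lebesgue_space {x. norm x \<ge> R0} (\<lambda>x. 9/2 + eps_bar R0 x)"
  shows "AE x in lebesgue. u x = 0"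
proof -
  obtain U G where flow: "stationary_flow U G" and U: "\<And>i. AE x in lborel. u x $ i = U i x"
    using stationary_flow_of_solution[OF assms(2,3)] by blast
  interpret stationary_flow U G by (rule flow)
  note [measurable] = Lloc_measurable[OF U4]
  let ?\<Omega> = "{x :: real^3. R0 \<le> norm x}" and ?p = "\<lambda>x. 9/2 + eps_bar R0 x"
  have R0: "R0 > 0" using assms(1) by simp
  have \<Omega>[measurable]: "?\<Omega> \<in> sets borel" by measurable
  have "var_norm ?\<Omega> ?p u < \<infinity>" using assms(4) by (simp add: var_Lebesgue_space_def)
  then obtain l where l: "0 < l" "(\<integral>\<^sup>+x. ennreal (norm (u x /\<^sub>R l) powr ?p x) \<partial>lebesgue_on ?\<Omega>) \<le> 1"
    unfolding var_norm_def by (auto simp: INF_less_iff)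
  define v where "v x = sqrt (\<Sum>i\<in>UNIV. (U i x)\<^sup>2) / l" for x
  have v0: "v x \<ge> 0" for x using l(1) by (simp add: v_def sum_nonneg)
  have vm[measurable]: "v \<in> borel_measurable borel" unfolding v_def[abs_def] by measurable
  have ae: "AE x in lborel. \<forall>i. u x $ i = U i x" using U by (intro eventually_all_finite)
  have lv: "l\<^sup>2 * (v x)\<^sup>2 = (\<Sum>i\<in>UNIV. (U i x)\<^sup>2)" for x
    using l(1) by (simp add: v_def power_divide sum_nonneg)
  have "Lloc 2 (\<lambda>x. (1 / l\<^sup>2) * (\<Sum>i\<in>UNIV. (U i x)\<^sup>2))"
    by (intro Lloc_cmult Lloc_sum U_sq)
  also have "(\<lambda>x. (1 / l\<^sup>2) * (\<Sum>i\<in>UNIV. (U i x)\<^sup>2)) = (\<lambda>x. (v x)\<^sup>2)"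
    using l(1) by (simp flip: lv)
  finally have v2: "Lloc 2 (\<lambda>x. (v x)\<^sup>2)" .
  then have v4: "Lloc 4 v"
    using vm by (simp add: Lloc_def flip: power_mult)
  have [measurable]: "eps_bar R0 \<in> borel_measurable borel" unfolding eps_bar_def[abs_def] by measurable
  have m: "integrable lborel (\<lambda>x. indicator ?\<Omega> x * v x powr ?p x)"
  proof (rule integrableI_nonneg)
    show "(\<lambda>x. indicator ?\<Omega> x * v x powr ?p x) \<in> borel_measurable lborel" by measurable
    show "AE x in lborel. 0 \<le> indicator ?\<Omega> x * v x powr ?p x" by (intro AE_I2) simp
    have "(\<integral>\<^sup>+x. ennreal (indicator ?\<Omega> x * v x powr ?p x) \<partial>lborel) =
        (\<integral>\<^sup>+x. ennreal (indicator ?\<Omega> x * v x powr ?p x) \<partial>lebesgue)"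
      by (simp add: nn_integral_completion)
    also have "\<dots> = (\<integral>\<^sup>+x. ennreal (norm (u x /\<^sub>R l) powr ?p x) * indicator ?\<Omega> x \<partial>lebesgue)"
    proof (rule nn_integral_cong_AE)
      show "AE x in lebesgue. ennreal (indicator ?\<Omega> x * v x powr ?p x) =
          ennreal (norm (u x /\<^sub>R l) powr ?p x) * indicator ?\<Omega> x"
        unfolding AE_lebesgue_iff using ae
      proof eventually_elim
        case (elim x)
        then have "norm (u x) = sqrt (\<Sum>i\<in>UNIV. (U i x)\<^sup>2)"
          by (simp add: norm_vec_def L2_set_def)
        then have "norm (u x /\<^sub>R l) = v x"
          using l(1) by (simp add: v_def divide_inverse mult.commute)
        then show ?case by (simp add: indicator_def)
      qed
    qed
    also have "\<dots> = (\<integral>\<^sup>+x. ennreal (norm (u x /\<^sub>R l) powr ?p x) \<partial>lebesgue_on ?\<Omega>)"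
      by (rule nn_integral_restrict_space[symmetric]) simp
    also have "\<dots> < \<infinity>" using l(2) by (rule le_less_trans) simp
    finally show "(\<integral>\<^sup>+x. ennreal (indicator ?\<Omega> x * v x powr ?p x) \<partial>lborel) < \<infinity>" .
  qed
  have growth: "((\<lambda>r. ball_sq r (\<lambda>x. (v x)\<^sup>2) / r powr (1/3)) \<longlongrightarrow> 0) at_top"
    by (rule fourth_power_growth[OF v4 v0 R0 m])
  have Y_le: "L4_mass r \<le> 3 * (l\<^sup>2)\<^sup>2 * ball_sq r (\<lambda>x. (v x)\<^sup>2)" for r
  proof -
    have "ball_sq r (\<lambda>x. (U i x)\<^sup>2) \<le> (l\<^sup>2)\<^sup>2 * ball_sq r (\<lambda>x. (v x)\<^sup>2)" for i
      unfolding ball_sq_cmult[symmetric]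
    proof (rule ball_sq_mono[OF Lloc_cmult[OF v2]])
      fix x :: "real^3"
      have "(U i x)\<^sup>2 \<le> (\<Sum>i\<in>UNIV. (U i x)\<^sup>2)" by (rule member_le_sum) auto
      then show "\<bar>(U i x)\<^sup>2\<bar> \<le> \<bar>l\<^sup>2 * (v x)\<^sup>2\<bar>" unfolding lv by simp
    qed
    then have "L4_mass r \<le> (\<Sum>i\<in>(UNIV :: 3 set). (l\<^sup>2)\<^sup>2 * ball_sq r (\<lambda>x. (v x)\<^sup>2))"
      unfolding L4_mass_def by (intro sum_mono)
    then show ?thesis by simp
  qed
  have "((\<lambda>r. L4_mass r / r powr (1/3)) \<longlongrightarrow> 0) at_top"
  proof (rule Lim_null_comparison)
    show "eventually (\<lambda>r. norm (L4_mass r / r powr (1/3)) \<le>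
        3 * (l\<^sup>2)\<^sup>2 * (ball_sq r (\<lambda>x. (v x)\<^sup>2) / r powr (1/3))) at_top"
      using Y_le L4_mass_nonneg by (intro always_eventually allI) (simp add: divide_right_mono)
    show "((\<lambda>r. 3 * (l\<^sup>2)\<^sup>2 * (ball_sq r (\<lambda>x. (v x)\<^sup>2) / r powr (1/3))) \<longlongrightarrow> 0) at_top"
      using growth by (rule tendsto_mult_right_zero)
  qed
  from flow_vanishes[OF this] have "AE x in lborel. \<forall>i. U i x = 0" by (intro eventually_all_finite)
  with ae have "AE x in lborel. u x = 0" by eventually_elim (simp add: vec_eq_iff)
  then show ?thesis by (simp add: AE_lebesgue_iff)
qed

end
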